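(* Let $(X,0)$ be a germ of a closed semialgebraic subset of $(\mathbb{R}^n,0)$ of dimension $k$. Let $f:(X,0)\to(\mathbb{R}^n,0)$ be a bi-Lipschitz embedding (not assumed semialgebraic) whose image is a germ of a closed semialgebraic set. If $n\ge 4k$, then there exists a germ of a tame bi-Lipschitz homeomorphism $F:(\mathbb{R}^n,0)\to(\mathbb{R}^n,0)$ such that $F|_X=f$. Moreover, there is a continuous family of germs of tame bi-Lipschitz homeomorphisms $F_t:(\mathbb{R}^n,0)\to(\mathbb{R}^n,0)$, $t\in\mathbb{R}$ (continuous in $(x,t)$), such that $F_0$ is the identity and $F_1|_X=f$.
   Context: Sets carry the outer metric, i.e. the restriction of the Euclidean distance. A bi-Lipschitz embedding $f:(X,0)\to(\mathbb{R}^n,0)$ is a germ at $0$ of a map such that $f((X,0))=(Y,0)$ is a germ of a closed set and $f:(X,0)\to(Y,0)$ is a germ of a bijection with $f$ and $f^{-1}$ Lipschitz. A germ of a bi-Lipschitz homeomorphism of $(\mathbb{R}^n,0)$ is called tame if it is a composition of germs of bi-Lipschitz homeomorphisms of the form $(x_1,\dots,x_n)\mapsto(x_1,\dots,x_{n-1},x_n+p(x_1,\dots,x_{n-1}))$ (fixing $0$) and linear mappings of $\mathbb{R}^n$ with determinant one. *)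

theory Defs
  imports "HOL-Analysis.Analysis"
begin

text \<open>Germs at the origin are handled through representatives: a set germ is represented by a set,
  a map germ by a total function whose values matter only near \<open>0\<close> (and, for a germ defined
  on \<open>(X,0)\<close>, only on \<open>X\<close>). Equality of germs is equality on a neighbourhood of \<open>0\<close>.\<close>

definition set_germ_eq :: "'a::real_normed_vector set \<Rightarrow> 'a set \<Rightarrow> bool" where
  "set_germ_eq X Y \<longleftrightarrow> (\<forall>\<^sub>F x in nhds 0. x \<in> X \<longleftrightarrow> x \<in> Y)"

definition map_germ_eq_on ::
    "'a::real_normed_vector set \<Rightarrow> ('a \<Rightarrow> 'b) \<Rightarrow> ('a \<Rightarrow> 'b) \<Rightarrow> bool" where
  "map_germ_eq_on X f g \<longleftrightarrow> (\<forall>\<^sub>F x in nhds 0. x \<in> X \<longrightarrow> f x = g x)"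

inductive semialgebraic :: "'a::euclidean_space set \<Rightarrow> bool" where
  pos: "real_polynomial_function p \<Longrightarrow> semialgebraic {x. p x > 0}"
| zero: "real_polynomial_function p \<Longrightarrow> semialgebraic {x. p x = 0}"
| union: "semialgebraic A \<Longrightarrow> semialgebraic B \<Longrightarrow> semialgebraic (A \<union> B)"
| inter: "semialgebraic A \<Longrightarrow> semialgebraic B \<Longrightarrow> semialgebraic (A \<inter> B)"
| compl: "semialgebraic A \<Longrightarrow> semialgebraic (- A)"

definition closed_semialgebraic_germ :: "'a::euclidean_space set \<Rightarrow> bool" where
  "closed_semialgebraic_germ X \<longleftrightarrow>
     (\<exists>Z. closed Z \<and> semialgebraic Z \<and> 0 \<in> Z \<and> set_germ_eq X Z)"

text \<open>The dimension of a nonempty semialgebraic set is the largest \<open>d\<close> such that the set contains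
  a homeomorphic copy of \<open>\<real>\<^sup>d\<close> (equivalently, of an open cube in \<open>\<real>\<^sup>d\<close>); here \<open>\<real>\<^sup>d\<close> is a linear
  subspace of dimension \<open>d\<close>. For the empty set the value is unspecified.\<close>

definition semialg_dim :: "'a::euclidean_space set \<Rightarrow> nat" where
  "semialg_dim A = Max {d. \<exists>S V. subspace (S :: 'a set) \<and> dim S = d \<and> V \<subseteq> A \<and> S homeomorphic V}"

text \<open>The dimension of the germ \<open>(X,0)\<close> is the dimension of all sufficiently small representatives.
  As the dimension is monotone, this is the minimum of the dimensions of \<open>X \<inter> ball 0 r\<close>.\<close>

definition germ_dim :: "'a::euclidean_space set \<Rightarrow> nat" where
  "germ_dim X = (INF r\<in>{0<..}. semialg_dim (X \<inter> ball 0 r))"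

text \<open>The germ \<open>f : (X,0) \<rightarrow> (Y,0)\<close> is a germ of a bijection, and \<open>f\<close> and its inverse are Lipschitz
  with respect to the outer metric. If \<open>Y\<close> is a closed germ, then \<open>f\<close> is a bi-Lipschitz embedding
  of \<open>(X,0)\<close> with image \<open>(Y,0)\<close>.\<close>

definition bilipschitz_germ ::
    "'a::real_normed_vector set \<Rightarrow> 'b::real_normed_vector set \<Rightarrow> ('a \<Rightarrow> 'b) \<Rightarrow> bool" where
  "bilipschitz_germ X Y f \<longleftrightarrow> f 0 = 0 \<and>
     (\<exists>U. open U \<and> 0 \<in> U \<and> set_germ_eq (f ` (X \<inter> U)) Y \<and> inj_on f (X \<inter> U) \<and>
          (\<exists>C. lipschitz_on C (X \<inter> U) f) \<and>
          (\<exists>C. lipschitz_on C (f ` (X \<inter> U)) (inv_into (X \<inter> U) f)))"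

text \<open>The coordinates of \<open>\<real>\<^sup>n\<close> are indexed by a linearly ordered finite type, so that there is a
  last coordinate.\<close>

definition last_index :: "'n::{finite,linorder}" where
  "last_index = Max UNIV"

text \<open>The map \<open>(x\<^sub>1,\<dots>,x\<^sub>n) \<mapsto> (x\<^sub>1,\<dots>,x\<^sub>n\<^sub>-\<^sub>1, x\<^sub>n + p(x\<^sub>1,\<dots>,x\<^sub>n\<^sub>-\<^sub>1))\<close>, where \<open>p\<close> is
  encoded as a function on \<open>\<real>\<^sup>n\<close> that does not depend on the last coordinate.\<close>

definition elementary_map :: "(real^'n::{finite,linorder} \<Rightarrow> real^'n::{finite,linorder}) \<Rightarrow> bool" where
  "elementary_map F \<longleftrightarrow>
     (\<exists>p. (\<forall>x y. (\<forall>i. i \<noteq> last_index \<longrightarrow> x $ i = y $ i) \<longrightarrow> p x = p y) \<and>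
          F = (\<lambda>x. \<chi> i. if i = last_index then x $ i + p x else x $ i))"

inductive tame_composition :: "(real^'n::{finite,linorder} \<Rightarrow> real^'n::{finite,linorder}) \<Rightarrow> bool" where
  elementary: "elementary_map F \<Longrightarrow> bilipschitz_germ UNIV UNIV F \<Longrightarrow> tame_composition F"
| linear: "linear F \<Longrightarrow> det (matrix F) = 1 \<Longrightarrow> tame_composition F"
| comp: "tame_composition F \<Longrightarrow> tame_composition G \<Longrightarrow> tame_composition (F \<circ> G)"
| germ_eq: "tame_composition F \<Longrightarrow> map_germ_eq_on UNIV F G \<Longrightarrow> tame_composition G"

definition tame_germ :: "(real^'n::{finite,linorder} \<Rightarrow> real^'n::{finite,linorder}) \<Rightarrow> bool" where
  "tame_germ F \<longleftrightarrow> bilipschitz_germ UNIV UNIV F \<and> tame_composition F"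

text \<open>Continuity in \<open>(x,t)\<close> of a family of germs at \<open>0\<close>, \<open>t \<in> \<real>\<close>: the family is jointly continuous
  on a neighbourhood of \<open>{0} \<times> \<real>\<close>. The size of the neighbourhood of \<open>0\<close> may depend on \<open>t\<close>.\<close>

definition continuous_germ_family ::
    "(real \<Rightarrow> 'a::real_normed_vector \<Rightarrow> 'b::topological_space) \<Rightarrow> bool" where
  "continuous_germ_family F \<longleftrightarrow>
     (\<exists>W. open W \<and> {0} \<times> UNIV \<subseteq> W \<and> continuous_on W (\<lambda>(x, t). F t x))"

end

theory Submission
  imports Defs "HOL-Computational_Algebra.Polynomial"
begin

text \<open>Choose complementary subspaces \<open>V\<close>, \<open>W\<close> such that the projection along \<open>W\<close> is bi-Lipschitz on
  \<open>X\<close> and the one along \<open>V\<close> is bi-Lipschitz on \<open>Y\<close>. A shear in direction \<open>W\<close> moves \<open>x = x\<^sub>V + x\<^sub>W\<close>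
  to \<open>x\<^sub>V + f(x)\<^sub>W\<close>, and a shear in direction \<open>V\<close> moves this point to \<open>f(x)\<close>. Both shears are given by
  Lipschitz functions extended from \<open>X\<close>, and scaling them by \<open>t\<close> gives the isotopy.

  Such \<open>V\<close>, \<open>W\<close> exist because the limits of secants of a \<open>k\<close>-dimensional semialgebraic germ satisfy
  enough polynomial equations: \<open>X\<close> has algebraic dimension at most \<open>k\<close>, hence any \<open>2k + 1\<close> linear forms
  are algebraically dependent on the difference set \<open>X - X\<close>, and the initial form of the relation
  vanishes on the cone of secant limits. That the algebraic dimension is bounded by the topological
  one follows from Noether normalization: after a change of coordinates \<open>X\<close> lies in a
  \<open>d\<close>-dimensional triangular system over \<open>d\<close> coordinates that are independent on \<open>X\<close>, and then \<open>X\<close>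
  contains an open piece of the smooth part of this system.\<close>

section \<open>Polynomial functions and algebraic dependence\<close>

text \<open>The bound n >= 4k is a dimension count. The secant cones of X and Y have algebraic
  dimension at most 2k, so W can have dimension n - 2k. Then V, of dimension 2k, must miss both W
  and the secants of Y, which works when 2k <= n - 2k. Algebraic dimension is measured by growth:
  polynomials of degree at most m restrict to X in a space of dimension O(m^k). This passes to
  finite unions, and on X x X the exponent doubles, while more than 2k variables have too many
  monomials for such a space. The dimension in the hypothesis is topological, in terms of embedded
  copies of R^d, and is given for X only. As f is not semialgebraic, homeomorphic cells are the
  invariant that it transports to Y, and semialgebraicity of Y turns them back into algebraic
  information. Roots of the triangular system may be multiple, hence a passage to derivatives; the
  local graph then comes from the mean value theorem and invariance of domain.\<close>

inductive mpoly_fun :: "'i set \<Rightarrow> nat \<Rightarrow> (('i \<Rightarrow> real) \<Rightarrow> real) \<Rightarrow> bool" for J where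
  const: "mpoly_fun J m (\<lambda>_. c)"
| var: "i \<in> J \<Longrightarrow> mpoly_fun J m f \<Longrightarrow> mpoly_fun J (Suc m) (\<lambda>x. x i * f x)"
| add: "mpoly_fun J m f \<Longrightarrow> mpoly_fun J m g \<Longrightarrow> mpoly_fun J m (\<lambda>x. f x + g x)"

lemma mpoly_fun_Suc: "mpoly_fun J m f \<Longrightarrow> mpoly_fun J (Suc m) f"
  by (induction rule: mpoly_fun.induct) (auto intro: mpoly_fun.intros)

lemma mpoly_fun_mono_deg:
  assumes "mpoly_fun J m f" "m \<le> m'"
  shows "mpoly_fun J m' f"
  using assms(2,1) by (induction rule: dec_induct) (auto intro: mpoly_fun_Suc)

lemma mpoly_fun_mono_vars: "mpoly_fun J m f \<Longrightarrow> J \<subseteq> K \<Longrightarrow> mpoly_fun K m f"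
  by (induction rule: mpoly_fun.induct) (auto intro: mpoly_fun.intros)

lemma mpoly_fun_scale: "mpoly_fun J m f \<Longrightarrow> mpoly_fun J m (\<lambda>x. c * f x)"
proof (induction rule: mpoly_fun.induct)
  case (const m d)
  show ?case by (rule mpoly_fun.const)
next
  case (var i m f)
  from mpoly_fun.var[OF this(1,3)] show ?case by (simp add: mult_ac)
next
  case (add m f g)
  from mpoly_fun.add[OF this(3,4)] show ?case by (simp add: algebra_simps)
qed

lemma mpoly_fun_mult:
  assumes "mpoly_fun J m f" "mpoly_fun J m' g"
  shows "mpoly_fun J (m + m') (\<lambda>x. f x * g x)"
  using assms(1)
proof (induction rule: mpoly_fun.induct)
  case (const m d)
  show ?case using mpoly_fun_mono_deg[OF mpoly_fun_scale[OF assms(2)]] by simp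
next
  case (var i m f)
  from mpoly_fun.var[OF this(1,3)] show ?case by (simp add: mult_ac)
next
  case (add m f g)
  from mpoly_fun.add[OF this(3,4)] show ?case by (simp add: algebra_simps)
qed

lemma mpoly_fun_coord: "i \<in> J \<Longrightarrow> mpoly_fun J (Suc m) (\<lambda>x. x i)"
  using mpoly_fun.var[OF _ mpoly_fun.const[of J m 1]] by simp

lemma mpoly_fun_sum:
  "(\<And>a. a \<in> S \<Longrightarrow> mpoly_fun J m (f a)) \<Longrightarrow> mpoly_fun J m (\<lambda>x. \<Sum>a\<in>S. f a x)"
  by (induction S rule: infinite_finite_induct) (auto intro: mpoly_fun.intros)

lemma mpoly_fun_power: "mpoly_fun J m f \<Longrightarrow> mpoly_fun J (n * m) (\<lambda>x. f x ^ n)"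
proof (induction n)
  case 0
  show ?case using mpoly_fun.const[of J 0 1] by simp
next
  case (Suc n)
  from mpoly_fun_mult[OF Suc.prems Suc.IH[OF Suc.prems]] show ?case by simp
qed

lemma mpoly_fun_prod:
  "(\<And>a. a \<in> S \<Longrightarrow> mpoly_fun J m (f a)) \<Longrightarrow> mpoly_fun J (card S * m) (\<lambda>x. \<Prod>a\<in>S. f a x)"
proof (induction S rule: infinite_finite_induct)
  case (insert a S)
  then have "mpoly_fun J (m + card S * m) (\<lambda>x. f a x * (\<Prod>b\<in>S. f b x))"
    by (intro mpoly_fun_mult) auto
  with insert show ?case by simp
qed (auto intro: mpoly_fun.intros)

lemma mpoly_fun_compose:
  assumes "mpoly_fun J m f" "\<And>i. i \<in> J \<Longrightarrow> mpoly_fun K r (\<lambda>x. g x i)"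
  shows "mpoly_fun K (m * r) (\<lambda>x. f (g x))"
  using assms(1)
proof (induction rule: mpoly_fun.induct)
  case (var i m f)
  from mpoly_fun_mult[OF assms(2)[OF var(1)] var(3)] show ?case by simp
qed (auto intro: mpoly_fun.intros)

text \<open>Values outside \<open>J\<close> are ignored, so total assignments serve as points for
  every variable set, and polynomials can be moved between variable sets and index types.\<close>

lemma mpoly_fun_cong:
  "mpoly_fun J m f \<Longrightarrow> (\<And>i. i \<in> J \<Longrightarrow> x i = y i) \<Longrightarrow> f x = f y"
  by (induction rule: mpoly_fun.induct) auto

lemma mpoly_fun_continuous:
  assumes "mpoly_fun J m f" "\<And>i. i \<in> J \<Longrightarrow> continuous_on S (\<lambda>x. g x i)"
  shows "continuous_on S (\<lambda>x. f (g x))"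
  using assms by (induction rule: mpoly_fun.induct) (auto intro!: continuous_intros)

lemma mpoly_fun_degree0: "mpoly_fun J 0 f \<Longrightarrow> f x = f y"
proof -
  have "mpoly_fun J m f \<Longrightarrow> m = 0 \<Longrightarrow> f x = f y" for m
    by (induction rule: mpoly_fun.induct) auto
  then show "mpoly_fun J 0 f \<Longrightarrow> f x = f y" by simp
qed

definition homogeneous :: "nat \<Rightarrow> (('i \<Rightarrow> real) \<Rightarrow> real) \<Rightarrow> bool" where
  "homogeneous e f \<longleftrightarrow> (\<forall>t x. f (\<lambda>i. t * x i) = t ^ e * f x)"

text \<open>Both ends of this decomposition matter: the highest nonzero part makes a polynomial
  monic after a shear, the lowest one gives equations for limits of secants.\<close>

lemma homogeneous_decomp:
  assumes "mpoly_fun J m f"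
  obtains h where "\<And>e. mpoly_fun J e (h e)" "\<And>e. homogeneous e (h e)"
    "\<And>x. f x = (\<Sum>e\<le>m. h e x)"
proof -
  have "\<exists>h. (\<forall>e. mpoly_fun J e (h e) \<and> homogeneous e (h e)) \<and> (\<forall>x. f x = (\<Sum>e\<le>m. h e x))"
    using assms
  proof (induction rule: mpoly_fun.induct)
    case (const m c)
    define h where "h e = (\<lambda>x::'a \<Rightarrow> real. if e = 0 then c else 0)" for e :: nat
    have "\<forall>e. mpoly_fun J e (h e) \<and> homogeneous e (h e)"
      by (auto intro: mpoly_fun.intros simp: homogeneous_def h_def)
    moreover have "\<forall>x. c = (\<Sum>e\<le>m. h e x)" by (simp add: sum.delta h_def)
    ultimately show ?case by blast
  next
    case (var i m f)
    then obtain h where h: "\<And>e. mpoly_fun J e (h e)" "\<And>e. homogeneous e (h e)"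
      "\<And>x. f x = (\<Sum>e\<le>m. h e x)" by blast
    define h' where "h' e = (case e of 0 \<Rightarrow> (\<lambda>x. 0) | Suc d \<Rightarrow> (\<lambda>x. x i * h d x))" for e
    have "mpoly_fun J e (h' e)" "homogeneous e (h' e)" for e
      using h(1,2) \<open>i \<in> J\<close> by (auto simp: h'_def homogeneous_def algebra_simps
          intro: mpoly_fun.intros split: nat.split)
    moreover have "x i * f x = (\<Sum>e\<le>Suc m. h' e x)" for x
      by (simp add: sum.atMost_Suc_shift h'_def h(3) sum_distrib_left del: sum.atMost_Suc)
    ultimately show ?case by blast
  next
    case (add m f g)
    from add.IH(1) obtain h where h: "\<And>e. mpoly_fun J e (h e)" "\<And>e. homogeneous e (h e)"
      "\<And>x. f x = (\<Sum>e\<le>m. h e x)" by blast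
    from add.IH(2) obtain h' where h': "\<And>e. mpoly_fun J e (h' e)" "\<And>e. homogeneous e (h' e)"
      "\<And>x. g x = (\<Sum>e\<le>m. h' e x)" by blast
    have "mpoly_fun J e (\<lambda>x. h e x + h' e x)" for e
      using h(1) h'(1) by (simp add: mpoly_fun.add)
    moreover have "homogeneous e (\<lambda>x. h e x + h' e x)" for e
      using h(2)[of e] h'(2)[of e] by (simp add: homogeneous_def distrib_left)
    moreover have "\<forall>x. f x + g x = (\<Sum>e\<le>m. h e x + h' e x)"
      by (simp add: h(3) h'(3) sum.distrib)
    ultimately have "(\<forall>e. mpoly_fun J e (\<lambda>x. h e x + h' e x) \<and>
        homogeneous e (\<lambda>x. h e x + h' e x)) \<and>
        (\<forall>x. f x + g x = (\<Sum>e\<le>m. h e x + h' e x))" by simp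
    then show ?case by (rule exI[of _ "\<lambda>e x. h e x + h' e x"])
  qed
  then show ?thesis using that by blast
qed

text \<open>The bound \<open>m - e\<close>, rather than just \<open>m\<close>, is what later makes
  the leading coefficient constant when the exponent reaches the full degree.\<close>

lemma mpoly_fun_expand:
  assumes "mpoly_fun (insert z J) m f"
  obtains a where "\<And>e. e \<le> m \<Longrightarrow> mpoly_fun J (m - e) (a e)"
    "\<And>x. f x = (\<Sum>e\<le>m. a e x * x z ^ e)"
proof -
  have "\<exists>a. (\<forall>e\<le>m. mpoly_fun J (m - e) (a e)) \<and> (\<forall>x. f x = (\<Sum>e\<le>m. a e x * x z ^ e))"
    using assms
  proof (induction rule: mpoly_fun.induct)
    case (const m c)
    have "(\<Sum>e\<le>m. (if e = 0 then c else 0) * x z ^ e) = c" for x :: "'a \<Rightarrow> real"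
      by (simp add: if_distrib[of "\<lambda>u. u * _"] sum.delta cong: if_cong)
    then show ?case
      by (intro exI[of _ "\<lambda>e x. if e = 0 then c else 0"]) (auto intro: mpoly_fun.intros)
  next
    case (var i m f)
    then obtain a where a: "\<And>e. e \<le> m \<Longrightarrow> mpoly_fun J (m - e) (a e)"
      "\<And>x. f x = (\<Sum>e\<le>m. a e x * x z ^ e)" by blast
    show ?case
    proof (cases "i = z")
      case True
      define a' where "a' e = (case e of 0 \<Rightarrow> (\<lambda>x. 0) | Suc d \<Rightarrow> a d)" for e
      have "mpoly_fun J (Suc m - e) (a' e)" if "e \<le> Suc m" for e
        using that a(1) by (auto simp: a'_def intro: mpoly_fun.intros split: nat.split)
      moreover have "x i * f x = (\<Sum>e\<le>Suc m. a' e x * x z ^ e)" for x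
        by (simp add: sum.atMost_Suc_shift a'_def a(2) sum_distrib_left True mult_ac del: sum.atMost_Suc)
      ultimately show ?thesis by blast
    next
      case False
      define a' where "a' e = (if e \<le> m then (\<lambda>x. x i * a e x) else (\<lambda>x. 0))" for e
      have "mpoly_fun J (Suc m - e) (a' e)" if "e \<le> Suc m" for e
        using that a(1)[of e] False var(1)
        by (auto simp: a'_def Suc_diff_le intro: mpoly_fun.intros)
      moreover have "x i * f x = (\<Sum>e\<le>Suc m. a' e x * x z ^ e)" for x
        by (simp add: a'_def a(2) sum_distrib_left mult_ac)
      ultimately show ?thesis by blast
    qed
  next
    case (add m f g)
    from add.IH(1) obtain a where a: "\<And>e. e \<le> m \<Longrightarrow> mpoly_fun J (m - e) (a e)"
      "\<And>x. f x = (\<Sum>e\<le>m. a e x * x z ^ e)" by blast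
    from add.IH(2) obtain b where b: "\<And>e. e \<le> m \<Longrightarrow> mpoly_fun J (m - e) (b e)"
      "\<And>x. g x = (\<Sum>e\<le>m. b e x * x z ^ e)" by blast
    have "\<forall>e\<le>m. mpoly_fun J (m - e) (\<lambda>x. a e x + b e x)"
      using a(1) b(1) by (simp add: mpoly_fun.add)
    moreover have "\<forall>x. f x + g x = (\<Sum>e\<le>m. (a e x + b e x) * x z ^ e)"
      by (simp add: a(2) b(2) distrib_right sum.distrib)
    ultimately show ?case by (rule exI[of _ "\<lambda>e x. a e x + b e x", OF conjI])
  qed
  then show ?thesis using that by blast
qed

lemma mpoly_fun_line:
  assumes "mpoly_fun J m f"
  shows "\<exists>q :: real poly. \<forall>t. f (\<lambda>i. a i + t * b i) = poly q t"
  using assms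
proof (induction rule: mpoly_fun.induct)
  case (const m c)
  show ?case by (rule exI[of _ "[:c:]"]) simp
next
  case (var i m f)
  then obtain q :: "real poly" where "\<forall>t. f (\<lambda>i. a i + t * b i) = poly q t" by blast
  then show ?case by (intro exI[of _ "[:a i, b i:] * q"]) (simp add: algebra_simps)
next
  case (add m f g)
  then obtain q q' :: "real poly" where "\<forall>t. f (\<lambda>i. a i + t * b i) = poly q t"
    "\<forall>t. g (\<lambda>i. a i + t * b i) = poly q' t" by blast
  then show ?case by (intro exI[of _ "q + q'"]) simp
qed

text \<open>Real polynomials form an integral domain: on the line through \<open>u\<close> and
  \<open>v\<close> both restrictions are nonzero univariate polynomials, so their product is nonzero
  at some parameter.\<close>

lemma mpoly_fun_mult_nonzero:
  assumes "mpoly_fun J m f" "f u \<noteq> 0" "mpoly_fun J' m' g" "g v \<noteq> 0"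
  shows "\<exists>w. f w * g w \<noteq> 0"
proof -
  obtain p :: "real poly" where p: "\<And>t. f (\<lambda>i. u i + t * (v i - u i)) = poly p t"
    using mpoly_fun_line[OF assms(1), of u "\<lambda>i. v i - u i"] by blast
  obtain q :: "real poly" where q: "\<And>t. g (\<lambda>i. u i + t * (v i - u i)) = poly q t"
    using mpoly_fun_line[OF assms(3), of u "\<lambda>i. v i - u i"] by blast
  have "poly p 0 \<noteq> 0" using p[of 0] assms(2) by simp
  moreover have "poly q 1 \<noteq> 0" using q[of 1] assms(4) by simp
  ultimately have "p * q \<noteq> 0" by auto
  then obtain t where "poly (p * q) t \<noteq> 0" using poly_all_0_iff_0 by blast
  then have "f (\<lambda>i. u i + t * (v i - u i)) * g (\<lambda>i. u i + t * (v i - u i)) \<noteq> 0"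
    by (simp add: p q)
  then show ?thesis by (rule exI[of _ "\<lambda>i. u i + t * (v i - u i)"])
qed

text \<open>The relation is required to be nonzero as a function, which over the reals is the same as having
  a nonzero coefficient.\<close>

definition alg_dep :: "'i set \<Rightarrow> ('i \<Rightarrow> 'b \<Rightarrow> real) \<Rightarrow> 'b set \<Rightarrow> bool" where
  "alg_dep I g A \<longleftrightarrow>
     (\<exists>m f v. mpoly_fun I m f \<and> f v \<noteq> 0 \<and> (\<forall>x\<in>A. f (\<lambda>i. g i x) = 0))"

lemma alg_depI:
  "mpoly_fun I m f \<Longrightarrow> f v \<noteq> 0 \<Longrightarrow> (\<And>x. x \<in> A \<Longrightarrow> f (\<lambda>i. g i x) = 0) \<Longrightarrow> alg_dep I g A"
  unfolding alg_dep_def by (rule exI[of _ m], rule exI[of _ f], rule exI[of _ v]) simp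

lemma alg_depE:
  assumes "alg_dep I g A"
  obtains m f v where "mpoly_fun I m f" "f v \<noteq> 0" "\<And>x. x \<in> A \<Longrightarrow> f (\<lambda>i. g i x) = 0"
  using assms unfolding alg_dep_def by metis

lemma alg_dep_subset: "alg_dep I g A \<Longrightarrow> B \<subseteq> A \<Longrightarrow> alg_dep I g B"
  unfolding alg_dep_def by blast

lemma alg_dep_mono_vars: "alg_dep I g A \<Longrightarrow> I \<subseteq> K \<Longrightarrow> alg_dep K g A"
  unfolding alg_dep_def by (meson mpoly_fun_mono_vars)

lemma alg_dep_Un:
  assumes "alg_dep I g A" "alg_dep I g B"
  shows "alg_dep I g (A \<union> B)"
proof -
  obtain m f v where f: "mpoly_fun I m f" "f v \<noteq> 0" "\<And>x. x \<in> A \<Longrightarrow> f (\<lambda>i. g i x) = 0"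
    using assms(1) by (rule alg_depE) blast
  obtain m' f' v' where f': "mpoly_fun I m' f'" "f' v' \<noteq> 0" "\<And>x. x \<in> B \<Longrightarrow> f' (\<lambda>i. g i x) = 0"
    using assms(2) by (rule alg_depE) blast
  have "\<exists>w. f w * f' w \<noteq> 0" using mpoly_fun_mult_nonzero[of I m f v I m' f' v'] f f' by simp
  then obtain w where w: "f w * f' w \<noteq> 0" by blast
  have zero: "f (\<lambda>i. g i x) * f' (\<lambda>i. g i x) = 0" if "x \<in> A \<union> B" for x
    using that
  proof
    assume "x \<in> A" then show ?thesis by (simp only: f(3) mult_zero_left)
  next
    assume "x \<in> B" then show ?thesis by (simp only: f'(3) mult_zero_right)
  qed
  show ?thesis
  proof (rule alg_depI[of I "m + m'" "\<lambda>x. f x * f' x" w])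
    show "mpoly_fun I (m + m') (\<lambda>x. f x * f' x)" by (rule mpoly_fun_mult[OF f(1) f'(1)])
    show "f w * f' w \<noteq> 0" by (rule w)
    show "f (\<lambda>i. g i x) * f' (\<lambda>i. g i x) = 0" if "x \<in> A \<union> B" for x using that by (rule zero)
  qed
qed

lemma alg_dep_UN:
  assumes "finite S" "\<And>s. s \<in> S \<Longrightarrow> alg_dep I g (A s)"
  shows "alg_dep I g (\<Union>s\<in>S. A s)"
  using assms
proof (induction S rule: finite_induct)
  case empty
  \<comment> \<open>On the empty set the constant 1 is a relation, even in no variables; hence a set
    on which functions are independent is nonempty.\<close>
  show ?case
    using alg_depI[of I 0 "\<lambda>_. 1" _ "{}" g, OF mpoly_fun.const] by simp
next
  case (insert s S)
  then have "alg_dep I g (A s)" "alg_dep I g (\<Union>s\<in>S. A s)" by blast+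
  then show ?case using alg_dep_Un by simp
qed

section \<open>Spanning sets for spaces of functions, and linear relations by counting\<close>

definition spanned_on :: "'b set \<Rightarrow> ('b \<Rightarrow> real) set \<Rightarrow> ('b \<Rightarrow> real) \<Rightarrow> bool" where
  "spanned_on A B f \<longleftrightarrow> (\<exists>c. \<forall>x\<in>A. f x = (\<Sum>b\<in>B. c b * b x))"

lemma spanned_on_base:
  assumes "finite B" "b \<in> B"
  shows "spanned_on A B b"
proof -
  have "b x = (\<Sum>b'\<in>B. of_bool (b' = b) * b' x)" for x
  proof -
    have "(\<Sum>b'\<in>B. of_bool (b' = b) * b' x) = (\<Sum>b'\<in>{b}. b' x)"
      using assms by (intro sum.mono_neutral_cong_right) auto
    then show ?thesis by simp
  qed
  then show ?thesis unfolding spanned_on_def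
    by (intro exI[of _ "\<lambda>b'. of_bool (b' = b)"] ballI)
qed

lemma spanned_on_scale:
  assumes "spanned_on A B f"
  shows "spanned_on A B (\<lambda>x. r * f x)"
proof -
  obtain c where "\<forall>x\<in>A. f x = (\<Sum>b\<in>B. c b * b x)" using assms(1) unfolding spanned_on_def by blast
  then show ?thesis unfolding spanned_on_def
    by (intro exI[of _ "\<lambda>b. r * c b"]) (simp add: sum_distrib_left mult.assoc)
qed

lemma spanned_on_add:
  assumes "spanned_on A B f" "spanned_on A B g"
  shows "spanned_on A B (\<lambda>x. f x + g x)"
proof -
  obtain c where "\<forall>x\<in>A. f x = (\<Sum>b\<in>B. c b * b x)"
    using assms(1) unfolding spanned_on_def by blast
  moreover obtain d where "\<forall>x\<in>A. g x = (\<Sum>b\<in>B. d b * b x)"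
    using assms(2) unfolding spanned_on_def by blast
  ultimately show ?thesis unfolding spanned_on_def
    by (intro exI[of _ "\<lambda>b. c b + d b"]) (simp add: sum.distrib distrib_right)
qed

lemma spanned_on_sum:
  "(\<And>s. s \<in> S \<Longrightarrow> spanned_on A B (f s)) \<Longrightarrow> spanned_on A B (\<lambda>x. \<Sum>s\<in>S. f s x)"
proof (induction S rule: infinite_finite_induct)
  case (infinite S)
  then show ?case unfolding spanned_on_def by (intro exI[of _ "\<lambda>_. 0"]) simp
next
  case empty
  then show ?case unfolding spanned_on_def by (intro exI[of _ "\<lambda>_. 0"]) simp
next
  case (insert s S)
  then show ?case using spanned_on_add[of A B "f s" "\<lambda>x. \<Sum>s\<in>S. f s x"] by simp
qed

lemma spanned_on_cong:
  "spanned_on A B f \<Longrightarrow> (\<And>x. x \<in> A \<Longrightarrow> f x = g x) \<Longrightarrow> spanned_on A B g"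
  unfolding spanned_on_def by auto

text \<open>The substitution \<phi> and the weight \<open>w\<close> are there for products: with
  powers of a variable, and of functions of the two components of a pair.\<close>

lemma spanned_on_trans:
  assumes "spanned_on A B f" "\<And>b. b \<in> B \<Longrightarrow> spanned_on A' B' (\<lambda>x. b (\<phi> x) * w x)"
    "\<And>x. x \<in> A' \<Longrightarrow> \<phi> x \<in> A"
  shows "spanned_on A' B' (\<lambda>x. f (\<phi> x) * w x)"
proof -
  obtain c where c: "\<forall>x\<in>A. f x = (\<Sum>b\<in>B. c b * b x)" using assms(1) unfolding spanned_on_def by blast
  have "spanned_on A' B' (\<lambda>x. \<Sum>b\<in>B. c b * (b (\<phi> x) * w x))"
    by (intro spanned_on_sum spanned_on_scale assms(2))
  then show ?thesis
    by (rule spanned_on_cong) (use assms(3) c in \<open>simp add: sum_distrib_left sum_distrib_right mult_ac\<close>)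
qed

text \<open>Dimensions are only bounded from above, so a spanning set stands in for a basis; its
  members may lie outside \<open>F\<close>, which admits pullbacks, products and extensions by
  zero.\<close>

definition fdim_le :: "'b set \<Rightarrow> (('b \<Rightarrow> real) \<Rightarrow> bool) \<Rightarrow> nat \<Rightarrow> bool" where
  "fdim_le A F N \<longleftrightarrow> (\<exists>B. finite B \<and> card B \<le> N \<and> (\<forall>f. F f \<longrightarrow> spanned_on A B f))"

lemma fdim_le_mono: "fdim_le A F N \<Longrightarrow> N \<le> M \<Longrightarrow> fdim_le A F M"
  unfolding fdim_le_def by (meson le_trans)

text \<open>The products of spanning functions with \<open>w ^ e\<close> span. For a free variable
  \<open>D\<close> is \<open>m + 1\<close> and the growth exponent rises by one; for a variable with
  a monic equation \<open>D\<close> is constant and only the factor changes.\<close>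

lemma fdim_le_expand:
  assumes "fdim_le A F N"
    and "\<And>f. F' f \<Longrightarrow> \<exists>a. (\<forall>e<D. F (a e)) \<and> (\<forall>x\<in>A. f x = (\<Sum>e<D. a e x * w x ^ e))"
  shows "fdim_le A F' (N * D)"
proof -
  obtain B where B: "finite B" "card B \<le> N" "\<And>f. F f \<Longrightarrow> spanned_on A B f"
    using assms(1) unfolding fdim_le_def by blast
  define B' where "B' = (\<lambda>(b, e) x. b x * w x ^ e) ` (B \<times> {..<D})"
  have "finite B'" using B by (simp add: B'_def)
  have "card B' \<le> card (B \<times> {..<D})" unfolding B'_def by (rule card_image_le) (use B in auto)
  also have "\<dots> \<le> N * D" using B by (simp add: card_cartesian_product)
  finally have "card B' \<le> N * D" .
  moreover have "spanned_on A B' f" if f: "F' f" for f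
  proof -
    obtain a where a: "\<forall>e<D. F (a e)" "\<forall>x\<in>A. f x = (\<Sum>e<D. a e x * w x ^ e)"
      using assms(2)[OF f] by blast
    have "spanned_on A B' (\<lambda>x. a e (id x) * w x ^ e)" if "e \<in> {..<D}" for e
    proof (rule spanned_on_trans[OF B(3)])
      show "F (a e)" using a that by simp
      fix b assume "b \<in> B"
      then show "spanned_on A B' (\<lambda>x. b (id x) * w x ^ e)"
        by (intro spanned_on_base[OF \<open>finite B'\<close>]) (use that in \<open>force simp: B'_def\<close>)
    qed auto
    then have "spanned_on A B' (\<lambda>x. \<Sum>e<D. a e x * w x ^ e)"
      by (intro spanned_on_sum) auto
    then show ?thesis by (rule spanned_on_cong) (use a in auto)
  qed
  ultimately show ?thesis unfolding fdim_le_def using \<open>finite B'\<close> by blast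
qed

lemma fdim_le_Un:
  assumes "fdim_le A F N" "fdim_le B F M"
  shows "fdim_le (A \<union> B) F (N + M)"
proof -
  obtain P where P: "finite P" "card P \<le> N" "\<And>f. F f \<Longrightarrow> spanned_on A P f"
    using assms(1) unfolding fdim_le_def by blast
  obtain Q where Q: "finite Q" "card Q \<le> M" "\<And>f. F f \<Longrightarrow> spanned_on B Q f"
    using assms(2) unfolding fdim_le_def by blast
  \<comment> \<open>Spanning functions are extended by zero, with \<open>A\<close> taking precedence
    on the overlap, so that each half acts on its own part of the union.\<close>
  define P' where "P' = (\<lambda>b x. if x \<in> A then b x else 0) ` P"
  define Q' where "Q' = (\<lambda>b x. if x \<in> A then 0 else b x) ` Q"
  have fin: "finite (P' \<union> Q')" using P Q by (simp add: P'_def Q'_def)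
  have "card (P' \<union> Q') \<le> card P' + card Q'" by (rule card_Un_le)
  also have "\<dots> \<le> N + M" using card_image_le[OF P(1)] card_image_le[OF Q(1)] P(2) Q(2)
    unfolding P'_def Q'_def by (meson add_mono le_trans)
  finally have "card (P' \<union> Q') \<le> N + M" .
  moreover have "spanned_on (A \<union> B) (P' \<union> Q') f" if Ff: "F f" for f
  proof -
    obtain c where c: "\<forall>x\<in>A. f x = (\<Sum>b\<in>P. c b * b x)"
      using P(3)[OF Ff] unfolding spanned_on_def by blast
    obtain d where d: "\<forall>x\<in>B. f x = (\<Sum>b\<in>Q. d b * b x)"
      using Q(3)[OF Ff] unfolding spanned_on_def by blast
    have "spanned_on (A \<union> B) (P' \<union> Q') (\<lambda>x. (\<Sum>b\<in>P. c b * (if x \<in> A then b x else 0)) +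
        (\<Sum>b\<in>Q. d b * (if x \<in> A then 0 else b x)))"
      by (intro spanned_on_add spanned_on_sum spanned_on_scale spanned_on_base[OF fin])
        (auto simp: P'_def Q'_def)
    then show ?thesis
    proof (rule spanned_on_cong)
      fix x assume "x \<in> A \<union> B"
      then show "(\<Sum>b\<in>P. c b * (if x \<in> A then b x else 0)) +
          (\<Sum>b\<in>Q. d b * (if x \<in> A then 0 else b x)) = f x"
        by (cases "x \<in> A") (use c d in auto)
    qed
  qed
  ultimately show ?thesis unfolding fdim_le_def using fin by blast
qed

lemma fdim_le_transfer:
  assumes "fdim_le A F N" "\<phi> ` A' \<subseteq> A"
    "\<And>f. F' f \<Longrightarrow> \<exists>h. F h \<and> (\<forall>x\<in>A'. f x = h (\<phi> x))"
  shows "fdim_le A' F' N"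
proof -
  obtain B where B: "finite B" "card B \<le> N" "\<And>f. F f \<Longrightarrow> spanned_on A B f"
    using assms(1) unfolding fdim_le_def by blast
  let ?B = "(\<lambda>b x. b (\<phi> x)) ` B"
  have "spanned_on A' ?B f" if f: "F' f" for f
  proof -
    obtain h where h: "F h" "\<And>x. x \<in> A' \<Longrightarrow> f x = h (\<phi> x)" using assms(3)[OF f] by blast
    have "spanned_on A' ?B (\<lambda>x. h (\<phi> x) * 1)"
    proof (rule spanned_on_trans[OF B(3)[OF h(1)]])
      show "spanned_on A' ?B (\<lambda>x. b (\<phi> x) * 1)" if "b \<in> B" for b
        using that B(1) by (intro spanned_on_base) auto
    qed (use assms(2) in auto)
    then show ?thesis by (rule spanned_on_cong) (use h in auto)
  qed
  moreover have "card ?B \<le> N" using card_image_le[OF B(1)] B(2) le_trans by blast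
  ultimately show ?thesis unfolding fdim_le_def using B(1) by (intro exI[of _ ?B]) auto
qed

text \<open>Gaussian elimination, by induction on the equations \<open>B\<close>.\<close>

lemma homogeneous_system:
  fixes c :: "'s \<Rightarrow> 'b \<Rightarrow> real"
  assumes "finite B" "finite S" "card B < card S"
  shows "\<exists>\<gamma>. (\<exists>s\<in>S. \<gamma> s \<noteq> 0) \<and> (\<forall>b\<in>B. (\<Sum>s\<in>S. \<gamma> s * c s b) = 0)"
  using assms
proof (induction B arbitrary: S c rule: finite_induct)
  case empty
  then obtain s where "s \<in> S" by fastforce
  then show ?case by (intro exI[of _ "\<lambda>_. 1"]) auto
next
  case (insert b B)
  show ?case
  proof (cases "\<exists>s0\<in>S. c s0 b \<noteq> 0")
    case False
    obtain \<gamma> where "\<exists>s\<in>S. \<gamma> s \<noteq> 0" "\<forall>b\<in>B. (\<Sum>s\<in>S. \<gamma> s * c s b) = 0"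
      using insert.IH[of S c] insert.prems insert.hyps by auto
    then show ?thesis using False by (intro exI[of _ \<gamma>]) auto
  next
    case True
    then obtain s0 where s0: "s0 \<in> S" "c s0 b \<noteq> 0" by blast
    let ?S = "S - {s0}"
    \<comment> \<open>\<open>c'\<close> are the coefficients after equation \<open>b\<close> has
      been solved for the unknown \<open>s0\<close> and the solution, \<open>g\<close> below, has
      been substituted.\<close>
    define c' where "c' s b' = c s b' - c s b / c s0 b * c s0 b'" for s b'
    have "card B < card ?S" using insert.prems insert.hyps s0 by auto
    then obtain \<gamma> where \<gamma>: "\<exists>s\<in>?S. \<gamma> s \<noteq> 0" "\<forall>b\<in>B. (\<Sum>s\<in>?S. \<gamma> s * c' s b) = 0"
      using insert.IH[of ?S c'] insert.prems by auto
    define g where "g = - (\<Sum>s\<in>?S. \<gamma> s * (c s b / c s0 b))"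
    define \<gamma>' where "\<gamma>' s = (if s = s0 then g else \<gamma> s)" for s
    have *: "(\<Sum>s\<in>S. \<gamma>' s * c s b') = (\<Sum>s\<in>?S. \<gamma> s * c' s b')" for b'
    proof -
      have "(\<Sum>s\<in>S. \<gamma>' s * c s b') = g * c s0 b' + (\<Sum>s\<in>?S. \<gamma> s * c s b')"
        using insert.prems s0 by (subst sum.remove[of _ s0]) (auto simp: \<gamma>'_def)
      also have "\<dots> = (\<Sum>s\<in>?S. \<gamma> s * c' s b')"
        by (simp add: g_def c'_def right_diff_distrib sum_subtractf sum_distrib_left sum_distrib_right mult_ac)
      finally show ?thesis .
    qed
    have "(\<Sum>s\<in>?S. \<gamma> s * c' s b) = 0" using s0 by (simp add: c'_def)
    then have "\<forall>b'\<in>insert b B. (\<Sum>s\<in>S. \<gamma>' s * c s b') = 0" using * \<gamma> by auto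
    moreover have "\<exists>s\<in>S. \<gamma>' s \<noteq> 0" using \<gamma>(1) by (auto simp: \<gamma>'_def)
    ultimately show ?thesis by blast
  qed
qed

lemma fdim_le_linear_relation:
  assumes "fdim_le A F N" "finite S" "N < card S" "\<And>s. s \<in> S \<Longrightarrow> F (f s)"
  shows "\<exists>\<gamma>. (\<exists>s\<in>S. \<gamma> s \<noteq> 0) \<and> (\<forall>x\<in>A. (\<Sum>s\<in>S. \<gamma> s * f s x) = 0)"
proof -
  obtain B where B: "finite B" "card B \<le> N" "\<And>f. F f \<Longrightarrow> spanned_on A B f"
    using assms(1) unfolding fdim_le_def by blast
  have "\<forall>s\<in>S. \<exists>c. \<forall>x\<in>A. f s x = (\<Sum>b\<in>B. c b * b x)"
    using B(3) assms(4) unfolding spanned_on_def by blast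
  then obtain c where c: "\<And>s x. s \<in> S \<Longrightarrow> x \<in> A \<Longrightarrow> f s x = (\<Sum>b\<in>B. c s b * b x)"
    by metis
  obtain \<gamma> where \<gamma>: "\<exists>s\<in>S. \<gamma> s \<noteq> 0" "\<forall>b\<in>B. (\<Sum>s\<in>S. \<gamma> s * c s b) = 0"
    using homogeneous_system[of B S c] B assms by auto
  have "(\<Sum>s\<in>S. \<gamma> s * f s x) = 0" if "x \<in> A" for x
  proof -
    have "(\<Sum>s\<in>S. \<gamma> s * f s x) = (\<Sum>s\<in>S. \<Sum>b\<in>B. \<gamma> s * c s b * b x)"
      using c that by (simp add: sum_distrib_left mult.assoc)
    also have "\<dots> = (\<Sum>b\<in>B. (\<Sum>s\<in>S. \<gamma> s * c s b) * b x)"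
      by (subst sum.swap) (simp add: sum_distrib_right)
    finally show ?thesis using \<gamma> by simp
  qed
  with \<gamma> show ?thesis by blast
qed

text \<open>Induction on the variables: read as a univariate polynomial in the value at
  \<open>z\<close>, the sum vanishes everywhere, so its coefficients do, and these are sums of the
  same kind over \<open>I\<close>.\<close>

lemma monomials_independent:
  assumes "finite I" "\<And>v::'i \<Rightarrow> real. (\<Sum>\<beta>\<in>PiE I (\<lambda>_. {..m}). \<gamma> \<beta> * (\<Prod>i\<in>I. v i ^ \<beta> i)) = 0"
    "\<beta> \<in> PiE I (\<lambda>_. {..m::nat})"
  shows "\<gamma> \<beta> = (0::real)"
  using assms
proof (induction I arbitrary: \<gamma> \<beta> rule: finite_induct)
  case empty
  then show ?case by simp
next
  case (insert z I)
  let ?P = "PiE I (\<lambda>_. {..m})"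
  have inj: "inj_on (\<lambda>(y, g). g(z := y)) ({..m} \<times> ?P)"
    using inj_combinator[OF insert(2), of "\<lambda>_. {..m}"] .
  have eq: "(\<Sum>e\<le>m. (\<Sum>\<beta>\<in>?P. \<gamma> (\<beta>(z := e)) * (\<Prod>i\<in>I. v i ^ \<beta> i)) * t ^ e) = 0" for v t
  proof -
    let ?v = "v(z := t)"
    have mon: "\<gamma> (\<beta>(z := e)) * (\<Prod>i\<in>insert z I. ?v i ^ (\<beta>(z := e)) i) =
        \<gamma> (\<beta>(z := e)) * (\<Prod>i\<in>I. v i ^ \<beta> i) * t ^ e" for e \<beta>
    proof -
      have "(\<Prod>i\<in>I. ?v i ^ (\<beta>(z := e)) i) = (\<Prod>i\<in>I. v i ^ \<beta> i)"
        using insert(2) by (intro prod.cong) auto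
      then show ?thesis using insert(1,2) by simp
    qed
    have "0 = (\<Sum>\<beta>\<in>PiE (insert z I) (\<lambda>_. {..m}). \<gamma> \<beta> * (\<Prod>i\<in>insert z I. ?v i ^ \<beta> i))"
      using insert.prems(1) by simp
    also have "\<dots> = (\<Sum>(e, \<beta>)\<in>{..m} \<times> ?P. \<gamma> (\<beta>(z := e)) * (\<Prod>i\<in>insert z I. ?v i ^ (\<beta>(z := e)) i))"
      unfolding PiE_insert_eq by (subst sum.reindex[OF inj]) (simp only: o_def case_prod_unfold)
    also have "\<dots> = (\<Sum>(e, \<beta>)\<in>{..m} \<times> ?P. \<gamma> (\<beta>(z := e)) * (\<Prod>i\<in>I. v i ^ \<beta> i) * t ^ e)"
      by (intro sum.cong refl) (simp only: split_beta mon)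
    also have "\<dots> = (\<Sum>e\<le>m. (\<Sum>\<beta>\<in>?P. \<gamma> (\<beta>(z := e)) * (\<Prod>i\<in>I. v i ^ \<beta> i)) * t ^ e)"
      by (simp add: sum.cartesian_product[symmetric] sum_distrib_right)
    finally show ?thesis by simp
  qed
  obtain e \<beta>' where *: "\<beta> = \<beta>'(z := e)" "e \<le> m" "\<beta>' \<in> ?P"
    using insert.prems(2) unfolding PiE_insert_eq by auto
  have "(\<Sum>\<beta>\<in>?P. \<gamma> (\<beta>(z := e)) * (\<Prod>i\<in>I. v i ^ \<beta> i)) = 0" for v :: "'i \<Rightarrow> real"
  proof -
    have "\<forall>i\<le>m. (\<Sum>\<beta>\<in>?P. \<gamma> (\<beta>(z := i)) * (\<Prod>i\<in>I. v i ^ \<beta> i)) = 0"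
      using eq[of v] polyfun_eq_0[of "\<lambda>e. \<Sum>\<beta>\<in>?P. \<gamma> (\<beta>(z := e)) * (\<Prod>i\<in>I. v i ^ \<beta> i)" m]
      by blast
    with * show ?thesis by blast
  qed
  from insert.IH[of "\<lambda>\<beta>. \<gamma> (\<beta>(z := e))", OF this *(3)] show ?case unfolding *(1) .
qed

text \<open>There are \<open>(m + 1)^(d + 1)\<close> monomials with exponents at most \<open>m\<close>, eventually more than the
  dimension of the space of functions on \<open>A\<close> in which they lie.\<close>

lemma alg_dep_if_fdim_le:
  fixes g :: "'i \<Rightarrow> 'b \<Rightarrow> real"
  assumes "finite I" "card I = Suc d"
    and "\<And>m. fdim_le A (\<lambda>h. \<exists>f. mpoly_fun I m f \<and> h = (\<lambda>x. f (\<lambda>i. g i x))) (C * (m + 1) ^ d)"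
  shows "alg_dep I g A"
proof -
  \<comment> \<open>Monomials with exponents at most \<open>m\<close> have degree at most
    \<open>Suc d * m\<close>. This choice makes \<open>C * (Suc d * m + 1) ^ d\<close> at most
    \<open>m * (m + 1) ^ d\<close>, which is below the number \<open>(m + 1) ^ Suc d\<close> of
    monomials.\<close>
  define m where "m = C * (Suc d + 1) ^ d"
  let ?P = "PiE I (\<lambda>_. {..m})"
  define F where "F = (\<lambda>h. \<exists>f. mpoly_fun I (Suc d * m) f \<and> h = (\<lambda>x::'b. f (\<lambda>i. g i x)))"
  define mon where "mon \<beta> v = (\<Prod>i\<in>I. v i ^ \<beta> i)" for \<beta> :: "'i \<Rightarrow> nat" and v :: "'i \<Rightarrow> real"
  have fin: "finite ?P" using assms(1) by (simp add: finite_PiE)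
  have mon: "mpoly_fun I (Suc d * m) (mon \<beta>)" if "\<beta> \<in> ?P" for \<beta>
  proof -
    have "mpoly_fun I (card I * m) (\<lambda>v. \<Prod>i\<in>I. v i ^ \<beta> i)"
    proof (rule mpoly_fun_prod)
      fix i assume "i \<in> I"
      then have "mpoly_fun I (\<beta> i * 1) (\<lambda>v. v i ^ \<beta> i)"
        using mpoly_fun_coord[of i I 0] by (intro mpoly_fun_power) simp
      then show "mpoly_fun I m (\<lambda>v. v i ^ \<beta> i)"
        by (rule mpoly_fun_mono_deg) (use that \<open>i \<in> I\<close> in auto)
    qed
    then show ?thesis by (simp add: mon_def[abs_def] assms(2))
  qed
  have "Suc d * m + 1 \<le> (m + 1) * (Suc d + 1)" by simp
  then have "C * (Suc d * m + 1) ^ d \<le> C * ((m + 1) * (Suc d + 1)) ^ d"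
    by (intro mult_le_mono power_mono) auto
  also have "\<dots> = m * (m + 1) ^ d"
    by (simp only: power_mult_distrib) (simp add: m_def)
  also have "\<dots> < (m + 1) ^ Suc d" by simp
  also have "\<dots> = card ?P" using assms(1,2) by (simp add: card_PiE)
  finally have "C * (Suc d * m + 1) ^ d < card ?P" .
  moreover have "fdim_le A F (C * (Suc d * m + 1) ^ d)" unfolding F_def by (rule assms(3))
  ultimately obtain \<gamma> where \<gamma>: "\<exists>\<beta>\<in>?P. \<gamma> \<beta> \<noteq> 0"
      "\<forall>x\<in>A. (\<Sum>\<beta>\<in>?P. \<gamma> \<beta> * mon \<beta> (\<lambda>i. g i x)) = 0"
    using fdim_le_linear_relation[of A F _ ?P "\<lambda>\<beta> x. mon \<beta> (\<lambda>i. g i x)"] fin mon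
    unfolding F_def by blast
  define f where "f v = (\<Sum>\<beta>\<in>?P. \<gamma> \<beta> * mon \<beta> v)" for v
  have "mpoly_fun I (Suc d * m) f" unfolding f_def[abs_def]
    by (intro mpoly_fun_sum mpoly_fun_scale mon)
  moreover obtain v where "f v \<noteq> 0"
    using \<gamma>(1) monomials_independent[OF assms(1), where m = m and \<gamma> = \<gamma>] unfolding f_def mon_def by blast
  ultimately show ?thesis using \<gamma>(2) unfolding alg_dep_def f_def by blast
qed

section \<open>Noether normalization\<close>

text \<open>Monic up to a constant, with the degree bounds on the coefficients that make reduction modulo the
  equation preserve the total degree.\<close>

definition monic_in :: "'i set \<Rightarrow> nat \<Rightarrow> (('i \<Rightarrow> real) \<Rightarrow> real poly) \<Rightarrow> bool" where
  "monic_in J D p \<longleftrightarrow> D > 0 \<and> (\<forall>y. degree (p y) \<le> D) \<and>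
     (\<exists>c. c \<noteq> 0 \<and> (\<forall>y. coeff (p y) D = c)) \<and>
     (\<forall>e\<le>D. mpoly_fun J (D - e) (\<lambda>y. coeff (p y) e))"

lemma poly_eq_sum_atMost:
  fixes p :: "'a::comm_semiring_1 poly"
  assumes "degree p \<le> D"
  shows "poly p x = (\<Sum>e\<le>D. coeff p e * x ^ e)"
  unfolding poly_altdef using assms by (intro sum.mono_neutral_left) (auto simp: coeff_eq_0)

text \<open>Only multiplication by \<open>x z\<close> can create the power \<open>D\<close>, which
  the equation eliminates. The number \<open>D\<close> of coefficients is the same for all
  \<open>m\<close>, so adjoining \<open>z\<close> multiplies dimensions by a constant.\<close>

lemma monic_in_reduce:
  assumes p: "monic_in J D p" and A: "\<And>x. x \<in> A \<Longrightarrow> poly (p x) (x z) = 0"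
    and f: "mpoly_fun (insert z J) m f"
  shows "\<exists>a. (\<forall>e<D. mpoly_fun J m (a e)) \<and> (\<forall>x\<in>A. f x = (\<Sum>e<D. a e x * x z ^ e))"
proof -
  obtain c where D: "D > 0" and deg: "\<And>y. degree (p y) \<le> D" and c: "c \<noteq> 0" "\<And>y. coeff (p y) D = c"
    and coeff: "\<And>e. e \<le> D \<Longrightarrow> mpoly_fun J (D - e) (\<lambda>y. coeff (p y) e)"
    using p unfolding monic_in_def by blast
  \<comment> \<open>The coefficient of the power \<open>e\<close> has degree at most
    \<open>m - e\<close> and vanishes for \<open>e > m\<close>, where truncated subtraction alone
    would still allow constants.\<close>
  define P where "P m e f \<longleftrightarrow> (if e \<le> m then mpoly_fun J (m - e) f else \<forall>x. f x = 0)" for m e f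
  have "\<exists>a. (\<forall>e<D. P m e (a e)) \<and> (\<forall>x\<in>A. f x = (\<Sum>e<D. a e x * x z ^ e))"
    using f
  proof (induction rule: mpoly_fun.induct)
    case (const m d)
    define a where "a e = (\<lambda>x::'a \<Rightarrow> real. if e = 0 then d else 0)" for e :: nat
    have "\<forall>e<D. P m e (a e)" by (auto simp: a_def P_def intro: mpoly_fun.const)
    moreover have "d = (\<Sum>e<D. a e x * x z ^ e)" for x
    proof -
      have "(\<Sum>e<D. a e x * x z ^ e) = (\<Sum>e\<in>{0}. a e x * x z ^ e)"
        using D by (intro sum.mono_neutral_right) (auto simp: a_def)
      then show ?thesis by (simp add: a_def)
    qed
    ultimately show ?case by (intro exI[of _ a]) simp
  next
    case (var i m f)
    from var.IH obtain a where a: "\<And>e. e < D \<Longrightarrow> P m e (a e)"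
      "\<And>x. x \<in> A \<Longrightarrow> f x = (\<Sum>e<D. a e x * x z ^ e)" by blast
    show ?case
    proof (cases "i = z")
      case False
      have "\<forall>e<D. P (Suc m) e (\<lambda>x. x i * a e x)"
      proof (intro allI impI)
        fix e assume "e < D"
        then have "P m e (a e)" by (rule a)
        then show "P (Suc m) e (\<lambda>x. x i * a e x)"
          using False var.hyps(1) mpoly_fun.var[of i J "m - e" "a e"]
          by (cases "e \<le> m") (auto simp: P_def Suc_diff_le intro: mpoly_fun.const)
      qed
      moreover have "\<forall>x\<in>A. x i * f x = (\<Sum>e<D. (x i * a e x) * x z ^ e)"
        using a(2) by (simp add: sum_distrib_left mult.assoc)
      ultimately show ?thesis by (intro exI[of _ "\<lambda>e x. x i * a e x"]) simp
    next
      case True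
      \<comment> \<open>Multiplying by \<open>x z\<close> shifts the coefficients; the overflow
        \<open>a (D - 1) x * x z ^ D\<close> is rewritten by the equation, solved for its leading
        power.\<close>
      define b where "b e x = (if e = 0 then 0 else a (e - 1) x) +
          (-1 / c) * (a (D - 1) x * coeff (p x) e)" for e x
      have "P (Suc m) e (b e)" if e: "e < D" for e
      proof (cases "e \<le> Suc m")
        case True
        have 1: "mpoly_fun J (Suc m - e) (\<lambda>x. if e = 0 then 0 else a (e - 1) x)"
        proof (cases e)
          case (Suc d)
          then show ?thesis using a(1)[of d] e True by (simp add: P_def)
        qed (simp add: mpoly_fun.const)
        have "mpoly_fun J (Suc m - e) (\<lambda>x. a (D - 1) x * coeff (p x) e)"
        proof (cases "D - 1 \<le> m")
          case True
          then have "mpoly_fun J ((m - (D - 1)) + (D - e)) (\<lambda>x. a (D - 1) x * coeff (p x) e)"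
            using a(1)[of "D - 1"] D coeff[of e] e by (intro mpoly_fun_mult) (auto simp: P_def)
          moreover have "(m - (D - 1)) + (D - e) = Suc m - e" using True D e by simp
          ultimately show ?thesis by simp
        next
          case False
          then show ?thesis using a(1)[of "D - 1"] D by (simp add: P_def mpoly_fun.const)
        qed
        then have "mpoly_fun J (Suc m - e) (\<lambda>x. (-1 / c) * (a (D - 1) x * coeff (p x) e))"
          by (rule mpoly_fun_scale)
        from mpoly_fun.add[OF 1 this] have "mpoly_fun J (Suc m - e) (b e)" unfolding b_def[abs_def] .
        then show ?thesis using True by (simp add: P_def)
      next
        case False
        then have "a (e - 1) x = 0" "a (D - 1) x = 0" for x
          using a(1)[of "e - 1"] a(1)[of "D - 1"] e D by (auto simp: P_def split: if_splits)
        then show ?thesis using False by (simp add: P_def b_def)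
      qed
      moreover have "x i * f x = (\<Sum>e<D. b e x * x z ^ e)" if x: "x \<in> A" for x
      proof -
        obtain D' where D': "D = Suc D'" using D by (cases D) auto
        have "0 = (\<Sum>e\<le>D. coeff (p x) e * x z ^ e)"
          using A[OF x] poly_eq_sum_atMost[OF deg[of x]] by simp
        also have "\<dots> = (\<Sum>e<D. coeff (p x) e * x z ^ e) + c * x z ^ D"
          using c by (simp add: lessThan_Suc_atMost[symmetric])
        finally have *: "x z ^ D = (-1 / c) * (\<Sum>e<D. coeff (p x) e * x z ^ e)"
          using c(1) by (simp add: field_simps)
        have "x i * f x = (\<Sum>e<D. a e x * x z ^ Suc e)"
          using a(2)[OF x] True by (simp add: sum_distrib_left mult_ac)
        also have "\<dots> = (\<Sum>e<D'. a e x * x z ^ Suc e) + a D' x * x z ^ D"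
          by (simp add: D')
        also have "(\<Sum>e<D'. a e x * x z ^ Suc e) = (\<Sum>e<D. (if e = 0 then 0 else a (e - 1) x) * x z ^ e)"
          unfolding D' by (subst sum.lessThan_Suc_shift) simp
        also have "a D' x * x z ^ D = (\<Sum>e<D. (-1 / c) * (a (D - 1) x * coeff (p x) e) * x z ^ e)"
          unfolding * sum_distrib_left by (intro sum.cong) (simp_all add: D')
        finally show ?thesis by (simp only: b_def distrib_right sum.distrib)
      qed
      ultimately show ?thesis by (intro exI[of _ b]) simp
    qed
  next
    case (add m f g)
    from add.IH(1) obtain a where a: "\<And>e. e < D \<Longrightarrow> P m e (a e)"
      "\<And>x. x \<in> A \<Longrightarrow> f x = (\<Sum>e<D. a e x * x z ^ e)" by blast
    from add.IH(2) obtain b where b: "\<And>e. e < D \<Longrightarrow> P m e (b e)"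
      "\<And>x. x \<in> A \<Longrightarrow> g x = (\<Sum>e<D. b e x * x z ^ e)" by blast
    have "\<forall>e<D. P m e (\<lambda>x. a e x + b e x)"
      using a(1) b(1) by (auto simp: P_def mpoly_fun.add)
    moreover have "\<forall>x\<in>A. f x + g x = (\<Sum>e<D. (a e x + b e x) * x z ^ e)"
      by (simp add: a(2) b(2) distrib_right sum.distrib)
    ultimately show ?case by (rule exI[of _ "\<lambda>e x. a e x + b e x", OF conjI])
  qed
  then obtain a where a: "\<forall>e<D. P m e (a e)" "\<forall>x\<in>A. f x = (\<Sum>e<D. a e x * x z ^ e)" by blast
  have "mpoly_fun J m (a e)" if "e < D" for e
  proof (cases "e \<le> m")
    case True
    then show ?thesis using a(1) that mpoly_fun_mono_deg[of J "m - e" "a e" m] by (simp add: P_def)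
  next
    case False
    then have "a e = (\<lambda>_. 0)" using a(1) that by (auto simp: P_def)
    then show ?thesis by (simp add: mpoly_fun.const)
  qed
  with a(2) show ?thesis by blast
qed

text \<open>\<open>J\<close> are the free variables. The equation of a list entry involves
  \<open>J\<close> and the entries after it, so arguments start from the end of the list. In
  \<open>q z y\<close> the coefficients are evaluated at \<open>y\<close>, and the value at
  \<open>z\<close> is the indeterminate.\<close>

primrec triangular :: "'i set \<Rightarrow> 'i list \<Rightarrow> ('i \<Rightarrow> ('i \<Rightarrow> real) \<Rightarrow> real poly) \<Rightarrow> bool" where
  "triangular J [] q \<longleftrightarrow> True"
| "triangular J (z # zs) q \<longleftrightarrow>
     z \<notin> J \<union> set zs \<and> (\<exists>D. monic_in (J \<union> set zs) D (q z)) \<and> triangular J zs q"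

lemma fdim_le_mpoly_fun:
  assumes "finite J"
  shows "fdim_le A (mpoly_fun J m) ((m + 1) ^ card J)"
  using assms
proof (induction J rule: finite_induct)
  case empty
  have "spanned_on A {\<lambda>_. 1} f" if f: "mpoly_fun {} m f" for f
  proof -
    have "f x = f (\<lambda>_. 0)" for x by (rule mpoly_fun_cong[OF f]) simp
    then have "\<forall>x\<in>A. f x = (\<Sum>b\<in>{\<lambda>_. 1}. f (\<lambda>_. 0) * b x)" by simp
    then show ?thesis unfolding spanned_on_def by (rule exI[of _ "\<lambda>_. f (\<lambda>_. 0)"])
  qed
  then show ?case unfolding fdim_le_def by (intro exI[of _ "{\<lambda>_. 1}"]) simp
next
  case (insert z J)
  have "fdim_le A (mpoly_fun (insert z J) m) ((m + 1) ^ card J * Suc m)"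
  proof (rule fdim_le_expand[OF insert.IH, where w = "\<lambda>x. x z"])
    fix f assume "mpoly_fun (insert z J) m f"
    then obtain a where a: "\<And>e. e \<le> m \<Longrightarrow> mpoly_fun J (m - e) (a e)"
      "\<And>x. f x = (\<Sum>e\<le>m. a e x * x z ^ e)" by (rule mpoly_fun_expand) blast
    have "mpoly_fun J m (a e)" if "e < Suc m" for e
      by (rule mpoly_fun_mono_deg[OF a(1)]) (use that in auto)
    moreover have "f x = (\<Sum>e<Suc m. a e x * x z ^ e)" for x
      unfolding a(2) by (simp add: lessThan_Suc_atMost)
    ultimately show "\<exists>a. (\<forall>e<Suc m. mpoly_fun J m (a e)) \<and>
        (\<forall>x\<in>A. f x = (\<Sum>e<Suc m. a e x * x z ^ e))" by blast
  qed
  then show ?case using insert.hyps by (simp add: mult.commute)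
qed

text \<open>Each equation leaves a fixed number of powers of its variable, so dependent variables
  only enlarge the constant; the exponent counts the free ones.\<close>

lemma fdim_le_triangular:
  assumes "finite J" "triangular J zs q" "\<And>x z. x \<in> A \<Longrightarrow> z \<in> set zs \<Longrightarrow> poly (q z x) (x z) = 0"
  shows "\<exists>C. \<forall>m. fdim_le A (mpoly_fun (J \<union> set zs) m) (C * (m + 1) ^ card J)"
  using assms(2,3)
proof (induction zs)
  case Nil
  show ?case using fdim_le_mpoly_fun[OF assms(1)] by (intro exI[of _ 1]) simp
next
  case (Cons z zs)
  then obtain C where C: "\<And>m. fdim_le A (mpoly_fun (J \<union> set zs) m) (C * (m + 1) ^ card J)" by auto
  obtain D where D: "monic_in (J \<union> set zs) D (q z)" using Cons.prems by auto
  have "fdim_le A (mpoly_fun (J \<union> set (z # zs)) m) (C * (m + 1) ^ card J * D)" for m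
  proof (rule fdim_le_expand[OF C, where w = "\<lambda>x. x z"])
    fix f assume "mpoly_fun (J \<union> set (z # zs)) m f"
    then have f: "mpoly_fun (insert z (J \<union> set zs)) m f" by simp
    show "\<exists>a. (\<forall>e<D. mpoly_fun (J \<union> set zs) m (a e)) \<and> (\<forall>x\<in>A. f x = (\<Sum>e<D. a e x * x z ^ e))"
      by (rule monic_in_reduce[OF D _ f]) (use Cons.prems(2) in auto)
  qed
  then show ?case by (intro exI[of _ "C * D"]) (simp add: mult_ac)
qed

text \<open>Along lines whose direction \<open>u\<close> is not a zero of the leading form, the
  leading coefficient is constant; the shear makes this direction a coordinate axis. The zero
  \<open>x0\<close> rules out nonzero constants, which have no monic form of positive
  degree.\<close>

lemma monic_after_shear:
  assumes f: "mpoly_fun J m f" "f v \<noteq> 0" "f x0 = 0"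
  obtains z w D p where "z \<in> J" "\<And>i. i \<notin> J - {z} \<Longrightarrow> w i = 0" "monic_in (J - {z}) D p"
    "\<And>y. poly (p y) (y z) = f (\<lambda>i. y i + y z * w i)"
proof -
  obtain h where h: "\<And>e. mpoly_fun J e (h e)" "\<And>e. homogeneous e (h e)"
    "\<And>x. f x = (\<Sum>e\<le>m. h e x)" using homogeneous_decomp[OF f(1)] by blast
  define E where "E = {e. e \<le> m \<and> (\<exists>v. h e v \<noteq> 0)}"
  have "finite E" by (simp add: E_def)
  have "E \<noteq> {}"
  proof
    assume "E = {}"
    then have "f v = 0" unfolding h(3) by (intro sum.neutral) (auto simp: E_def)
    with f show False by simp
  qed
  \<comment> \<open>The actual degree, as opposed to the bound \<open>m\<close>.\<close>
  define D where "D = Max E"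
  have D: "D \<in> E" using Max_in[OF \<open>finite E\<close> \<open>E \<noteq> {}\<close>] by (simp add: D_def)
  then obtain u where u: "h D u \<noteq> 0" "D \<le> m" by (auto simp: E_def)
  have fD: "f x = (\<Sum>e\<le>D. h e x)" for x
    unfolding h(3)
  proof (rule sum.mono_neutral_right)
    show "\<forall>e\<in>{..m} - {..D}. h e x = 0"
      using Max_ge[OF \<open>finite E\<close>] unfolding D_def[symmetric] by (auto simp: E_def not_le)
  qed (use u in auto)
  have "D > 0"
  proof (rule ccontr)
    assume "\<not> D > 0"
    then have "f x = h 0 x" for x by (simp add: fD)
    moreover have "h 0 v = h 0 x0" by (rule mpoly_fun_degree0[OF h(1)])
    ultimately show False using f by simp
  qed
  have "\<exists>z\<in>J. u z \<noteq> 0"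
  proof (rule ccontr)
    assume "\<not> ?thesis"
    then have "h D u = h D (\<lambda>i. 0 * u i)" by (intro mpoly_fun_cong[OF h(1)]) auto
    also have "\<dots> = 0 ^ D * h D u" using h(2)[of D] unfolding homogeneous_def by blast
    also have "\<dots> = 0" using \<open>D > 0\<close> by simp
    finally show False using u by simp
  qed
  then obtain z where z: "z \<in> J" "u z \<noteq> 0" by blast
  \<comment> \<open>The direction \<open>u\<close>, scaled to have component 1 at \<open>z\<close>,
    with that component removed: up to coordinates outside \<open>J\<close>, which \<open>f\<close>
    ignores, the shear takes the axis of \<open>z\<close> to the line spanned by
    \<open>u\<close>.\<close>
  define w where "w i = (if i \<in> J - {z} then u i / u z else 0)" for i
  define g where "g y = f (\<lambda>i. y i + y z * w i)" for y
  have "mpoly_fun J D f" unfolding fD[abs_def]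
    by (intro mpoly_fun_sum mpoly_fun_mono_deg[OF h(1)]) auto
  moreover have "mpoly_fun J 1 (\<lambda>y. y i + y z * w i)" if "i \<in> J" for i
  proof -
    have "mpoly_fun J 1 (\<lambda>y. y i + w i * y z)"
      using that z mpoly_fun_coord[of _ J 0] by (intro mpoly_fun.add mpoly_fun_scale) auto
    then show ?thesis by (simp add: mult.commute)
  qed
  ultimately have "mpoly_fun J (D * 1) g" unfolding g_def[abs_def] by (rule mpoly_fun_compose)
  then have "mpoly_fun (insert z (J - {z})) D g" using z by (simp add: insert_absorb)
  then obtain a where a: "\<And>e. e \<le> D \<Longrightarrow> mpoly_fun (J - {z}) (D - e) (a e)"
    "\<And>x. g x = (\<Sum>e\<le>D. a e x * x z ^ e)" by (rule mpoly_fun_expand) blast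
  define p where "p y = (\<Sum>e\<le>D. monom (a e y) e)" for y
  have coeff: "coeff (p y) e = (if e \<le> D then a e y else 0)" for y e
    by (simp add: p_def coeff_sum coeff_monom sum.delta)
  have "poly (p y) (y z) = f (\<lambda>i. y i + y z * w i)" for y
    by (simp add: p_def poly_sum poly_monom flip: a(2) g_def)
  moreover have "monic_in (J - {z}) D p"
  proof -
    define c where "c = a D (\<lambda>_. 0)"
    have "a D y = c" for y unfolding c_def using mpoly_fun_degree0[of "J - {z}" "a D"] a(1)[of D] by simp
    moreover have "c \<noteq> 0"
    proof -
      \<comment> \<open>With the component at \<open>z\<close> restored, comparing powers of
        \<open>t\<close> along \<open>u'\<close> identifies the leading coefficient with
        \<open>h D u'\<close>, a nonzero multiple of \<open>h D u\<close> by homogeneity.\<close>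
      define u' where "u' i = (if i = z then 1 else w i)" for i
      have "(\<Sum>e\<le>D. a e (\<lambda>_. 0) * t ^ e) = (\<Sum>e\<le>D. h e u' * t ^ e)" for t
      proof -
        let ?y = "\<lambda>i. if i = z then t else 0"
        have "a e (\<lambda>_. 0) = a e ?y" if "e \<le> D" for e
          by (rule mpoly_fun_cong[OF a(1)[OF that]]) auto
        then have "(\<Sum>e\<le>D. a e (\<lambda>_. 0) * t ^ e) = g ?y" unfolding a(2) by simp
        also have "\<dots> = f (\<lambda>i. t * u' i)" unfolding g_def
          by (rule mpoly_fun_cong[OF f(1)]) (auto simp: u'_def w_def)
        also have "\<dots> = (\<Sum>e\<le>D. h e u' * t ^ e)" unfolding fD
          using h(2) by (simp add: homogeneous_def mult.commute)
        finally show ?thesis .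
      qed
      then have "a D (\<lambda>_. 0) = h D u'"
        using polyfun_eq_coeffs[of "\<lambda>e. a e (\<lambda>_. 0)" D "\<lambda>e. h e u'"] by blast
      also have "\<dots> = h D (\<lambda>i. 1 / u z * u i)"
        by (rule mpoly_fun_cong[OF h(1)]) (use z in \<open>auto simp: u'_def w_def\<close>)
      also have "\<dots> = (1 / u z) ^ D * h D u" using h(2)[of D] unfolding homogeneous_def by blast
      finally show ?thesis using z u by (simp add: c_def)
    qed
    ultimately show ?thesis unfolding monic_in_def using \<open>D > 0\<close> a(1)
      by (auto simp: coeff intro!: degree_le)
  qed
  ultimately show ?thesis using that[of z w D p] z(1) by (auto simp: w_def)
qed

lemma monic_in_compose:
  assumes "monic_in J D p" "\<And>i. i \<in> J \<Longrightarrow> mpoly_fun K 1 (\<lambda>x. T x i)"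
  shows "monic_in K D (\<lambda>x. p (T x))"
proof -
  have "mpoly_fun K ((D - e) * 1) (\<lambda>y. coeff (p (T y)) e)" if "e \<le> D" for e
    using assms that unfolding monic_in_def by (intro mpoly_fun_compose[where g = T]) auto
  then show ?thesis using assms(1) unfolding monic_in_def by auto
qed

text \<open>Induction on the number of variables: a relation on \<open>A\<close> becomes monic in
  some \<open>z\<close> by a shear, and the other variables are normalised on the sheared set.
  Coordinates outside \<open>J\<close> stay fixed, so this does not disturb \<open>z\<close>, and
  degree one in both directions preserves degree bounds.\<close>

lemma noether_normalization:
  assumes "finite J" "A \<noteq> {}"
  shows "\<exists>T T' J0 zs q. J0 \<union> set zs = J \<and> triangular J0 zs q \<and> (\<forall>x. T' (T x) = x) \<and> (\<forall>x. T (T' x) = x) \<and>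
    (\<forall>x. \<forall>i. i \<notin> J \<longrightarrow> T x i = x i \<and> T' x i = x i) \<and>
    (\<forall>i\<in>J. mpoly_fun J 1 (\<lambda>x. T x i) \<and> mpoly_fun J 1 (\<lambda>x. T' x i)) \<and>
    (\<forall>x\<in>A. \<forall>z\<in>set zs. poly (q z (T x)) (T x z) = 0) \<and> \<not> alg_dep J0 (\<lambda>i x. T x i) A"
  using assms
proof (induction "card J" arbitrary: J A rule: less_induct)
  case less
  show ?case
  proof (cases "alg_dep J (\<lambda>i x. x i) A")
    case False
    have "mpoly_fun J 1 (\<lambda>x. x i)" if "i \<in> J" for i using that mpoly_fun_coord[of i J 0] by simp
    then show ?thesis using False
      by (intro exI[of _ "\<lambda>x. x"] exI[of _ "\<lambda>x. x"] exI[of _ J] exI[of _ "[]"]) simp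
  next
    case True
    obtain m f v where f: "mpoly_fun J m f" "f v \<noteq> 0" "\<And>x. x \<in> A \<Longrightarrow> f (\<lambda>i. x i) = 0"
      by (rule alg_depE[OF True]) blast
    obtain x0 where "x0 \<in> A" using less.prems by blast
    then have "f x0 = 0" using f(3)[of x0] by simp
    obtain z w D p where z: "z \<in> J" and w: "\<And>i. i \<notin> J - {z} \<Longrightarrow> w i = 0"
      and p: "monic_in (J - {z}) D p" "\<And>y. poly (p y) (y z) = f (\<lambda>i. y i + y z * w i)"
      by (rule monic_after_shear[of J m f v x0, OF f(1,2) \<open>f x0 = 0\<close>]) (rule that)
    define S where "S x i = x i - x z * w i" for x i
    define S' where "S' x i = x i + x z * w i" for x i
    have wz: "w z = 0" using w by simp
    have S: "S' (S x) = x" "S (S' x) = x" for x by (auto simp: S_def S'_def wz)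
    have "card (J - {z}) < card J" using z less.prems by (meson card_Diff1_less)
    then have "\<exists>T T' J0 zs q. J0 \<union> set zs = J - {z} \<and> triangular J0 zs q \<and>
      (\<forall>x. T' (T x) = x) \<and> (\<forall>x. T (T' x) = x) \<and>
      (\<forall>x. \<forall>i. i \<notin> J - {z} \<longrightarrow> T x i = x i \<and> T' x i = x i) \<and>
      (\<forall>i\<in>J - {z}. mpoly_fun (J - {z}) 1 (\<lambda>x. T x i) \<and> mpoly_fun (J - {z}) 1 (\<lambda>x. T' x i)) \<and>
      (\<forall>x\<in>S ` A. \<forall>z\<in>set zs. poly (q z (T x)) (T x z) = 0) \<and> \<not> alg_dep J0 (\<lambda>i x. T x i) (S ` A)"
      by (rule less.hyps) (use less.prems in auto)
    then obtain T T' J0 zs q where *: "J0 \<union> set zs = J - {z} \<and> triangular J0 zs q \<and>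
      (\<forall>x. T' (T x) = x) \<and> (\<forall>x. T (T' x) = x) \<and>
      (\<forall>x. \<forall>i. i \<notin> J - {z} \<longrightarrow> T x i = x i \<and> T' x i = x i) \<and>
      (\<forall>i\<in>J - {z}. mpoly_fun (J - {z}) 1 (\<lambda>x. T x i) \<and> mpoly_fun (J - {z}) 1 (\<lambda>x. T' x i)) \<and>
      (\<forall>x\<in>S ` A. \<forall>z\<in>set zs. poly (q z (T x)) (T x z) = 0) \<and> \<not> alg_dep J0 (\<lambda>i x. T x i) (S ` A)"
      by (elim exE) (rule that)
    have IH: "J0 \<union> set zs = J - {z}" "triangular J0 zs q"
      "\<And>x. T' (T x) = x" "\<And>x. T (T' x) = x"
      "\<And>x i. i \<notin> J - {z} \<Longrightarrow> T x i = x i" "\<And>x i. i \<notin> J - {z} \<Longrightarrow> T' x i = x i"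
      "\<And>i. i \<in> J - {z} \<Longrightarrow> mpoly_fun (J - {z}) 1 (\<lambda>x. T x i)"
      "\<And>i. i \<in> J - {z} \<Longrightarrow> mpoly_fun (J - {z}) 1 (\<lambda>x. T' x i)"
      "\<And>x z. x \<in> A \<Longrightarrow> z \<in> set zs \<Longrightarrow> poly (q z (T (S x))) (T (S x) z) = 0"
      "\<not> alg_dep J0 (\<lambda>i x. T x i) (S ` A)"
      using * by blast+
    \<comment> \<open>\<open>p\<close> refers to the coordinates after the shear, the system to
      those after \<open>T\<close>. Composing with \<open>T'\<close> translates between them, and
      the equation stays monic in \<open>z\<close>, which \<open>T\<close> fixes.\<close>
    define q' where "q' = q(z := (\<lambda>x. p (T' x)))"
    have T1: "mpoly_fun J 1 (\<lambda>x. T x i)" "mpoly_fun J 1 (\<lambda>x. T' x i)" if "i \<in> J" for i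
    proof -
      have c: "mpoly_fun J 1 (\<lambda>x. x z)" using z mpoly_fun_coord[of z J 0] by simp
      show "mpoly_fun J 1 (\<lambda>x. T x i)" "mpoly_fun J 1 (\<lambda>x. T' x i)"
        using that c IH(5)[of z] IH(6)[of z] mpoly_fun_mono_vars[OF IH(7)[of i], of J]
          mpoly_fun_mono_vars[OF IH(8)[of i], of J] by (cases "i = z"; auto)+
    qed
    have S1: "mpoly_fun J 1 (\<lambda>x. S x i)" "mpoly_fun J 1 (\<lambda>x. S' x i)" if "i \<in> J" for i
    proof -
      have "mpoly_fun J 1 (\<lambda>x. x i + c * x z)" for c
        using that z mpoly_fun_coord[of _ J 0] by (intro mpoly_fun.add mpoly_fun_scale) auto
      from this[of "w i"] this[of "- w i"]
      show "mpoly_fun J 1 (\<lambda>x. S x i)" "mpoly_fun J 1 (\<lambda>x. S' x i)"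
        by (simp_all add: S_def S'_def mult.commute)
    qed
    have "triangular J0 (z # zs) q'"
    proof -
      have z': "z \<notin> J0 \<union> set zs" using IH(1) by auto
      have "triangular J0 ys q \<Longrightarrow> z \<notin> set ys \<Longrightarrow> triangular J0 ys q'" for ys
        by (induction ys) (auto simp: q'_def)
      then have "triangular J0 zs q'" using z' IH(2) by simp
      moreover have "monic_in (J - {z}) D (\<lambda>x. p (T' x))"
        by (rule monic_in_compose[OF p(1) IH(8)])
      then have "monic_in (J0 \<union> set zs) D (q' z)" by (simp add: q'_def IH(1))
      ultimately show ?thesis using z' by auto
    qed
    moreover have "J0 \<union> set (z # zs) = J" using IH(1) z by auto
    moreover have "poly (q' y (T (S x))) (T (S x) y) = 0" if "x \<in> A" "y \<in> set (z # zs)" for x y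
    proof (cases "y = z")
      case True
      have "(\<lambda>i. S x i + S x z * w i) = x" by (simp add: S_def wz)
      then have "poly (p (S x)) (S x z) = f x" unfolding p(2) by simp
      then show ?thesis using True f(3)[OF \<open>x \<in> A\<close>] IH(5)[of z "S x"]
        by (simp add: q'_def IH(3))
    qed (use that IH(9) in \<open>auto simp: q'_def\<close>)
    moreover have "\<not> alg_dep J0 (\<lambda>i x. T (S x) i) A"
      using IH(10) unfolding alg_dep_def by auto
    moreover have "mpoly_fun J 1 (\<lambda>x. T (S x) i)" "mpoly_fun J 1 (\<lambda>x. S' (T' x) i)" if "i \<in> J" for i
      using mpoly_fun_compose[of J 1 "\<lambda>x. T x i" J 1 S] T1[OF that] S1
        mpoly_fun_compose[of J 1 "\<lambda>x. S' x i" J 1 T'] S1[OF that] T1 by auto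
    moreover have "T (S x) i = x i \<and> S' (T' x) i = x i" if "i \<notin> J" for x i
    proof -
      have "w i = 0" using w that by blast
      then show ?thesis using that IH(5)[of i] IH(6)[of i] by (simp add: S_def S'_def)
    qed
    ultimately show ?thesis using IH(3,4) S
      by (intro exI[of _ "\<lambda>x. T (S x)"] exI[of _ "\<lambda>x. S' (T' x)"] exI[of _ J0] exI[of _ "z # zs"]
          exI[of _ q'] conjI) auto
  qed
qed

section \<open>Algebraic and topological dimension\<close>

text \<open>Differentiation multiplies the constant leading coefficient by a positive number;
  \<open>e < D\<close> keeps the degree positive.\<close>

lemma monic_in_higher_pderiv:
  assumes "monic_in J D p" "e < D"
  shows "monic_in J (D - e) (\<lambda>y. (pderiv ^^ e) (p y))"
proof -
  obtain c where deg: "\<And>y. degree (p y) \<le> D" and c: "c \<noteq> 0" "\<And>y. coeff (p y) D = c"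
    and coeff: "\<And>e. e \<le> D \<Longrightarrow> mpoly_fun J (D - e) (\<lambda>y. coeff (p y) e)"
    using assms(1) unfolding monic_in_def by blast
  have "degree ((pderiv ^^ e) (p y)) \<le> D - e" for y
    using deg[of y] by (intro degree_le) (auto simp: coeff_higher_pderiv coeff_eq_0)
  moreover have "coeff ((pderiv ^^ e) (p y)) (D - e) = pochhammer (real (Suc (D - e))) e * c" for y
    using assms(2) c(2)[of y] by (simp add: coeff_higher_pderiv del: of_nat_Suc)
  moreover have "pochhammer (real (Suc (D - e))) e * c \<noteq> 0"
    using c(1) pochhammer_pos[of "real (Suc (D - e))" e] by simp
  moreover have "mpoly_fun J (D - e - i) (\<lambda>y. coeff ((pderiv ^^ e) (p y)) i)" if "i \<le> D - e" for i
  proof -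
    have "mpoly_fun J (D - (i + e)) (\<lambda>y. coeff (p y) (i + e))" using that assms(2) by (intro coeff) simp
    then show ?thesis by (simp add: coeff_higher_pderiv mpoly_fun_scale add.commute del: of_nat_Suc)
  qed
  ultimately show ?thesis using assms(2) unfolding monic_in_def by auto
qed

text \<open>\<open>e\<close> is the multiplicity of the root \<open>t\<close>, at most
  \<open>D\<close> because the derivative of order \<open>D\<close> is a nonzero constant. The gain
  is that \<open>t\<close> is a simple root of the derivative of order \<open>e - 1\<close>.\<close>

lemma monic_in_multiplicity:
  assumes "monic_in J D p" "poly (p y) t = 0"
  obtains e where "0 < e" "e \<le> D" "poly ((pderiv ^^ (e - 1)) (p y)) t = 0" "poly ((pderiv ^^ e) (p y)) t \<noteq> 0"
proof -
  obtain c where deg: "degree (p y) \<le> D" and c: "c \<noteq> 0" "coeff (p y) D = c"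
    using assms(1) unfolding monic_in_def by blast
  let ?P = "\<lambda>e. poly ((pderiv ^^ e) (p y)) t \<noteq> 0"
  have "degree ((pderiv ^^ D) (p y)) \<le> 0"
    using deg by (intro degree_le) (auto simp: coeff_higher_pderiv coeff_eq_0)
  then have "poly ((pderiv ^^ D) (p y)) t = coeff ((pderiv ^^ D) (p y)) 0"
    by (simp add: poly_altdef)
  also have "\<dots> = pochhammer 1 D * c" using c by (simp add: coeff_higher_pderiv)
  finally have PD: "?P D" using c pochhammer_pos[of "1::real" D] by simp
  define e where "e = (LEAST e. ?P e)"
  have "?P e" unfolding e_def by (rule LeastI[of ?P, OF PD])
  moreover have "e \<le> D" unfolding e_def by (rule Least_le[of ?P, OF PD])
  moreover have "e > 0"
  proof (rule ccontr)
    assume "\<not> e > 0"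
    then show False using \<open>?P e\<close> assms(2) by simp
  qed
  moreover have "\<not> ?P (e - 1)"
    using not_less_Least[of "e - 1" ?P] \<open>e > 0\<close> unfolding e_def by simp
  ultimately show ?thesis using that by blast
qed

lemma continuous_on_monic_in:
  assumes "monic_in J D p" "continuous_on S g" "continuous_on S h"
  shows "continuous_on S (\<lambda>x. poly (p (vec_nth (g x))) (h x))"
proof -
  have "continuous_on S (\<lambda>x. coeff (p (vec_nth (g x))) e)" if "e \<le> D" for e
  proof (rule mpoly_fun_continuous[where f = "\<lambda>y. coeff (p y) e" and J = J and m = "D - e"])
    show "mpoly_fun J (D - e) (\<lambda>y. coeff (p y) e)" using assms(1) that unfolding monic_in_def by blast
  qed (intro continuous_intros assms)
  then have "continuous_on S (\<lambda>x. \<Sum>e\<le>D. coeff (p (vec_nth (g x))) e * h x ^ e)"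
    using assms(3) by (intro continuous_intros) auto
  moreover have "degree (p y) \<le> D" for y using assms(1) unfolding monic_in_def by blast
  ultimately show ?thesis by (simp only: poly_eq_sum_atMost[of "p y" D for y])
qed

lemma monic_in_cong:
  assumes "monic_in J D p" "\<And>i. i \<in> J \<Longrightarrow> x i = y i"
  shows "p x = p y"
proof (rule poly_eqI)
  fix e
  have "degree (p x) \<le> D" "degree (p y) \<le> D" using assms(1) unfolding monic_in_def by blast+
  moreover have "coeff (p x) e = coeff (p y) e" if "e \<le> D"
  proof (rule mpoly_fun_cong[where f = "\<lambda>y. coeff (p y) e"])
    show "mpoly_fun J (D - e) (\<lambda>y. coeff (p y) e)" using assms(1) that unfolding monic_in_def by blast
  qed (rule assms(2))
  ultimately show "coeff (p x) e = coeff (p y) e" by (cases "e \<le> D") (auto simp: coeff_eq_0)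
qed

text \<open>Radial compression, sending x to c + r x / (1 + |x|), preserves the subspace as it
  contains \<open>c\<close>.\<close>

lemma homeomorphic_subspace_Int_ball:
  fixes S :: "'a::real_normed_vector set"
  assumes "subspace S" "c \<in> S" "r > 0"
  shows "S homeomorphic (S \<inter> ball c r)"
proof -
  define F where "F x = c + (r / (1 + norm x)) *\<^sub>R x" for x :: 'a
  define G where "G y = (1 / (r - norm (y - c))) *\<^sub>R (y - c)" for y
  have pos: "1 + norm x > 0" for x :: 'a using norm_ge_zero[of x] by linarith
  have nF: "norm (F x - c) = r * norm x / (1 + norm x)" for x
    using pos[of x] assms(3) by (simp add: F_def abs_of_pos)
  have FS: "F x \<in> S \<inter> ball c r" if "x \<in> S" for x
  proof -
    have "F x \<in> S" using that assms by (auto simp: F_def intro: subspace_add subspace_scale)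
    moreover have "norm (F x - c) < r" using pos[of x] assms(3) unfolding nF by (simp add: field_simps)
    ultimately show ?thesis by (simp add: dist_norm norm_minus_commute)
  qed
  have GS: "G y \<in> S" if "y \<in> S \<inter> ball c r" for y
    using that assms by (auto simp: G_def intro: subspace_diff subspace_scale)
  have GF: "G (F x) = x" if "x \<in> S" for x
  proof -
    have "r - norm (F x - c) = r / (1 + norm x)" unfolding nF using pos[of x] by (simp add: field_simps)
    then show ?thesis using pos[of x] assms(3) unfolding G_def by (simp add: F_def)
  qed
  have FG: "F (G y) = y" if "y \<in> S \<inter> ball c r" for y
  proof -
    have *: "r - norm (y - c) > 0" using that by (auto simp: dist_norm norm_minus_commute)
    then have "norm (G y) = norm (y - c) / (r - norm (y - c))" by (simp add: G_def)
    then have "1 + norm (G y) = r / (r - norm (y - c))" using * by (simp add: field_simps)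
    then show ?thesis using * assms(3) unfolding F_def by (simp add: G_def)
  qed
  show ?thesis
  proof (rule homeomorphicI[of F S _ G])
    show "F ` S = S \<inter> ball c r" using FS FG GS by force
    show "G ` (S \<inter> ball c r) = S" using FS GF GS by force
    have "1 + norm x \<noteq> 0" for x :: 'a using pos[of x] by simp
    then show "continuous_on S F" unfolding F_def by (intro continuous_intros) blast
    show "continuous_on (S \<inter> ball c r) G" unfolding G_def
      by (intro continuous_intros) (auto simp: dist_norm norm_minus_commute)
  qed (use GF FG in auto)
qed

text \<open>From the end of the list on, both points give the next polynomial the same coefficients;
  equal values at different arguments would force a zero of its derivative in between, by the mean
  value theorem.\<close>

lemma triangular_inj_on:
  fixes q :: "'n::finite \<Rightarrow> ('n \<Rightarrow> real) \<Rightarrow> real poly" and x y :: "real^'n"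
  assumes "triangular J zs q" "\<And>i. i \<in> J \<Longrightarrow> x $ i = y $ i"
    "\<And>z. z \<in> set zs \<Longrightarrow> poly (q z (vec_nth x)) (x $ z) = poly (q z (vec_nth y)) (y $ z)"
    "\<And>z t. z \<in> set zs \<Longrightarrow> min (x $ z) (y $ z) < t \<Longrightarrow> t < max (x $ z) (y $ z) \<Longrightarrow>
       poly (pderiv (q z (vec_nth x))) t \<noteq> 0"
  shows "\<forall>i\<in>J \<union> set zs. x $ i = y $ i"
  using assms(1,3,4)
proof (induction zs)
  case Nil
  then show ?case using assms(2) by simp
next
  case (Cons z zs)
  then have IH: "\<forall>i\<in>J \<union> set zs. x $ i = y $ i" by simp
  obtain D where "monic_in (J \<union> set zs) D (q z)" using Cons.prems(1) by auto
  then have eq: "q z (vec_nth x) = q z (vec_nth y)" by (rule monic_in_cong) (use IH in auto)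
  have "x $ z = y $ z"
  proof (rule ccontr)
    assume "x $ z \<noteq> y $ z"
    then have "min (x $ z) (y $ z) < max (x $ z) (y $ z)" by auto
    from poly_MVT[OF this, of "q z (vec_nth x)"] obtain t
      where t: "min (x $ z) (y $ z) < t" "t < max (x $ z) (y $ z)"
        "poly (q z (vec_nth x)) (max (x $ z) (y $ z)) - poly (q z (vec_nth x)) (min (x $ z) (y $ z)) =
          (max (x $ z) (y $ z) - min (x $ z) (y $ z)) * poly (pderiv (q z (vec_nth x))) t" by blast
    have "poly (q z (vec_nth x)) (x $ z) = poly (q z (vec_nth x)) (y $ z)"
      using Cons.prems(2)[of z] eq by simp
    then have "poly (q z (vec_nth x)) (max (x $ z) (y $ z)) = poly (q z (vec_nth x)) (min (x $ z) (y $ z))"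
      by (simp add: max_def min_def)
    then show False using t \<open>x $ z \<noteq> y $ z\<close> Cons.prems(3)[of z t] by auto
  qed
  with IH show ?case by auto
qed

lemma dim_coordinate_subspace:
  "dim {x::real^'n. \<forall>i. i \<notin> J \<longrightarrow> x $ i = 0} = card J"
proof -
  let ?d = "(\<lambda>i. axis i 1 :: real^'n) ` J"
  have "{x::real^'n. \<forall>i. i \<notin> J \<longrightarrow> x $ i = 0} = {x. \<forall>b\<in>Basis. b \<notin> ?d \<longrightarrow> x \<bullet> b = 0}"
    by (auto simp: Basis_vec_def inner_axis axis_eq_axis image_iff)
  moreover have "dim \<dots> = card ?d" by (rule dim_substandard) (auto simp: Basis_vec_def)
  moreover have "card ?d = card J" by (rule card_image) (auto simp: inj_on_def axis_eq_axis)
  ultimately show ?thesis by simp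
qed

text \<open>The pieces \<open>part \<epsilon>\<close> fix the multiplicities of the roots. On a piece where the coordinates \<open>J\<close>
  remain independent, passing to derivatives makes all roots of the triangular system simple, so its
  zero set \<open>M\<close> is locally a graph over these coordinates. A relation between \<open>f\<close> and the coordinates
  \<open>J\<close> on \<open>M\<close>, divided by the largest power of \<open>f\<close>, shows that near a suitable point of the piece
  \<open>f\<close> vanishes on all of \<open>M\<close>.\<close>

lemma zero_set_contains_cell:
  fixes f :: "('n::finite \<Rightarrow> real) \<Rightarrow> real" and U :: "(real^'n) set"
    and q :: "'n \<Rightarrow> ('n \<Rightarrow> real) \<Rightarrow> real poly"
  defines "X \<equiv> {y. f (vec_nth y) = 0} \<inter> U"
  assumes f: "mpoly_fun UNIV r f" and U: "open U"
    and tri: "triangular J zs q" "J \<union> set zs = UNIV"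
    and zero: "\<And>y z. y \<in> X \<Longrightarrow> z \<in> set zs \<Longrightarrow> poly (q z (vec_nth y)) (y $ z) = 0"
    and indep: "\<not> alg_dep J (\<lambda>i y. y $ i) X"
  shows "\<exists>S V. subspace (S :: (real^'n) set) \<and> dim S = card J \<and> V \<subseteq> X \<and> S homeomorphic V"
proof -
  have zJ: "z \<notin> J" if "z \<in> set zs" for z
  proof -
    have "triangular J ys q \<Longrightarrow> z \<in> set ys \<Longrightarrow> z \<notin> J" for ys by (induction ys) auto
    then show ?thesis using tri(1) that by blast
  qed
  have "\<exists>K D. monic_in K D (q z)" if "z \<in> set zs" for z
  proof -
    have "triangular J ys q \<Longrightarrow> z \<in> set ys \<Longrightarrow> \<exists>K D. monic_in K D (q z)" for ys
      by (induction ys) auto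
    then show ?thesis using tri(1) that by blast
  qed
  then obtain K D where KD: "\<And>z. z \<in> set zs \<Longrightarrow> monic_in (K z) (D z) (q z)" by metis
  define E where "E = PiE (set zs) (\<lambda>z. {1..D z})"
  define part where "part \<epsilon> = {y\<in>X. \<forall>z\<in>set zs. poly ((pderiv ^^ (\<epsilon> z - 1)) (q z (vec_nth y))) (y $ z) = 0 \<and>
    poly ((pderiv ^^ \<epsilon> z) (q z (vec_nth y))) (y $ z) \<noteq> 0}" for \<epsilon>
  have "finite E" unfolding E_def by (intro finite_PiE) auto
  have "X \<subseteq> (\<Union>\<epsilon>\<in>E. part \<epsilon>)"
  proof
    fix y assume y: "y \<in> X"
    have "\<exists>e. 0 < e \<and> e \<le> D z \<and> poly ((pderiv ^^ (e - 1)) (q z (vec_nth y))) (y $ z) = 0 \<and>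
       poly ((pderiv ^^ e) (q z (vec_nth y))) (y $ z) \<noteq> 0" if "z \<in> set zs" for z
      using monic_in_multiplicity[OF KD[OF that] zero[OF y that]] by blast
    then obtain \<epsilon> where \<epsilon>: "\<And>z. z \<in> set zs \<Longrightarrow> 0 < \<epsilon> z \<and> \<epsilon> z \<le> D z \<and>
        poly ((pderiv ^^ (\<epsilon> z - 1)) (q z (vec_nth y))) (y $ z) = 0 \<and>
        poly ((pderiv ^^ \<epsilon> z) (q z (vec_nth y))) (y $ z) \<noteq> 0" by metis
    then have "restrict \<epsilon> (set zs) \<in> E" by (auto simp: E_def Suc_le_eq)
    moreover have "y \<in> part (restrict \<epsilon> (set zs))" using \<epsilon> y by (simp add: part_def)
    ultimately show "y \<in> (\<Union>\<epsilon>\<in>E. part \<epsilon>)" by blast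
  qed
  \<comment> \<open>Dependence passes to finite unions, so on some piece the coordinates
    \<open>J\<close> are still independent.\<close>
  then have "\<not> alg_dep J (\<lambda>i y. y $ i) (\<Union>\<epsilon>\<in>E. part \<epsilon>)" using indep alg_dep_subset by blast
  then obtain \<epsilon> where \<epsilon>: "\<epsilon> \<in> E" "\<not> alg_dep J (\<lambda>i y. y $ i) (part \<epsilon>)"
    using alg_dep_UN[OF \<open>finite E\<close>, of J "\<lambda>i y. y $ i" part] by blast
  define q' where "q' z y = (pderiv ^^ (\<epsilon> z - 1)) (q z y)" for z y
  have \<epsilon>D: "0 < \<epsilon> z" "\<epsilon> z \<le> D z" if "z \<in> set zs" for z using \<epsilon>(1) that by (auto simp: E_def PiE_iff)
  have q'01: "poly (q' z (vec_nth y)) (y $ z) = 0"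
    "poly (pderiv (q' z (vec_nth y))) (y $ z) \<noteq> 0" if yz: "y \<in> part \<epsilon>" "z \<in> set zs" for y z
  proof -
    obtain e where "\<epsilon> z = Suc e" using \<epsilon>D[OF yz(2)] by (cases "\<epsilon> z") auto
    with yz show "poly (q' z (vec_nth y)) (y $ z) = 0" "poly (pderiv (q' z (vec_nth y))) (y $ z) \<noteq> 0"
      by (auto simp: part_def q'_def)
  qed
  note q'0 = q'01(1) and q'1 = q'01(2)
  have KD': "monic_in (K z) (D z - (\<epsilon> z - 1)) (q' z)" if "z \<in> set zs" for z
    unfolding q'_def[abs_def] using \<epsilon>D[OF that] by (intro monic_in_higher_pderiv KD that) auto
  have tri': "triangular J zs q'"
  proof -
    have "triangular J ys q \<Longrightarrow> set ys \<subseteq> set zs \<Longrightarrow> triangular J ys q'" for ys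
    proof (induction ys)
      case (Cons z ys)
      then obtain D' where D': "monic_in (J \<union> set ys) D' (q z)" by auto
      \<comment> \<open>\<open>D'\<close> comes from the triangular system and is not known to equal
        \<open>D z\<close>. If the order reached \<open>D'\<close>, the next derivative would vanish
        identically, which is impossible at a point of the nonempty piece.\<close>
      have "\<epsilon> z - 1 < D'"
      proof (rule ccontr)
        assume "\<not> \<epsilon> z - 1 < D'"
        have "part \<epsilon> \<noteq> {}"
        proof
          assume "part \<epsilon> = {}"
          then show False using \<epsilon>(2) alg_dep_UN[of "{}" J "\<lambda>i y. y $ i" part] by simp
        qed
        then obtain y where y: "y \<in> part \<epsilon>" by blast
        have "degree (q z (vec_nth y)) \<le> D'" using D' unfolding monic_in_def by blast
        then have "(pderiv ^^ \<epsilon> z) (q z (vec_nth y)) = 0"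
          using \<open>\<not> \<epsilon> z - 1 < D'\<close> \<epsilon>D[of z] Cons.prems(2)
          by (intro poly_eqI) (auto simp: coeff_higher_pderiv coeff_eq_0)
        then show False using y Cons.prems(2) by (auto simp: part_def)
      qed
      then have "monic_in (J \<union> set ys) (D' - (\<epsilon> z - 1)) (q' z)"
        unfolding q'_def[abs_def] by (intro monic_in_higher_pderiv D')
      with Cons show ?case by auto
    qed simp
    then show ?thesis using tri(1) by blast
  qed
  define M where "M = {y. \<forall>z\<in>set zs. poly (q' z y) (y z) = 0}"
  obtain C where C: "\<And>m. fdim_le M (mpoly_fun UNIV m) (C * (m + 1) ^ card J)"
    using fdim_le_triangular[of J zs q' M] tri(2) tri' by (auto simp: M_def)
  \<comment> \<open>The variable \<open>None\<close> stands for \<open>f\<close>: together with the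
    free coordinates these are \<open>card J + 1\<close> functions on a set of growth exponent
    \<open>card J\<close>.\<close>
  define g where "g k y = (case k of None \<Rightarrow> f y | Some i \<Rightarrow> y i)" for k :: "'n option" and y
  define I where "I = insert None (Some ` J)"
  have "alg_dep I g M"
  proof (rule alg_dep_if_fdim_le[where d = "card J" and C = "C * (r + 1) ^ card J"])
    show "finite I" by (simp add: I_def)
    show "card I = Suc (card J)" by (simp add: I_def card_image)
    fix m
    \<comment> \<open>Each function in \<open>g\<close> has degree at most \<open>r + 1\<close>, so
      degree \<open>m\<close> in them means degree at most \<open>m * (r + 1)\<close> in the
      coordinates; the factor goes into the constant.\<close>
    have "C * (m * (r + 1) + 1) ^ card J \<le> C * ((m + 1) * (r + 1)) ^ card J"
      by (intro mult_le_mono power_mono) auto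
    also have "\<dots> = C * (r + 1) ^ card J * (m + 1) ^ card J" by (simp only: power_mult_distrib mult_ac)
    finally have le: "C * (m * (r + 1) + 1) ^ card J \<le> C * (r + 1) ^ card J * (m + 1) ^ card J" .
    show "fdim_le M (\<lambda>h. \<exists>F. mpoly_fun I m F \<and> h = (\<lambda>x. F (\<lambda>i. g i x)))
        (C * (r + 1) ^ card J * (m + 1) ^ card J)"
    proof (rule fdim_le_mono[OF fdim_le_transfer[OF C[of "m * (r + 1)"], where \<phi> = "\<lambda>x. x"] le])
      fix h assume "\<exists>F. mpoly_fun I m F \<and> h = (\<lambda>x. F (\<lambda>i. g i x))"
      then obtain F where F: "mpoly_fun I m F" "h = (\<lambda>x. F (\<lambda>i. g i x))" by blast
      have "mpoly_fun UNIV (m * (r + 1)) (\<lambda>x. F (\<lambda>i. g i x))"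
      proof (rule mpoly_fun_compose[OF F(1), where g = "\<lambda>x i. g i x"])
        show "mpoly_fun UNIV (r + 1) (\<lambda>x. g i x)" for i
          using mpoly_fun_coord[of _ UNIV r] mpoly_fun_mono_deg[OF f, of "r + 1"]
          by (cases i) (auto simp: g_def[abs_def])
      qed
      then show "\<exists>h'. mpoly_fun UNIV (m * (r + 1)) h' \<and> (\<forall>x\<in>M. h x = h' x)" using F(2) by auto
    qed auto
  qed
  then obtain mF F v where F: "mpoly_fun I mF F" "F v \<noteq> 0" "\<And>y. y \<in> M \<Longrightarrow> F (\<lambda>i. g i y) = 0"
    by (rule alg_depE) blast
  obtain a where a: "\<And>e. e \<le> mF \<Longrightarrow> mpoly_fun (Some ` J) (mF - e) (a e)"
    "\<And>x. F x = (\<Sum>e\<le>mF. a e x * x None ^ e)"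
    using F(1) unfolding I_def by (rule mpoly_fun_expand) blast
  define b where "b e y = a e (case_option 0 y)" for e and y :: "'n \<Rightarrow> real"
  have b: "mpoly_fun J ((mF - e) * 1) (b e)" if "e \<le> mF" for e
    unfolding b_def[abs_def]
  proof (rule mpoly_fun_compose[OF a(1)[OF that], where g = "case_option 0"])
    show "mpoly_fun J 1 (\<lambda>y. case_option 0 y i)" if "i \<in> Some ` J" for i
      using that mpoly_fun_coord[of _ J 0] by auto
  qed
  have ab: "a e x = b e (\<lambda>i. x (Some i))" if "e \<le> mF" for e x
    unfolding b_def by (rule mpoly_fun_cong[OF a(1)[OF that]]) auto
  have rel: "(\<Sum>e\<le>mF. b e y * f y ^ e) = 0" if "y \<in> M" for y
  proof -
    have "F (\<lambda>i. g i y) = (\<Sum>e\<le>mF. b e y * f y ^ e)"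
      unfolding a(2) by (intro sum.cong refl) (simp add: ab g_def)
    then show ?thesis using F(3)[OF that] by simp
  qed
  have "\<exists>e\<le>mF. \<exists>y. b e y \<noteq> 0"
  proof (rule ccontr)
    assume "\<not> ?thesis"
    then have "F v = 0" unfolding a(2) by (intro sum.neutral) (auto simp: ab)
    then show False using F(2) by simp
  qed
  then obtain e1 where e1: "e1 \<le> mF \<and> (\<exists>y. b e1 y \<noteq> 0)" by blast
  define e0 where "e0 = (LEAST e. e \<le> mF \<and> (\<exists>y. b e y \<noteq> 0))"
  have e0: "e0 \<le> mF" "\<exists>y. b e0 y \<noteq> 0"
    using LeastI[of "\<lambda>e. e \<le> mF \<and> (\<exists>y. b e y \<noteq> 0)", OF e1] unfolding e0_def by auto
  have low: "b e y = 0" if "e < e0" for e y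
    using not_less_Least[of e "\<lambda>e. e \<le> mF \<and> (\<exists>y. b e y \<noteq> 0)"] that e0(1) unfolding e0_def by auto
  obtain u where "b e0 u \<noteq> 0" using e0(2) by blast
  \<comment> \<open>\<open>b e0\<close> is a nonzero polynomial in coordinates that are independent
    on the piece, so it cannot vanish on all of it.\<close>
  then obtain y0 where y0: "y0 \<in> part \<epsilon>" "b e0 (vec_nth y0) \<noteq> 0"
    using \<epsilon>(2) alg_depI[OF b[OF e0(1)], of u "part \<epsilon>" "\<lambda>i y. y $ i"] by blast
  have "y0 \<in> X" using y0(1) by (simp add: part_def)
  define h where "h y = (\<Sum>e\<in>{e0..mF}. b e (vec_nth y) * f (vec_nth y) ^ (e - e0))" for y :: "real^'n"
  have fcont: "continuous_on UNIV (\<lambda>y::real^'n. f (vec_nth y))"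
    by (rule mpoly_fun_continuous[OF f]) (intro continuous_intros)
  have hcont: "continuous_on UNIV h" unfolding h_def
  proof (intro continuous_intros fcont)
    fix e assume "e \<in> {e0..mF}"
    then show "continuous_on UNIV (\<lambda>y::real^'n. b e (vec_nth y))"
      by (intro mpoly_fun_continuous[OF b] continuous_intros) auto
  qed
  have "f (vec_nth y0) = 0" using \<open>y0 \<in> X\<close> by (simp add: X_def)
  then have "h y0 = (\<Sum>e\<in>{e0}. b e (vec_nth y0) * f (vec_nth y0) ^ (e - e0))" unfolding h_def
    using e0(1) by (intro sum.mono_neutral_right) auto
  then have h0: "h y0 \<noteq> 0" using y0(2) by simp
  have hM: "h y = 0" if "vec_nth y \<in> M" "f (vec_nth y) \<noteq> 0" for y
  proof -
    have "0 = (\<Sum>e\<le>mF. b e (vec_nth y) * f (vec_nth y) ^ e)" using rel[OF that(1)] by simp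
    also have "\<dots> = (\<Sum>e\<in>{e0..mF}. b e (vec_nth y) * f (vec_nth y) ^ e)"
      using low by (intro sum.mono_neutral_right) (auto simp: not_le)
    also have "\<dots> = f (vec_nth y) ^ e0 * h y" unfolding h_def sum_distrib_left
      by (intro sum.cong refl) (simp add: flip: power_add)
    finally show ?thesis using that(2) by simp
  qed
  have "open ({y. h y \<noteq> 0} \<inter> U)"
  proof -
    have "open (h -` (- {0}))" using hcont by (intro open_vimage) auto
    moreover have "h -` (- {0}) = {y. h y \<noteq> 0}" by auto
    ultimately show ?thesis using U by (metis open_Int)
  qed
  moreover have "y0 \<in> {y. h y \<noteq> 0} \<inter> U" using h0 \<open>y0 \<in> X\<close> by (simp add: X_def)
  ultimately obtain \<delta>1 where \<delta>1: "\<delta>1 > 0" "ball y0 \<delta>1 \<subseteq> {y. h y \<noteq> 0} \<inter> U"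
    by (meson open_contains_ball)
  \<comment> \<open>The coefficients and the argument must vary separately, because the mean value
    point lies between coordinates of two different points.\<close>
  have "\<exists>\<delta>>0. \<forall>y t. dist y0 y < \<delta> \<longrightarrow> \<bar>t - y0 $ z\<bar> < \<delta> \<longrightarrow> poly (pderiv (q' z (vec_nth y))) t \<noteq> 0"
    if z: "z \<in> set zs" for z
  proof (cases "D z - (\<epsilon> z - 1) = 1")
    \<comment> \<open>Here the derivative is constant, hence not monic of positive degree.\<close>
    case True
    obtain c where deg: "\<And>y. degree (q' z y) \<le> 1" and c: "c \<noteq> 0" "\<And>y. coeff (q' z y) 1 = c"
      using KD'[OF z] unfolding monic_in_def True by blast
    have "pderiv (q' z y) = [:c:]" for y
      using deg[of y] c by (intro poly_eqI) (auto simp: coeff_pderiv coeff_pCons coeff_eq_0 split: nat.split)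
    then show ?thesis using c by (intro exI[of _ 1]) simp
  next
    case False
    have "0 < D z - (\<epsilon> z - 1)" using KD'[OF z] unfolding monic_in_def by blast
    then have "monic_in (K z) (D z - (\<epsilon> z - 1) - 1) (\<lambda>y. (pderiv ^^ 1) (q' z y))"
      using False by (intro monic_in_higher_pderiv KD'[OF z]) auto
    then have "continuous_on UNIV (\<lambda>w::(real^'n) \<times> real. poly ((pderiv ^^ 1) (q' z (vec_nth (fst w)))) (snd w))"
      by (rule continuous_on_monic_in) (intro continuous_intros)+
    then have c: "continuous_on UNIV (\<lambda>w::(real^'n) \<times> real. poly (pderiv (q' z (vec_nth (fst w)))) (snd w))"
      by simp
    define N where "N = (\<lambda>w::(real^'n) \<times> real. poly (pderiv (q' z (vec_nth (fst w)))) (snd w)) -` (- {0})"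
    have "open N" unfolding N_def using c by (intro open_vimage) auto
    moreover have "(y0, y0 $ z) \<in> N" using q'1[OF y0(1) z] by (simp add: N_def)
    ultimately obtain \<delta> where \<delta>: "\<delta> > 0" "ball (y0, y0 $ z) \<delta> \<subseteq> N" by (meson open_contains_ball)
    show ?thesis
    proof (intro exI[of _ "\<delta> / 2"] conjI allI impI)
      show "\<delta> / 2 > 0" using \<delta> by simp
      fix y t assume *: "dist y0 y < \<delta> / 2" "\<bar>t - y0 $ z\<bar> < \<delta> / 2"
      have "dist (y0, y0 $ z) (y, t) \<le> dist y0 y + dist (y0 $ z) t"
        unfolding dist_Pair_Pair by (rule sqrt_sum_squares_le_sum) auto
      also have "\<dots> < \<delta>" using * unfolding dist_real_def by linarith
      finally have "(y, t) \<in> N" using \<delta> by auto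
      then show "poly (pderiv (q' z (vec_nth y))) t \<noteq> 0" by (simp add: N_def)
    qed
  qed
  then obtain \<delta>z where \<delta>z: "\<And>z. z \<in> set zs \<Longrightarrow> \<delta>z z > 0"
    "\<And>z y t. z \<in> set zs \<Longrightarrow> dist y0 y < \<delta>z z \<Longrightarrow> \<bar>t - y0 $ z\<bar> < \<delta>z z \<Longrightarrow>
      poly (pderiv (q' z (vec_nth y))) t \<noteq> 0" by metis
  define \<delta> where "\<delta> = Min (insert \<delta>1 (\<delta>z ` set zs))"
  have \<delta>: "\<delta> > 0" "\<delta> \<le> \<delta>1" "\<And>z. z \<in> set zs \<Longrightarrow> \<delta> \<le> \<delta>z z"
    using \<delta>1(1) \<delta>z(1) by (auto simp: \<delta>_def)
  \<comment> \<open>The free coordinates are kept and each other one is replaced by the value of its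
    equation, so \<open>M\<close> is the inverse image of the coordinate subspace
    \<open>S\<close>.\<close>
  define \<Phi> where "\<Phi> y = (\<chi> i. if i \<in> J then y $ i else poly (q' i (vec_nth y)) (y $ i))" for y :: "real^'n"
  have zs: "i \<in> set zs" if "i \<notin> J" for i using that tri(2) by auto
  have \<Phi>cont: "continuous_on (ball y0 \<delta>) \<Phi>"
    unfolding \<Phi>_def
  proof (rule continuous_on_vec_lambda)
    fix i
    show "continuous_on (ball y0 \<delta>) (\<lambda>y. if i \<in> J then y $ i else poly (q' i (vec_nth y)) (y $ i))"
    proof (cases "i \<in> J")
      case False
      then show ?thesis using continuous_on_monic_in[OF KD'[OF zs[OF False]], of "ball y0 \<delta>" "\<lambda>y. y" "\<lambda>y. y $ i"]
        by (simp add: continuous_intros)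
    qed (simp add: continuous_intros)
  qed
  have \<Phi>inj: "inj_on \<Phi> (ball y0 \<delta>)"
  proof (rule inj_onI)
    fix x y assume xy: "x \<in> ball y0 \<delta>" "y \<in> ball y0 \<delta>" "\<Phi> x = \<Phi> y"
    have \<Phi>eq: "\<Phi> x $ i = \<Phi> y $ i" for i using xy by simp
    have "\<forall>i\<in>J \<union> set zs. x $ i = y $ i"
    proof (rule triangular_inj_on[OF tri'])
      show "x $ i = y $ i" if "i \<in> J" for i using \<Phi>eq[of i] that by (simp add: \<Phi>_def)
      fix z assume z: "z \<in> set zs"
      then show "poly (q' z (vec_nth x)) (x $ z) = poly (q' z (vec_nth y)) (y $ z)"
        using \<Phi>eq[of z] zJ by (simp add: \<Phi>_def)
      fix t assume t: "min (x $ z) (y $ z) < t" "t < max (x $ z) (y $ z)"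
      have "\<bar>x $ z - y0 $ z\<bar> < \<delta>" "\<bar>y $ z - y0 $ z\<bar> < \<delta>"
        using xy component_le_norm_cart[of "x - y0" z] component_le_norm_cart[of "y - y0" z]
        by (auto simp: dist_norm norm_minus_commute)
      then have "\<bar>t - y0 $ z\<bar> < \<delta>" using t by auto
      then show "poly (pderiv (q' z (vec_nth x))) t \<noteq> 0"
        using xy \<delta>(3)[OF z] by (intro \<delta>z(2)[OF z]) auto
    qed
    then show "x = y" using tri(2) by (simp add: vec_eq_iff)
  qed
  obtain \<Psi> where \<Psi>: "homeomorphism (ball y0 \<delta>) (\<Phi> ` ball y0 \<delta>) \<Phi> \<Psi>"
    using invariance_of_domain_homeomorphism[OF open_ball \<Phi>cont _ \<Phi>inj] by auto
  have "open (\<Phi> ` ball y0 \<delta>)" by (rule invariance_of_domain[OF \<Phi>cont open_ball \<Phi>inj])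
  moreover have "\<Phi> y0 \<in> \<Phi> ` ball y0 \<delta>" using \<delta>(1) by simp
  ultimately obtain \<rho> where \<rho>: "\<rho> > 0" "ball (\<Phi> y0) \<rho> \<subseteq> \<Phi> ` ball y0 \<delta>" by (meson open_contains_ball)
  define S where "S = {w::real^'n. \<forall>i. i \<notin> J \<longrightarrow> w $ i = 0}"
  have "subspace S" by (auto simp: S_def subspace_def)
  have "\<Phi> y0 \<in> S" using q'0[OF y0(1)] zs by (auto simp: S_def \<Phi>_def)
  let ?V = "\<Psi> ` (S \<inter> ball (\<Phi> y0) \<rho>)"
  have "homeomorphism (S \<inter> ball (\<Phi> y0) \<rho>) ?V \<Psi> \<Phi>"
    using homeomorphism_symD[OF \<Psi>] by (rule homeomorphism_of_subsets) (use \<rho> \<Psi> in \<open>auto simp: homeomorphism_def\<close>)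
  then have "S \<inter> ball (\<Phi> y0) \<rho> homeomorphic ?V" using homeomorphic_def by blast
  then have "S homeomorphic ?V"
    using homeomorphic_subspace_Int_ball[OF \<open>subspace S\<close> \<open>\<Phi> y0 \<in> S\<close> \<rho>(1)] homeomorphic_trans by blast
  moreover have "?V \<subseteq> X"
  proof
    fix y assume "y \<in> ?V"
    then obtain w where w: "w \<in> S" "w \<in> ball (\<Phi> y0) \<rho>" "y = \<Psi> w" by blast
    then obtain y' where y': "y' \<in> ball y0 \<delta>" "w = \<Phi> y'" using \<rho>(2) by blast
    then have "y = y'" using w(3) homeomorphism_apply1[OF \<Psi>] by simp
    then have y: "y \<in> ball y0 \<delta>" "\<Phi> y \<in> S" using y' w by auto
    have "poly (q' z (vec_nth y)) (y $ z) = 0" if "z \<in> set zs" for z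
    proof -
      have "\<Phi> y $ z = 0" using y(2) zJ[OF that] by (simp add: S_def)
      then show ?thesis using zJ[OF that] by (simp add: \<Phi>_def)
    qed
    then have "vec_nth y \<in> M" by (simp add: M_def)
    moreover have "y \<in> ball y0 \<delta>1" using y(1) \<delta>(2) by simp
    then have "h y \<noteq> 0" "y \<in> U" using \<delta>1(2) by blast+
    ultimately show "y \<in> X" using hM by (auto simp: X_def)
  qed
  moreover have "dim S = card J" unfolding S_def by (rule dim_coordinate_subspace)
  ultimately show ?thesis using \<open>subspace S\<close> by blast
qed

text \<open>A bound on the exponent of the Hilbert function of \<open>X\<close>. It behaves well
  under unions and products without any irreducibility.\<close>

definition poly_growth :: "(real^'n) set \<Rightarrow> nat \<Rightarrow> bool" where
  "poly_growth X k \<longleftrightarrow> (\<exists>C. \<forall>m. fdim_le X (\<lambda>h. \<exists>F. mpoly_fun UNIV m F \<and> h = (\<lambda>x. F (vec_nth x)))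
     (C * (m + 1) ^ k))"

text \<open>The property behind \<open>semialg_dim\<close>, as a bound instead of a maximum, which
  makes monotonicity in the set immediate.\<close>

definition cells_dim_le :: "(real^'n) set \<Rightarrow> nat \<Rightarrow> bool" where
  "cells_dim_le X k \<longleftrightarrow>
     (\<forall>S V. subspace (S :: (real^'n) set) \<longrightarrow> V \<subseteq> X \<longrightarrow> S homeomorphic V \<longrightarrow> dim S \<le> k)"

lemma cells_dim_le_subset: "cells_dim_le X k \<Longrightarrow> Y \<subseteq> X \<Longrightarrow> cells_dim_le Y k"
  unfolding cells_dim_le_def by (meson subset_trans)

lemma poly_growth_Un:
  assumes "poly_growth A k" "poly_growth B k"
  shows "poly_growth (A \<union> B) k"
proof -
  obtain C where C: "\<And>m. fdim_le A (\<lambda>h. \<exists>F. mpoly_fun UNIV m F \<and> h = (\<lambda>x. F (vec_nth x))) (C * (m + 1) ^ k)"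
    using assms(1) unfolding poly_growth_def by blast
  obtain D where D: "\<And>m. fdim_le B (\<lambda>h. \<exists>F. mpoly_fun UNIV m F \<and> h = (\<lambda>x. F (vec_nth x))) (D * (m + 1) ^ k)"
    using assms(2) unfolding poly_growth_def by blast
  have "fdim_le (A \<union> B) (\<lambda>h. \<exists>F. mpoly_fun UNIV m F \<and> h = (\<lambda>x. F (vec_nth x))) ((C + D) * (m + 1) ^ k)" for m
    unfolding add_mult_distrib by (rule fdim_le_Un[OF C D])
  then show ?thesis unfolding poly_growth_def by blast
qed

text \<open>The free coordinates \<open>J0\<close> of a Noether normalization are independent on
  \<open>X\<close>, so \<open>X\<close> contains a cell of dimension \<open>card J0\<close>, which
  is therefore at most \<open>k\<close>; and \<open>card J0\<close> is also the growth exponent of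
  the triangular system.\<close>

lemma poly_growth_zero_set:
  fixes X :: "(real^'n) set"
  assumes X: "X = {y. f (vec_nth y) = 0} \<inter> U"
    and f: "mpoly_fun UNIV r f" and U: "open U" and cells: "cells_dim_le X k"
  shows "poly_growth X k"
proof (cases "X = {}")
  case True
  have "fdim_le X F N" for F N
    unfolding fdim_le_def spanned_on_def True by (intro exI[of _ "{}"]) simp
  then show ?thesis unfolding poly_growth_def by blast
next
  case False
  have "\<exists>T T' J0 zs q. J0 \<union> set zs = UNIV \<and> triangular J0 zs q \<and> (\<forall>x. T' (T x) = x) \<and> (\<forall>x. T (T' x) = x) \<and>
    (\<forall>x. \<forall>i. i \<notin> UNIV \<longrightarrow> T x i = x i \<and> T' x i = x i) \<and>
    (\<forall>i\<in>UNIV. mpoly_fun UNIV 1 (\<lambda>x. T x i) \<and> mpoly_fun UNIV 1 (\<lambda>x. T' x i)) \<and>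
    (\<forall>x\<in>vec_nth ` X. \<forall>z\<in>set zs. poly (q z (T x)) (T x z) = 0) \<and> \<not> alg_dep J0 (\<lambda>i x. T x i) (vec_nth ` X)"
    by (rule noether_normalization) (use False in auto)
  then obtain T T' J0 zs q where *: "J0 \<union> set zs = (UNIV :: 'n set) \<and> triangular J0 zs q \<and> (\<forall>x. T' (T x) = x) \<and> (\<forall>x. T (T' x) = x) \<and>
    (\<forall>x. \<forall>i. i \<notin> UNIV \<longrightarrow> T x i = x i \<and> T' x i = x i) \<and>
    (\<forall>i\<in>UNIV. mpoly_fun UNIV 1 (\<lambda>x. T x i) \<and> mpoly_fun UNIV 1 (\<lambda>x. T' x i)) \<and>
    (\<forall>x\<in>vec_nth ` X. \<forall>z\<in>set zs. poly (q z (T x)) (T x z) = 0) \<and> \<not> alg_dep J0 (\<lambda>i x. T x i) (vec_nth ` X)"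
    by (elim exE) (rule that)
  have J0: "J0 \<union> set zs = UNIV" and tri: "triangular J0 zs q"
    and T: "\<And>x. T' (T x) = x" "\<And>x. T (T' x) = x"
    and poly: "\<And>i. mpoly_fun UNIV 1 (\<lambda>x. T x i)" "\<And>i. mpoly_fun UNIV 1 (\<lambda>x. T' x i)"
    and zero: "\<And>x z. x \<in> X \<Longrightarrow> z \<in> set zs \<Longrightarrow> poly (q z (T (vec_nth x))) (T (vec_nth x) z) = 0"
    and indep: "\<not> alg_dep J0 (\<lambda>i x. T x i) (vec_nth ` X)"
    using * by blast+
  define \<tau> where "\<tau> x = (\<chi> i. T (vec_nth x) i)" for x :: "real^'n"
  define \<tau>' where "\<tau>' x = (\<chi> i. T' (vec_nth x) i)" for x :: "real^'n"
  have nth: "vec_nth (\<tau> x) = T (vec_nth x)" "vec_nth (\<tau>' x) = T' (vec_nth x)" for x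
    by (simp_all add: \<tau>_def \<tau>'_def fun_eq_iff)
  have \<tau>: "\<tau>' (\<tau> x) = x" "\<tau> (\<tau>' x) = x" for x
    by (simp_all add: T nth vec_eq_iff)
  have cont: "continuous_on S \<tau>" "continuous_on S \<tau>'" for S
    unfolding \<tau>_def \<tau>'_def
    by (intro continuous_on_vec_lambda mpoly_fun_continuous[OF poly(1)] mpoly_fun_continuous[OF poly(2)]
        continuous_intros)+
  have f1: "mpoly_fun UNIV (r * 1) (\<lambda>y. f (T' y))" using f poly(2) by (rule mpoly_fun_compose)
  \<comment> \<open>The image of \<open>X\<close> under \<tau>, written through the inverse so that
    it is again a zero set in an open set.\<close>
  define X1 where "X1 = {y. f (T' (vec_nth y)) = 0} \<inter> (\<tau>' -` U)"
  have X1: "y \<in> X1 \<longleftrightarrow> \<tau>' y \<in> X" for y by (simp add: X X1_def nth)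
  have cell: "\<exists>S V. subspace (S :: (real^'n) set) \<and> dim S = card J0 \<and> V \<subseteq> X1 \<and> S homeomorphic V"
    unfolding X1_def
  proof (rule zero_set_contains_cell[OF f1 _ tri J0])
    show "open (\<tau>' -` U)" using cont U by (intro open_vimage) auto
    show "\<not> alg_dep J0 (\<lambda>i y. y $ i) ({y. f (T' (vec_nth y)) = 0} \<inter> \<tau>' -` U)"
    proof
      assume "alg_dep J0 (\<lambda>i y. y $ i) ({y. f (T' (vec_nth y)) = 0} \<inter> \<tau>' -` U)"
      then obtain m F v where F: "mpoly_fun J0 m F" "F v \<noteq> 0" "\<And>y. y \<in> X1 \<Longrightarrow> F (\<lambda>i. y $ i) = 0"
        unfolding X1_def[symmetric] by (rule alg_depE) blast
      have "F (\<lambda>i. T x i) = 0" if x: "x \<in> vec_nth ` X" for x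
      proof -
        obtain y where y: "y \<in> X" "x = vec_nth y" using x by blast
        then have "\<tau> y \<in> X1" by (simp add: X1 \<tau>)
        from F(3)[OF this] show ?thesis by (simp add: nth y)
      qed
      then show False using indep alg_depI[of J0 m F v "vec_nth ` X" "\<lambda>i x. T x i"] F(1,2) by blast
    qed
    fix y z assume "y \<in> {y. f (T' (vec_nth y)) = 0} \<inter> \<tau>' -` U" "z \<in> set zs"
    then have "\<tau>' y \<in> X" "z \<in> set zs" using X1[of y] by (auto simp: X1_def)
    from zero[OF this] show "poly (q z (vec_nth y)) (y $ z) = 0" by (simp add: nth T)
  qed
  then obtain S V where SV: "subspace (S :: (real^'n) set)" "dim S = card J0" "V \<subseteq> X1" "S homeomorphic V"
    by blast
  have "V homeomorphic \<tau>' ` V"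
    by (rule homeomorphicI[of \<tau>' V _ \<tau>]) (auto simp: \<tau> cont image_image)
  then have "S homeomorphic \<tau>' ` V" using SV(4) homeomorphic_trans by blast
  moreover have "\<tau>' ` V \<subseteq> X" using SV(3) X1 by blast
  ultimately have "card J0 \<le> k" using cells SV(1,2) unfolding cells_dim_le_def by metis
  obtain C where C: "\<And>m. fdim_le (T ` vec_nth ` X) (mpoly_fun UNIV m) (C * (m + 1) ^ card J0)"
    using fdim_le_triangular[of J0 zs q "T ` vec_nth ` X"] tri J0 zero by auto
  have "fdim_le X (\<lambda>h. \<exists>F. mpoly_fun UNIV m F \<and> h = (\<lambda>x. F (vec_nth x))) (C * (m + 1) ^ k)" for m
  proof (rule fdim_le_mono[OF fdim_le_transfer[OF C[of m], where \<phi> = "\<lambda>x. T (vec_nth x)"]])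
    show "C * (m + 1) ^ card J0 \<le> C * (m + 1) ^ k"
      using \<open>card J0 \<le> k\<close> by (intro mult_le_mono2 power_increasing) auto
    fix h assume "\<exists>F. mpoly_fun UNIV m F \<and> h = (\<lambda>x::real^'n. F (vec_nth x))"
    then obtain F where F: "mpoly_fun UNIV m F" "h = (\<lambda>x::real^'n. F (vec_nth x))" by blast
    have "mpoly_fun UNIV (m * 1) (\<lambda>x. F (T' x))" using F(1) poly(2) by (rule mpoly_fun_compose)
    then show "\<exists>h'. mpoly_fun UNIV m h' \<and> (\<forall>x\<in>X. h x = h' (T (vec_nth x)))"
      by (intro exI[of _ "\<lambda>x. F (T' x)"]) (simp add: F(2) T)
  qed auto
  then show ?thesis unfolding poly_growth_def by blast
qed

section \<open>Semialgebraic sets as finite unions of zero sets in open sets\<close>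

text \<open>Strict inequalities are absorbed in \<open>U\<close>, which may be any open set, so
  intersections with balls have the same form.\<close>

inductive loc_zero_set :: "(real^'n) set \<Rightarrow> bool" where
  basic: "mpoly_fun UNIV m f \<Longrightarrow> open U \<Longrightarrow> loc_zero_set ({x. f (vec_nth x) = 0} \<inter> U)"
| Un: "loc_zero_set A \<Longrightarrow> loc_zero_set B \<Longrightarrow> loc_zero_set (A \<union> B)"

lemma loc_zero_set_open: "open U \<Longrightarrow> loc_zero_set U"
  using loc_zero_set.basic[OF mpoly_fun.const[of UNIV 0 0]] by simp

lemma loc_zero_set_Int:
  assumes "loc_zero_set A" "loc_zero_set B"
  shows "loc_zero_set (A \<inter> B)"
  using assms
proof (induction A rule: loc_zero_set.induct)
  case (basic m f U)
  from basic(3) show ?case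
  proof (induction B rule: loc_zero_set.induct)
    case (basic m' g V)
    \<comment> \<open>Over the reals, two equations amount to one for the sum of the
      squares.\<close>
    have "mpoly_fun UNIV (m + m + (m' + m')) (\<lambda>x. f x * f x + g x * g x)"
      using \<open>mpoly_fun UNIV m f\<close> \<open>mpoly_fun UNIV m' g\<close>
      by (intro mpoly_fun.add mpoly_fun_mono_deg[OF mpoly_fun_mult]) auto
    from loc_zero_set.basic[OF this open_Int[OF \<open>open U\<close> \<open>open V\<close>]]
    show ?case by (rule back_subst[of loc_zero_set]) (auto simp: sum_squares_eq_zero_iff)
  next
    case (Un A B)
    then show ?case by (simp add: Int_Un_distrib loc_zero_set.Un)
  qed
next
  case (Un A A')
  then show ?case by (simp add: Int_Un_distrib2 loc_zero_set.Un)
qed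

lemma real_polynomial_function_mpoly_fun:
  fixes p :: "real^'n \<Rightarrow> real"
  assumes "real_polynomial_function p"
  shows "\<exists>m f. mpoly_fun UNIV m f \<and> p = (\<lambda>x. f (vec_nth x))"
  using assms
proof (induction rule: real_polynomial_function.induct)
  case (linear p)
  define f where "f v = (\<Sum>i\<in>UNIV. p (axis i 1) * v i)" for v
  have "p x = f (vec_nth x)" for x
  proof -
    have "linear p" using linear by (rule bounded_linear.linear)
    have "p x = p (\<Sum>i\<in>UNIV. x $ i *\<^sub>R axis i 1)" using basis_expansion[of x] by (simp add: scalar_mult_eq_scaleR)
    also have "\<dots> = f (vec_nth x)"
      by (simp add: linear_sum[OF \<open>linear p\<close>] linear_scale[OF \<open>linear p\<close>] f_def mult.commute)
    finally show ?thesis .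
  qed
  moreover have "mpoly_fun UNIV 1 f" unfolding f_def[abs_def]
    using mpoly_fun_coord[of _ UNIV 0] by (intro mpoly_fun_sum mpoly_fun_scale) auto
  ultimately show ?case by blast
next
  case (const c)
  then show ?case using mpoly_fun.const[of UNIV 0 c] by blast
next
  case (add f g)
  then obtain m u m' v where *: "mpoly_fun UNIV m u" "f = (\<lambda>x. u (vec_nth x))"
    "mpoly_fun UNIV m' v" "g = (\<lambda>x. v (vec_nth x))" by blast
  have "mpoly_fun UNIV (m + m') (\<lambda>x. u x + v x)"
    by (intro mpoly_fun.add mpoly_fun_mono_deg[OF *(1)] mpoly_fun_mono_deg[OF *(3)]) auto
  then show ?case using *(2,4) by blast
next
  case (mult f g)
  then obtain m u m' v where *: "mpoly_fun UNIV m u" "f = (\<lambda>x. u (vec_nth x))"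
    "mpoly_fun UNIV m' v" "g = (\<lambda>x. v (vec_nth x))" by blast
  have "mpoly_fun UNIV (m + m') (\<lambda>x. u x * v x)" by (rule mpoly_fun_mult[OF *(1,3)])
  then show ?case using *(2,4) by blast
qed

text \<open>The complement is carried along in the induction, since \<open>loc_zero_set\<close> has
  no rule for complements.\<close>

lemma semialgebraic_loc_zero_set:
  fixes A :: "(real^'n) set"
  assumes "semialgebraic A"
  shows "loc_zero_set A \<and> loc_zero_set (- A)"
  using assms
proof (induction rule: semialgebraic.induct)
  case (pos p)
  have o: "open {x. p x > 0}" "open {x. - p x > 0}"
    using continuous_real_polymonial_function[OF pos] continuous_at_imp_continuous_on
    by (auto intro!: open_Collect_less continuous_intros)
  obtain m f where f: "mpoly_fun UNIV m f" "p = (\<lambda>x. f (vec_nth x))"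
    using real_polynomial_function_mpoly_fun[OF pos] by blast
  have "loc_zero_set ({x. f (vec_nth x) = 0} \<inter> UNIV \<union> {x. - p x > 0})"
    by (intro loc_zero_set.Un loc_zero_set.basic[OF f(1)] loc_zero_set_open o) auto
  moreover have "{x. f (vec_nth x) = 0} \<inter> UNIV \<union> {x. - p x > 0} = - {x. p x > 0}"
    by (auto simp: f(2))
  ultimately show ?case using loc_zero_set_open[OF o(1)] by simp
next
  case (zero p)
  have "open {x. p x \<noteq> 0}"
    using continuous_real_polymonial_function[OF zero] continuous_at_imp_continuous_on
    by (auto intro!: open_Collect_neq continuous_intros)
  then have "loc_zero_set (- {x. p x = 0})"
    by (intro loc_zero_set_open) (simp add: Collect_neg_eq[symmetric])
  moreover obtain m f where f: "mpoly_fun UNIV m f" "p = (\<lambda>x. f (vec_nth x))"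
    using real_polynomial_function_mpoly_fun[OF zero] by blast
  ultimately show ?case using loc_zero_set.basic[OF f(1), of UNIV] by simp
next
  case (union A B)
  then show ?case by (simp add: loc_zero_set.Un loc_zero_set_Int)
next
  case (inter A B)
  then show ?case by (simp add: loc_zero_set.Un loc_zero_set_Int)
qed simp

lemma poly_growth_loc_zero_set:
  assumes "loc_zero_set A" "cells_dim_le A k"
  shows "poly_growth A k"
  using assms
proof (induction rule: loc_zero_set.induct)
  case (basic m f U)
  show ?case by (rule poly_growth_zero_set[OF refl basic])
next
  case (Un A B)
  then show ?case by (metis cells_dim_le_subset poly_growth_Un sup_ge1 sup_ge2)
qed

section \<open>Limits of secants\<close>

text \<open>The tensor product of the polynomials of degree at most \<open>m\<close> in either
  point. Allowing the full degree in both factors is generous but keeps the growth exponent.\<close>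

inductive separable :: "nat \<Rightarrow> ((real^'n) \<times> (real^'n) \<Rightarrow> real) \<Rightarrow> bool" where
  product: "mpoly_fun UNIV m u \<Longrightarrow> mpoly_fun UNIV m v \<Longrightarrow>
     separable m (\<lambda>p. u (vec_nth (fst p)) * v (vec_nth (snd p)))"
| add: "separable m g \<Longrightarrow> separable m h \<Longrightarrow> separable m (\<lambda>p. g p + h p)"

lemma linear_component_mpoly_fun:
  fixes T :: "real^'n \<Rightarrow> real^'n"
  assumes "linear T"
  obtains t where "mpoly_fun UNIV 1 t" "\<And>x. T x $ i = t (vec_nth x)"
proof -
  define t where "t v = (\<Sum>j\<in>UNIV. T (axis j 1) $ i * v j)" for v
  have "T x $ i = t (vec_nth x)" for x
  proof -
    have "T x = T (\<Sum>j\<in>UNIV. x $ j *\<^sub>R axis j 1)"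
      using basis_expansion[of x] by (simp add: scalar_mult_eq_scaleR)
    then show ?thesis
      by (simp add: linear_sum[OF assms] linear_scale[OF assms] t_def mult.commute)
  qed
  moreover have "mpoly_fun UNIV 1 t" unfolding t_def[abs_def]
    using mpoly_fun_coord[of _ UNIV 0] by (intro mpoly_fun_sum mpoly_fun_scale) auto
  ultimately show ?thesis using that by blast
qed

text \<open>A linear form of a difference is a function of one point minus a function of the other,
  so multiplying by it turns one product into two.\<close>

lemma separable_difference:
  fixes T :: "real^'n \<Rightarrow> real^'n"
  assumes "mpoly_fun I m F" "linear T"
  shows "separable m (\<lambda>p. F (\<lambda>i. T (fst p - snd p) $ i))"
  using assms(1)
proof (induction rule: mpoly_fun.induct)
  case (const m c)
  from separable.product[OF mpoly_fun.const[of UNIV m c] mpoly_fun.const[of UNIV m 1]]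
  show ?case by simp
next
  case (var i m F)
  obtain t where t: "mpoly_fun UNIV 1 t" "\<And>x. T x $ i = t (vec_nth x)"
    by (rule linear_component_mpoly_fun[OF assms(2), of i]) (rule that)
  have "separable (Suc m) (\<lambda>p. (t (vec_nth (fst p)) - t (vec_nth (snd p))) * h p)"
    if "separable m h" for h
    using that
  proof (induction rule: separable.induct)
    case (product m u v)
    have 1: "mpoly_fun UNIV (Suc m) (\<lambda>x. t x * u x)" "mpoly_fun UNIV (Suc m) (\<lambda>x. (- 1) * (t x * v x))"
      using mpoly_fun_mult[OF t(1) product(1)]
        mpoly_fun_scale[OF mpoly_fun_mult[OF t(1) product(2)], of "- 1"] by simp_all
    from separable.add[OF separable.product[OF 1(1) mpoly_fun_Suc[OF product(2)]]
        separable.product[OF mpoly_fun_Suc[OF product(1)] 1(2)]]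
    show ?case by (rule back_subst[of "separable (Suc m)"]) (auto simp: algebra_simps)
  next
    case (add m g h)
    from separable.add[OF add.IH] show ?case by (simp add: algebra_simps)
  qed
  from this[OF var.IH] show ?case by (simp add: linear_diff[OF assms(2)] t(2))
next
  case (add m f g)
  show ?case by (rule separable.add[OF add.IH])
qed

text \<open>Products of spanning functions on \<open>X\<close> give growth exponent
  \<open>2 * k\<close> on pairs, so the counting argument applies to any \<open>2 * k + 1\<close> of
  the forms.\<close>

lemma alg_dep_differences:
  fixes T :: "real^'n \<Rightarrow> real^'n"
  assumes "poly_growth X k" "linear T" "2 * k < card I"
  shows "alg_dep I (\<lambda>i p. T (fst p - snd p) $ i) (X \<times> X)"
proof -
  obtain I' where I': "I' \<subseteq> I" "card I' = Suc (2 * k)"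
    using assms(3) by (meson Suc_leI obtain_subset_with_card_n)
  obtain C where C: "\<And>m. fdim_le X (\<lambda>h. \<exists>F. mpoly_fun UNIV m F \<and> h = (\<lambda>x. F (vec_nth x))) (C * (m + 1) ^ k)"
    using assms(1) unfolding poly_growth_def by blast
  have "alg_dep I' (\<lambda>i p. T (fst p - snd p) $ i) (X \<times> X)"
  proof (rule alg_dep_if_fdim_le[OF _ I'(2), where C = "C * C"])
    show "finite I'" by simp
    fix m
    obtain B where B: "finite B" "card B \<le> C * (m + 1) ^ k"
      "\<And>F. mpoly_fun UNIV m F \<Longrightarrow> spanned_on X B (\<lambda>x. F (vec_nth x))"
      using C[of m] unfolding fdim_le_def by blast
    define B2 where "B2 = (\<lambda>(b, b') p. b (fst p) * b' (snd p)) ` (B \<times> B)"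
    have "finite B2" using B by (simp add: B2_def)
    have "card B2 \<le> card (B \<times> B)" unfolding B2_def by (rule card_image_le) (use B in auto)
    also have "\<dots> \<le> (C * (m + 1) ^ k) * (C * (m + 1) ^ k)"
      unfolding card_cartesian_product by (intro mult_le_mono B)
    also have "\<dots> = C * C * (m + 1) ^ (2 * k)" by (simp add: mult_2 power_add)
    finally have cardB2: "card B2 \<le> C * C * (m + 1) ^ (2 * k)" .
    have "spanned_on (X \<times> X) B2 h" if "separable m h" for h
      using that B(3)
    proof (induction rule: separable.induct)
      case (product m u v)
      show ?case
      proof (rule spanned_on_trans[OF product(3)[OF product(1)], where A' = "X \<times> X" and \<phi> = fst])
        fix b assume b: "b \<in> B"
        have "spanned_on (X \<times> X) B2 (\<lambda>p. v (vec_nth (snd p)) * b (fst p))"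
        proof (rule spanned_on_trans[OF product(3)[OF product(2)], where A' = "X \<times> X" and \<phi> = snd])
          fix b' assume "b' \<in> B"
          then have "(\<lambda>p. b (fst p) * b' (snd p)) \<in> B2" using b unfolding B2_def by force
          then show "spanned_on (X \<times> X) B2 (\<lambda>p. b' (snd p) * b (fst p))"
            using spanned_on_base[OF \<open>finite B2\<close>] by (simp add: mult.commute)
        qed auto
        then show "spanned_on (X \<times> X) B2 (\<lambda>p. b (fst p) * v (vec_nth (snd p)))" by (simp add: mult.commute)
      qed auto
    next
      case (add m g h)
      then show ?case by (intro spanned_on_add) auto
    qed
    then show "fdim_le (X \<times> X) (\<lambda>h. \<exists>f. mpoly_fun I' m f \<and> h = (\<lambda>p. f (\<lambda>i. T (fst p - snd p) $ i)))
        (C * C * (m + 1) ^ (2 * k))"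
      unfolding fdim_le_def using \<open>finite B2\<close> cardB2 separable_difference[OF _ assms(2)] by blast
  qed
  then show ?thesis using I'(1) by (rule alg_dep_mono_vars)
qed

text \<open>The points are not required to converge to \<open>0\<close>, and the scaling factors may be negative; this
  only enlarges the cone.\<close>

definition secant_cone :: "'a::real_normed_vector set \<Rightarrow> 'a set" where
  "secant_cone X = {u. \<exists>x y s. (\<forall>j::nat. x j \<in> X \<and> y j \<in> X \<and> s j \<noteq> 0) \<and> s \<longlonglongrightarrow> 0 \<and>
     (\<lambda>j. (x j - y j) /\<^sub>R s j) \<longlonglongrightarrow> u}"

lemma secant_cone_scale:
  assumes "u \<in> secant_cone X" "c \<noteq> 0"
  shows "c *\<^sub>R u \<in> secant_cone X"
proof -
  obtain x y s where *: "\<And>j::nat. x j \<in> X \<and> y j \<in> X \<and> s j \<noteq> 0" "s \<longlonglongrightarrow> 0"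
    "(\<lambda>j. (x j - y j) /\<^sub>R s j) \<longlonglongrightarrow> u" using assms(1) unfolding secant_cone_def by blast
  have "(\<lambda>j. c *\<^sub>R ((x j - y j) /\<^sub>R s j)) \<longlonglongrightarrow> c *\<^sub>R u" by (intro tendsto_intros *)
  moreover have "c *\<^sub>R ((x j - y j) /\<^sub>R s j) = (x j - y j) /\<^sub>R (s j / c)" for j
    by (simp add: divide_inverse)
  ultimately have "(\<lambda>j. (x j - y j) /\<^sub>R (s j / c)) \<longlonglongrightarrow> c *\<^sub>R u" by (simp only:)
  moreover have "(\<lambda>j. s j / c) \<longlonglongrightarrow> 0" using tendsto_divide[OF *(2) tendsto_const assms(2)] by simp
  ultimately show ?thesis unfolding secant_cone_def using *(1) assms(2)
    by (intro CollectI exI[of _ x] exI[of _ y] exI[of _ "\<lambda>j. s j / c"]) simp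
qed

text \<open>The homogeneous part of lowest degree of the relation survives in the limit.\<close>

lemma alg_dep_secant_cone:
  fixes T :: "real^'n \<Rightarrow> real^'n"
  assumes "alg_dep I (\<lambda>i p. T (fst p - snd p) $ i) (X \<times> X)" "linear T"
  shows "alg_dep I (\<lambda>i u. T u $ i) (secant_cone X)"
proof -
  obtain m f v where f: "mpoly_fun I m f" "f v \<noteq> 0"
    "\<And>p. p \<in> X \<times> X \<Longrightarrow> f (\<lambda>i. T (fst p - snd p) $ i) = 0"
    using assms(1) by (rule alg_depE) blast
  obtain h where h: "\<And>e. mpoly_fun I e (h e)" "\<And>e. homogeneous e (h e)"
    "\<And>x. f x = (\<Sum>e\<le>m. h e x)" using homogeneous_decomp[OF f(1)] by blast
  have "\<exists>e\<le>m. \<exists>v. h e v \<noteq> 0"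
  proof (rule ccontr)
    assume "\<not> ?thesis"
    then have "f v = 0" unfolding h(3) by (intro sum.neutral) auto
    with f(2) show False by simp
  qed
  then obtain e1 where e1: "e1 \<le> m \<and> (\<exists>v. h e1 v \<noteq> 0)" by blast
  define e0 where "e0 = (LEAST e. e \<le> m \<and> (\<exists>v. h e v \<noteq> 0))"
  have e0: "e0 \<le> m" "\<exists>v. h e0 v \<noteq> 0"
    using LeastI[of "\<lambda>e. e \<le> m \<and> (\<exists>v. h e v \<noteq> 0)", OF e1] unfolding e0_def by auto
  have low: "h e v = 0" if "e < e0" for e v
    using not_less_Least[of e "\<lambda>e. e \<le> m \<and> (\<exists>v. h e v \<noteq> 0)"] that e0(1) unfolding e0_def by auto
  have cont: "continuous_on UNIV (\<lambda>u::real^'n. h e (\<lambda>i. T u $ i))" for e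
    using linear_continuous_on[of T UNIV] assms(2)
    by (intro mpoly_fun_continuous[OF h(1)] continuous_intros) (simp add: linear_conv_bounded_linear)
  have "h e0 (\<lambda>i. T u $ i) = 0" if u: "u \<in> secant_cone X" for u
  proof -
    obtain x y s where *: "\<And>j::nat. x j \<in> X \<and> y j \<in> X \<and> s j \<noteq> 0" "s \<longlonglongrightarrow> 0"
      "(\<lambda>j. (x j - y j) /\<^sub>R s j) \<longlonglongrightarrow> u" using u unfolding secant_cone_def by blast
    define w where "w j = (x j - y j) /\<^sub>R s j" for j
    have hw: "(\<lambda>j. h e (\<lambda>i. T (w j) $ i)) \<longlonglongrightarrow> h e (\<lambda>i. T u $ i)" for e
      using continuous_on_tendsto_compose[OF cont *(3)[folded w_def], of e] by simp
    \<comment> \<open>By homogeneity each part carries a power of \<open>s j\<close>, and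
      \<open>s j ^ e0\<close> cancels. In the limit only \<open>e = e0\<close> is left, where
      \<open>0 ^ 0\<close> is 1.\<close>
    have "(\<Sum>e\<in>{e0..m}. s j ^ (e - e0) * h e (\<lambda>i. T (w j) $ i)) = 0" for j
    proof -
      have "x j - y j = s j *\<^sub>R w j" using *(1)[of j] by (simp add: w_def)
      then have "0 = f (\<lambda>i. s j * T (w j) $ i)"
        using f(3)[of "(x j, y j)"] *(1)[of j] by (simp add: linear_scale[OF assms(2)])
      also have "\<dots> = (\<Sum>e\<le>m. s j ^ e * h e (\<lambda>i. T (w j) $ i))"
        unfolding h(3) using h(2) by (simp add: homogeneous_def)
      also have "\<dots> = (\<Sum>e\<in>{e0..m}. s j ^ e * h e (\<lambda>i. T (w j) $ i))"
        using low by (intro sum.mono_neutral_right) (auto simp: not_le)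
      also have "\<dots> = s j ^ e0 * (\<Sum>e\<in>{e0..m}. s j ^ (e - e0) * h e (\<lambda>i. T (w j) $ i))"
        unfolding sum_distrib_left by (intro sum.cong refl) (simp flip: power_add mult.assoc)
      finally show ?thesis using *(1)[of j] by simp
    qed
    moreover have "(\<lambda>j. \<Sum>e\<in>{e0..m}. s j ^ (e - e0) * h e (\<lambda>i. T (w j) $ i)) \<longlonglongrightarrow>
        (\<Sum>e\<in>{e0..m}. 0 ^ (e - e0) * h e (\<lambda>i. T u $ i))"
      by (intro tendsto_intros hw *(2))
    moreover have "(\<Sum>e\<in>{e0..m}. 0 ^ (e - e0) * h e (\<lambda>i. T u $ i)) =
        (\<Sum>e\<in>{e0}. 0 ^ (e - e0) * h e (\<lambda>i. T u $ i))"
      using e0(1) by (intro sum.mono_neutral_right) auto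
    ultimately show ?thesis by (simp add: LIMSEQ_const_iff)
  qed
  moreover obtain v0 where "h e0 v0 \<noteq> 0" using e0(2) by blast
  ultimately show ?thesis using alg_depI[OF h(1)[of e0], of v0 "secant_cone X" "\<lambda>i u. T u $ i"] by blast
qed

section \<open>Subspaces that avoid a cone\<close>

text \<open>Quantifying over all linear \<open>T\<close> makes the bound invariant under changes of
  coordinates, as the elimination of forms one by one requires.\<close>

definition cone_dim_le :: "(real^'n) set \<Rightarrow> nat \<Rightarrow> bool" where
  "cone_dim_le C e \<longleftrightarrow> (\<forall>(T :: real^'n \<Rightarrow> real^'n) I. linear T \<longrightarrow> e < card I \<longrightarrow> alg_dep I (\<lambda>i u. T u $ i) C)"

lemma cone_dim_le_secant_cone: "poly_growth X k \<Longrightarrow> cone_dim_le (secant_cone X) (2 * k)"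
  unfolding cone_dim_le_def by (intro allI impI alg_dep_secant_cone alg_dep_differences)

lemma cone_dim_le_Un: "cone_dim_le C e \<Longrightarrow> cone_dim_le D e \<Longrightarrow> cone_dim_le (C \<union> D) e"
  unfolding cone_dim_le_def by (simp add: alg_dep_Un)

lemma cone_dim_le_mono: "cone_dim_le C e \<Longrightarrow> e \<le> e' \<Longrightarrow> cone_dim_le C e'"
  unfolding cone_dim_le_def by simp

text \<open>On \<open>W\<close> the relation can be chosen linear. This lets a subspace be treated
  as a further cone to avoid.\<close>

lemma cone_dim_le_subspace:
  fixes W :: "(real^'n) set"
  assumes "subspace W"
  shows "cone_dim_le W (dim W)"
  unfolding cone_dim_le_def
proof (intro allI impI)
  fix T :: "real^'n \<Rightarrow> real^'n" and I :: "'n set"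
  assume T: "linear T" and I: "dim W < card I"
  obtain B where B: "B \<subseteq> W" "independent B" "W \<subseteq> span B" "card B = dim W"
    using basis_exists by blast
  have "finite B" using B(2) by (rule independent_imp_finite)
  then obtain \<gamma> where \<gamma>: "\<exists>i\<in>I. \<gamma> i \<noteq> 0" "\<forall>b\<in>B. (\<Sum>i\<in>I. \<gamma> i * T b $ i) = 0"
    using homogeneous_system[of B I "\<lambda>i b. T b $ i"] I B(4) by auto
  then obtain i0 where i0: "i0 \<in> I" "\<gamma> i0 \<noteq> 0" by blast
  have "mpoly_fun I 1 (\<lambda>v. \<Sum>i\<in>I. \<gamma> i * v i)"
    using mpoly_fun_coord[of _ I 0] by (intro mpoly_fun_sum mpoly_fun_scale) auto
  moreover have "(\<Sum>i\<in>I. \<gamma> i * (if i = i0 then 1 else 0)) \<noteq> 0"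
    using i0 by (simp add: if_distrib[of "\<lambda>u. _ * u"] sum.delta cong: if_cong)
  moreover have "(\<Sum>i\<in>I. \<gamma> i * T u $ i) = 0" if "u \<in> W" for u
  proof (rule linear_eq_0_on_span[of "\<lambda>u. \<Sum>i\<in>I. \<gamma> i * T u $ i" B])
    show "linear (\<lambda>u. \<Sum>i\<in>I. \<gamma> i * T u $ i)"
      by (rule linearI) (simp_all add: linear_add[OF T] linear_scale[OF T] sum.distrib
          distrib_left sum_distrib_left mult_ac)
  qed (use \<gamma>(2) B(3) that in auto)
  ultimately show "alg_dep I (\<lambda>i u. T u $ i) W"
    by (intro alg_depI[of I 1 "\<lambda>v. \<Sum>i\<in>I. \<gamma> i * v i" "\<lambda>i. if i = i0 then 1 else 0"])
qed

text \<open>Repeated projection from a point: more than \<open>e\<close> forms satisfy a relation on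
  \<open>C\<close>, and a direction \<open>v\<close> violating it is missed by the cone, so
  projecting along \<open>v\<close> drops one form. The induction runs down from all
  coordinates.\<close>

lemma cone_avoiding_coordinates:
  fixes C :: "(real^'n) set"
  assumes scale: "\<And>u c. u \<in> C \<Longrightarrow> c \<noteq> 0 \<Longrightarrow> c *\<^sub>R u \<in> C"
    and dim: "cone_dim_le C e" and "e \<le> N" "N \<le> CARD('n)"
  shows "\<exists>(T :: real^'n \<Rightarrow> real^'n) I. linear T \<and> inj T \<and> card I = N \<and>
     (\<forall>u\<in>C. (\<forall>i\<in>I. T u $ i = 0) \<longrightarrow> u = 0)"
  using assms(4,3)
proof (induction rule: inc_induct)
  case base
  show ?case
    by (rule exI[of _ "\<lambda>x. x"], rule exI[of _ UNIV]) (auto simp: linear_id[unfolded id_def] inj_on_def vec_eq_iff)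
next
  case (step N)
  then obtain T :: "real^'n \<Rightarrow> real^'n" and I where T: "linear T" "inj T" "card I = Suc N"
    "\<And>u. u \<in> C \<Longrightarrow> (\<forall>i\<in>I. T u $ i = 0) \<Longrightarrow> u = 0" by (metis le_SucI)
  have "alg_dep I (\<lambda>i u. T u $ i) C" using dim T step.prems unfolding cone_dim_le_def by simp
  then obtain m f v' where f: "mpoly_fun I m f" "f v' \<noteq> 0" "\<And>u. u \<in> C \<Longrightarrow> f (\<lambda>i. T u $ i) = 0"
    by (rule alg_depE) blast
  obtain z where z: "z \<in> I" using T(3) by (metis card.empty ex_in_conv nat.distinct(1))
  \<comment> \<open>The factor \<open>v z\<close> makes the component of the direction at
    \<open>z\<close> nonzero, so that form \<open>z\<close> can be used for the projection.\<close>
  have "\<exists>v. v z * f v \<noteq> 0"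
    using mpoly_fun_mult_nonzero[of I 1 "\<lambda>v. v z" "\<lambda>_. 1" I m f v'] mpoly_fun_coord[OF z, of 0] f(1,2) by simp
  then obtain v where v: "v z \<noteq> 0" "f v \<noteq> 0" by auto
  \<comment> \<open>The forms in \<open>I - {z}\<close> are changed so as to vanish in direction
    \<open>v\<close>; keeping form \<open>z\<close> keeps the map injective.\<close>
  define T' where "T' u = (\<chi> i. T u $ i - (if i \<in> I - {z} then v i / v z * T u $ z else 0))" for u
  have "linear T'" unfolding T'_def
    by (rule linearI) (simp_all add: vec_eq_iff linear_add[OF T(1)] linear_scale[OF T(1)] algebra_simps)
  moreover have "inj T'"
  proof (rule injI)
    fix x y assume "T' x = T' y"
    then have eq: "T' x $ i = T' y $ i" for i by simp
    have z': "T x $ z = T y $ z" using eq[of z] by (simp add: T'_def)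
    have "T x $ i = T y $ i" for i
      using eq[of i] z' by (cases "i \<in> I - {z}") (auto simp: T'_def)
    then have "T x = T y" by (simp add: vec_eq_iff)
    then show "x = y" by (rule injD[OF T(2)])
  qed
  moreover have "card (I - {z}) = N" using T(3) z by simp
  moreover have "u = 0" if u: "u \<in> C" "\<forall>i\<in>I - {z}. T' u $ i = 0" for u
  proof (cases "T u $ z = 0")
    case True
    have "\<forall>i\<in>I. T u $ i = 0"
    proof
      fix i assume "i \<in> I"
      then show "T u $ i = 0" using u(2) True by (cases "i = z") (auto simp: T'_def)
    qed
    then show ?thesis using T(4) u(1) by blast
  next
    case False
    \<comment> \<open>On \<open>I\<close> the old forms of \<open>u\<close> are proportional to
      \<open>v\<close>; rescaled to equal \<open>v\<close>, they belong to a point of the cone where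
      the relation fails.\<close>
    let ?c = "v z / T u $ z"
    have "f (\<lambda>i. T (?c *\<^sub>R u) $ i) = f v"
    proof (rule mpoly_fun_cong[OF f(1)])
      fix i assume "i \<in> I"
      then show "T (?c *\<^sub>R u) $ i = v i"
        using u(2) False v(1) by (cases "i = z") (auto simp: T'_def linear_scale[OF T(1)])
    qed
    moreover have "?c *\<^sub>R u \<in> C" using u(1) False v(1) by (intro scale) auto
    ultimately show ?thesis using f(3) v(2) by simp
  qed
  ultimately show ?case by blast
qed

lemma cone_avoiding_subspace:
  fixes C :: "(real^'n) set"
  assumes "\<And>u c. u \<in> C \<Longrightarrow> c \<noteq> 0 \<Longrightarrow> c *\<^sub>R u \<in> C" "cone_dim_le C e" "e \<le> CARD('n)"
  obtains W where "subspace W" "dim W = CARD('n) - e" "\<And>u. u \<in> C \<Longrightarrow> u \<in> W \<Longrightarrow> u = 0"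
proof -
  obtain T :: "real^'n \<Rightarrow> real^'n" and I where T: "linear T" "inj T" "card I = e"
    "\<And>u. u \<in> C \<Longrightarrow> (\<forall>i\<in>I. T u $ i = 0) \<Longrightarrow> u = 0"
    using cone_avoiding_coordinates[OF assms(1,2) order_refl assms(3)] by metis
  define W where "W = {u. \<forall>i\<in>I. T u $ i = 0}"
  have sub: "subspace W"
    by (auto simp: W_def subspace_def linear_add[OF T(1)] linear_scale[OF T(1)] linear_0[OF T(1)])
  have "surj T" using T(1,2) linear_inj_imp_surj by blast
  then have "T ` W = {x. \<forall>i. i \<notin> - I \<longrightarrow> x $ i = 0}"
    by (auto simp: W_def image_iff) (metis surjD)
  then have "dim (T ` W) = CARD('n) - e"
    using dim_coordinate_subspace[of "- I"] T(3) card_Diff_subset[of I UNIV] by (simp add: Compl_eq_Diff_UNIV)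
  moreover have "dim (T ` W) = dim W"
    using T(1,2) by (intro dim_image_eq) (auto intro: inj_on_subset)
  ultimately show ?thesis using that[of W] sub T(4) by (simp add: W_def)
qed

text \<open>With n the dimension of the space, \<open>W\<close> has dimension n - 2k. To find
  \<open>V\<close>, of dimension 2k, the union of \<open>W\<close> and the secants of
  \<open>Y\<close> must have algebraic dimension at most n - 2k; for the secants this means 2k <= n
  - 2k, the hypothesis on \<open>k\<close>.\<close>

lemma complementary_subspaces_avoiding_secants:
  fixes X Y :: "(real^'n) set"
  assumes "poly_growth X k" "poly_growth Y k" "4 * k \<le> CARD('n)"
  obtains V W where "subspace V" "subspace W" "V \<inter> W = {0}" "dim V + dim W = CARD('n)"
    "\<And>u. u \<in> secant_cone X \<Longrightarrow> u \<in> W \<Longrightarrow> u = 0" "\<And>u. u \<in> secant_cone Y \<Longrightarrow> u \<in> V \<Longrightarrow> u = 0"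
proof -
  obtain W where W: "subspace W" "dim W = CARD('n) - 2 * k" "\<And>u. u \<in> secant_cone X \<Longrightarrow> u \<in> W \<Longrightarrow> u = 0"
    by (rule cone_avoiding_subspace[of "secant_cone X" "2 * k"])
      (use assms in \<open>auto intro: secant_cone_scale cone_dim_le_secant_cone\<close>)
  have 1: "cone_dim_le (W \<union> secant_cone Y) (dim W)"
    using assms W(2) by (intro cone_dim_le_Un cone_dim_le_subspace W(1)
        cone_dim_le_mono[OF cone_dim_le_secant_cone]) auto
  have 2: "c *\<^sub>R u \<in> W \<union> secant_cone Y" if "u \<in> W \<union> secant_cone Y" "c \<noteq> 0" for u c
    using that subspace_scale[OF W(1)] secant_cone_scale by blast
  obtain V where V: "subspace V" "dim V = CARD('n) - dim W" "\<And>u. u \<in> W \<union> secant_cone Y \<Longrightarrow> u \<in> V \<Longrightarrow> u = 0"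
    by (rule cone_avoiding_subspace[OF 2 1]) (use W(2) in auto)
  show ?thesis
  proof (rule that[OF V(1) W(1)])
    show "V \<inter> W = {0}" using V(1,3) W(1) subspace_0 by blast
    show "dim V + dim W = CARD('n)" using V(2) W(2) by simp
  qed (use V(3) W(3) in auto)
qed

lemma projection_along_complement:
  fixes V W :: "'a::euclidean_space set"
  assumes "subspace V" "subspace W" "V \<inter> W = {0}" "dim V + dim W = DIM('a)"
  obtains P where "linear P" "\<And>x. P x \<in> V" "\<And>x. x - P x \<in> W" "\<And>x. x \<in> V \<Longrightarrow> P x = x" "\<And>x. x \<in> W \<Longrightarrow> P x = 0"
proof -
  have "dim {x + y |x y. x \<in> V \<and> y \<in> W} = DIM('a)"
    using dim_sums_Int[OF assms(1,2)] assms(3,4) by simp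
  moreover have "subspace {x + y |x y. x \<in> V \<and> y \<in> W}" using assms by (intro subspace_sums)
  ultimately have *: "{x + y |x y. x \<in> V \<and> y \<in> W} = UNIV"
    using dim_eq_full span_eq_iff by (metis (no_types, lifting))
  have "\<exists>v. v \<in> V \<and> x - v \<in> W" for x
  proof -
    have "x \<in> {x + y |x y. x \<in> V \<and> y \<in> W}" unfolding * by simp
    then obtain a b where "x = a + b" "a \<in> V" "b \<in> W" by blast
    then show ?thesis by (intro exI[of _ a]) simp
  qed
  then obtain P where P: "\<And>x. P x \<in> V" "\<And>x. x - P x \<in> W" by metis
  have unique: "P x = v" if "v \<in> V" "x - v \<in> W" for x v
  proof -
    have "P x - v \<in> V" using P(1) that(1) assms(1) by (intro subspace_diff)
    moreover have "(x - v) - (x - P x) \<in> W" by (rule subspace_diff[OF assms(2) that(2) P(2)])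
    ultimately have "P x - v \<in> V \<inter> W" by (simp add: algebra_simps)
    then show ?thesis using assms(3) by simp
  qed
  have "linear P"
  proof (rule linearI)
    fix x y
    have "(x - P x) + (y - P y) \<in> W" using P(2) assms(2) by (intro subspace_add)
    then show "P (x + y) = P x + P y"
      using P(1) assms(1) by (intro unique subspace_add) (auto simp: algebra_simps)
    fix c
    have "c *\<^sub>R (x - P x) \<in> W" using P(2) assms(2) by (intro subspace_scale)
    then show "P (c *\<^sub>R x) = c *\<^sub>R P x"
      using P(1) assms(1) by (intro unique subspace_scale) (auto simp: algebra_simps)
  qed
  moreover have "P x = x" if "x \<in> V" for x using that assms(2) subspace_0 by (intro unique) auto
  moreover have "P x = 0" if "x \<in> W" for x using that assms(1) subspace_0 by (intro unique) auto
  ultimately show ?thesis using that P by blast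
qed

text \<open>Otherwise there are secants between points tending to 0 which \<open>P\<close> shrinks
  more and more; normalised, they accumulate on the compact sphere at a unit vector of the secant
  cone killed by \<open>P\<close>.\<close>

lemma projection_injective_near_0:
  fixes X :: "'a::euclidean_space set" and P :: "'a \<Rightarrow> 'a"
  assumes "linear P" "\<And>u. u \<in> secant_cone X \<Longrightarrow> P u = 0 \<Longrightarrow> u = 0"
  obtains L r where "r > 0" "\<And>x y. x \<in> X \<inter> ball 0 r \<Longrightarrow> y \<in> X \<inter> ball 0 r \<Longrightarrow> norm (x - y) \<le> L * norm (P (x - y))"
proof (rule ccontr)
  assume "\<not> thesis"
  have "\<exists>x y. x \<in> X \<inter> ball 0 (inverse (real (Suc j))) \<and> y \<in> X \<inter> ball 0 (inverse (real (Suc j))) \<and>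
      norm (x - y) > real (Suc j) * norm (P (x - y))" for j
  proof (rule ccontr)
    assume no: "\<not> ?thesis"
    have thesis
    proof (rule that[of "inverse (real (Suc j))" "real (Suc j)"])
      fix x y
      assume "x \<in> X \<inter> ball 0 (inverse (real (Suc j)))" "y \<in> X \<inter> ball 0 (inverse (real (Suc j)))"
      then show "norm (x - y) \<le> real (Suc j) * norm (P (x - y))" using no by (meson not_le)
    qed simp
    with \<open>\<not> thesis\<close> show False ..
  qed
  then obtain x y where xy: "\<And>j. x j \<in> X" "\<And>j. y j \<in> X"
    "\<And>j. norm (x j) < inverse (real (Suc j))" "\<And>j. norm (y j) < inverse (real (Suc j))"
    "\<And>j. norm (x j - y j) > real (Suc j) * norm (P (x j - y j))"
    by (simp add: dist_norm) metis
  define s where "s j = norm (x j - y j)" for j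
  have s0: "s j > 0" for j
    unfolding s_def by (rule le_less_trans[OF _ xy(5)]) simp
  have "s \<longlonglongrightarrow> 0"
  proof (rule Lim_null_comparison[of _ "\<lambda>j. 2 * inverse (real (Suc j))"])
    have "norm (s j) \<le> 2 * inverse (real (Suc j))" for j
      using xy(3,4)[of j] norm_triangle_ineq4[of "x j" "y j"] by (simp add: s_def)
    then show "\<forall>\<^sub>F j in sequentially. norm (s j) \<le> 2 * inverse (real (Suc j))" by simp
    show "(\<lambda>j. 2 * inverse (real (Suc j))) \<longlonglongrightarrow> 0"
      using tendsto_mult_right[OF LIMSEQ_inverse_real_of_nat, of 2] by simp
  qed
  define w where "w j = (x j - y j) /\<^sub>R s j" for j
  have nw: "norm (w j) = 1" for j using s0[of j] by (simp add: w_def) (simp add: s_def)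
  then have "\<And>j. w j \<in> sphere 0 1" by simp
  then obtain u \<rho> where u: "u \<in> sphere 0 1" "strict_mono \<rho>" "(w \<circ> \<rho>) \<longlonglongrightarrow> u"
    using compact_sphere[of 0 1] unfolding compact_def by meson
  have "u \<in> secant_cone X" unfolding secant_cone_def
  proof (rule CollectI, rule exI[of _ "x \<circ> \<rho>"], rule exI[of _ "y \<circ> \<rho>"], rule exI[of _ "s \<circ> \<rho>"],
      intro conjI allI)
    show "(s \<circ> \<rho>) \<longlonglongrightarrow> 0" using \<open>s \<longlonglongrightarrow> 0\<close> u(2) by (rule LIMSEQ_subseq_LIMSEQ)
    show "(\<lambda>j. ((x \<circ> \<rho>) j - (y \<circ> \<rho>) j) /\<^sub>R (s \<circ> \<rho>) j) \<longlonglongrightarrow> u" using u(3) by (simp add: w_def o_def)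
    show "(s \<circ> \<rho>) j \<noteq> 0" for j using s0[of "\<rho> j"] by simp
  qed (use xy in auto)
  moreover have "P u = 0"
  proof (rule LIMSEQ_unique)
    have "isCont P u" using assms(1) by (simp add: linear_continuous_at linear_conv_bounded_linear)
    then show "(\<lambda>j. P ((w \<circ> \<rho>) j)) \<longlonglongrightarrow> P u" using u(3) by (rule isCont_tendsto_compose)
    have "(\<lambda>j. P (w j)) \<longlonglongrightarrow> 0"
    proof (rule Lim_null_comparison[OF _ LIMSEQ_inverse_real_of_nat])
      have "norm (P (w j)) \<le> inverse (real (Suc j))" for j
      proof -
        have "norm (P (w j)) = norm (P (x j - y j)) / s j"
          using s0[of j] by (simp add: w_def linear_scale[OF assms(1)] divide_inverse)
        also have "\<dots> \<le> inverse (real (Suc j))"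
          using xy(5)[of j] s0[of j] by (simp add: s_def field_simps)
        finally show ?thesis .
      qed
      then show "\<forall>\<^sub>F j in sequentially. norm (P (w j)) \<le> inverse (real (Suc j))" by simp
    qed
    from LIMSEQ_subseq_LIMSEQ[OF this u(2)] show "(\<lambda>j. P ((w \<circ> \<rho>) j)) \<longlonglongrightarrow> 0" by (simp add: o_def)
  qed
  ultimately have "u = 0" by (rule assms(2))
  then show False using u(1) by simp
qed

section \<open>Lipschitz extension and tame shears\<close>

text \<open>McShane's extension, for a function given on \<open>p ` A\<close> through its values along \<open>p\<close>.\<close>

lemma lipschitz_extension_real:
  fixes p :: "'c \<Rightarrow> 'a::metric_space" and v :: "'c \<Rightarrow> real"
  assumes "L \<ge> 0" "\<And>x y. x \<in> A \<Longrightarrow> y \<in> A \<Longrightarrow> \<bar>v x - v y\<bar> \<le> L * dist (p x) (p y)"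
  obtains g where "L-lipschitz_on UNIV g" "\<And>x. x \<in> A \<Longrightarrow> g (p x) = v x"
proof (cases "A = {}")
  case True
  have "L-lipschitz_on UNIV (\<lambda>x::'a. 0::real)" using assms(1) by (intro lipschitz_onI) auto
  then show ?thesis using that[of "\<lambda>_. 0"] True by simp
next
  case False
  define g where "g z = (INF x\<in>A. v x + L * dist z (p x))" for z
  have bdd: "bdd_below ((\<lambda>x. v x + L * dist z (p x)) ` A)" for z
  proof -
    obtain a where a: "a \<in> A" using False by blast
    have "v a - L * dist (p a) z \<le> v x + L * dist z (p x)" if "x \<in> A" for x
    proof -
      have "v a - v x \<le> L * dist (p a) (p x)" using assms(2)[OF a that] by simp
      also have "\<dots> \<le> L * (dist (p a) z + dist z (p x))"
        using assms(1) dist_triangle by (intro mult_left_mono) auto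
      finally show ?thesis by (simp add: distrib_left)
    qed
    then show ?thesis by (intro bdd_belowI2)
  qed
  have le: "g z \<le> g z' + L * dist z z'" for z z'
  proof -
    have "g z - L * dist z z' \<le> g z'"
      unfolding g_def[of z']
    proof (rule cINF_greatest[OF False])
      fix x assume "x \<in> A"
      have "g z \<le> v x + L * dist z (p x)" unfolding g_def by (rule cINF_lower[OF bdd \<open>x \<in> A\<close>])
      also have "L * dist z (p x) \<le> L * (dist z z' + dist z' (p x))"
        using assms(1) dist_triangle by (intro mult_left_mono) auto
      finally show "g z - L * dist z z' \<le> v x + L * dist z' (p x)" by (simp add: distrib_left)
    qed
    then show ?thesis by simp
  qed
  have "L-lipschitz_on UNIV g"
  proof (rule lipschitz_onI[OF _ assms(1)])
    fix z z'
    show "dist (g z) (g z') \<le> L * dist z z'"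
      using le[of z z'] le[of z' z] by (simp add: dist_real_def dist_commute abs_le_iff)
  qed
  moreover have "g (p x) = v x" if x: "x \<in> A" for x
  proof (rule antisym)
    have "g (p x) \<le> v x + L * dist (p x) (p x)" unfolding g_def by (rule cINF_lower[OF bdd x])
    then show "g (p x) \<le> v x" by simp
    show "v x \<le> g (p x)" unfolding g_def
    proof (rule cINF_greatest[OF False])
      fix y assume "y \<in> A"
      then show "v x \<le> v y + L * dist (p x) (p y)" using assms(2)[OF x \<open>y \<in> A\<close>] by simp
    qed
  qed
  ultimately show ?thesis using that by blast
qed

lemma orthonormal_basis_subspace_expand:
  fixes W :: "'a::euclidean_space set"
  assumes "subspace W"
  obtains B where "finite B" "B \<subseteq> W" "\<And>b. b \<in> B \<Longrightarrow> norm b = 1" "\<And>x. x \<in> W \<Longrightarrow> (\<Sum>b\<in>B. (x \<bullet> b) *\<^sub>R b) = x"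
proof -
  obtain B where B: "B \<subseteq> W" "pairwise orthogonal B" "\<And>b. b \<in> B \<Longrightarrow> norm b = 1"
    "independent B" "span B = W"
    using orthonormal_basis_subspace[OF assms] by metis
  have "finite B" using B(4) by (rule independent_imp_finite)
  then show ?thesis using that[of B] B orthonormal_basis_expand[OF B(2,3)] by blast
qed

text \<open>Extending the components in an orthonormal basis of \<open>W\<close> keeps the values in
  \<open>W\<close>, as needed for a shear in direction \<open>W\<close>.\<close>

lemma lipschitz_extension_subspace:
  fixes p :: "'c \<Rightarrow> 'a::metric_space" and v :: "'c \<Rightarrow> 'b::euclidean_space"
  assumes "subspace W" "\<And>x. x \<in> A \<Longrightarrow> v x \<in> W"
    "\<And>x y. x \<in> A \<Longrightarrow> y \<in> A \<Longrightarrow> norm (v x - v y) \<le> L * dist (p x) (p y)"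
  obtains g C where "C-lipschitz_on UNIV g" "\<And>z. g z \<in> W" "\<And>x. x \<in> A \<Longrightarrow> g (p x) = v x"
proof -
  obtain B where B: "finite B" "B \<subseteq> W" "\<And>b. b \<in> B \<Longrightarrow> norm b = 1"
    "\<And>x. x \<in> W \<Longrightarrow> (\<Sum>b\<in>B. (x \<bullet> b) *\<^sub>R b) = x"
    using orthonormal_basis_subspace_expand[OF assms(1)] by blast
  have "\<exists>g. \<bar>L\<bar>-lipschitz_on UNIV g \<and> (\<forall>x\<in>A. g (p x) = v x \<bullet> b)" if b: "b \<in> B" for b
  proof -
    have "\<bar>v x \<bullet> b - v y \<bullet> b\<bar> \<le> \<bar>L\<bar> * dist (p x) (p y)" if "x \<in> A" "y \<in> A" for x y
    proof -
      have "\<bar>v x \<bullet> b - v y \<bullet> b\<bar> \<le> norm (v x - v y) * norm b"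
        using Cauchy_Schwarz_ineq2[of "v x - v y" b] by (simp add: inner_diff_left)
      also have "\<dots> \<le> L * dist (p x) (p y)" using assms(3)[OF that] B(3)[OF b] by simp
      also have "\<dots> \<le> \<bar>L\<bar> * dist (p x) (p y)" by (intro mult_right_mono) auto
      finally show ?thesis .
    qed
    then obtain g where "\<bar>L\<bar>-lipschitz_on UNIV g" "\<And>x. x \<in> A \<Longrightarrow> g (p x) = v x \<bullet> b"
      using lipschitz_extension_real[of "\<bar>L\<bar>" A "\<lambda>x. v x \<bullet> b" p] by auto
    then show ?thesis by blast
  qed
  then obtain g where g: "\<And>b. b \<in> B \<Longrightarrow> \<bar>L\<bar>-lipschitz_on UNIV (g b)"
    "\<And>b x. b \<in> B \<Longrightarrow> x \<in> A \<Longrightarrow> g b (p x) = v x \<bullet> b" by metis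
  define G where "G z = (\<Sum>b\<in>B. g b z *\<^sub>R b)" for z
  have "(real (card B) * \<bar>L\<bar>)-lipschitz_on UNIV G"
  proof (rule lipschitz_onI)
    fix z z'
    have "dist (G z) (G z') = norm (\<Sum>b\<in>B. (g b z - g b z') *\<^sub>R b)"
      by (simp add: G_def dist_norm scaleR_left_diff_distrib sum_subtractf)
    also have "\<dots> \<le> (\<Sum>b\<in>B. \<bar>L\<bar> * dist z z')"
    proof (rule sum_norm_le)
      fix b assume "b \<in> B"
      then show "norm ((g b z - g b z') *\<^sub>R b) \<le> \<bar>L\<bar> * dist z z'"
        using lipschitz_onD[OF g(1), of b z z'] B(3) by (simp add: dist_real_def)
    qed
    finally show "dist (G z) (G z') \<le> real (card B) * \<bar>L\<bar> * dist z z'" by simp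
  qed simp
  moreover have "G z \<in> W" for z
    unfolding G_def using B(2) assms(1) by (intro subspace_sum subspace_scale) auto
  moreover have "G (p x) = v x" if "x \<in> A" for x
    using g(2)[OF _ that] B(4)[OF assms(2)[OF that]] by (simp add: G_def)
  ultimately show ?thesis using that by blast
qed

section \<open>Bi-Lipschitz shears as tame maps\<close>

text \<open>The maps constructed live on the whole space; composing global maps takes no shrinking
  of neighbourhoods.\<close>

definition bilipschitz_homeo :: "('a::real_normed_vector \<Rightarrow> 'a) \<Rightarrow> bool" where
  "bilipschitz_homeo F \<longleftrightarrow> F 0 = 0 \<and> (\<exists>G C D. C-lipschitz_on UNIV F \<and> D-lipschitz_on UNIV G \<and>
     (\<forall>x. G (F x) = x) \<and> (\<forall>y. F (G y) = y))"

lemma bilipschitz_homeo_imp_germ: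
  assumes "bilipschitz_homeo F"
  shows "bilipschitz_germ UNIV UNIV F"
proof -
  obtain G C D where G: "F 0 = 0" "C-lipschitz_on UNIV F" "D-lipschitz_on UNIV G"
    "\<And>x. G (F x) = x" "\<And>y. F (G y) = y"
    using assms unfolding bilipschitz_homeo_def by blast
  have inj: "inj F" using G(4) by (metis injI)
  have range: "range F = UNIV" using G(5) by (metis surjI)
  have "inv F = G" using G(4,5) by (metis inj inv_unique_comp comp_apply ext id_apply)
  then show ?thesis unfolding bilipschitz_germ_def
    using G(1,2,3) inj range by (intro conjI exI[of _ UNIV]) (auto simp: set_germ_eq_def)
qed

lemma bilipschitz_homeo_comp:
  assumes "bilipschitz_homeo F" "bilipschitz_homeo F'"
  shows "bilipschitz_homeo (F \<circ> F')"
proof -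
  obtain G C D where G: "F 0 = 0" "C-lipschitz_on UNIV F" "D-lipschitz_on UNIV G"
    "\<And>x. G (F x) = x" "\<And>y. F (G y) = y"
    using assms(1) unfolding bilipschitz_homeo_def by blast
  obtain G' C' D' where G': "F' 0 = 0" "C'-lipschitz_on UNIV F'" "D'-lipschitz_on UNIV G'"
    "\<And>x. G' (F' x) = x" "\<And>y. F' (G' y) = y"
    using assms(2) unfolding bilipschitz_homeo_def by blast
  have "(C * C')-lipschitz_on UNIV (F \<circ> F')" "(D' * D)-lipschitz_on UNIV (G' \<circ> G)"
    by (rule lipschitz_on_compose[OF G'(2) lipschitz_on_subset[OF G(2) subset_UNIV]],
        rule lipschitz_on_compose[OF G(3) lipschitz_on_subset[OF G'(3) subset_UNIV]])
  then show ?thesis unfolding bilipschitz_homeo_def using G G'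
    by (intro conjI exI[of _ "G' \<circ> G"] exI[of _ "C * C'"] exI[of _ "D' * D"]) auto
qed

text \<open>Moving by \<open>h x\<close> in either direction does not change \<open>h\<close>, so
  subtracting \<open>h\<close> gives the inverse.\<close>

lemma bilipschitz_homeo_shear:
  fixes h :: "'a::real_normed_vector \<Rightarrow> 'a"
  assumes "C-lipschitz_on UNIV h" "h 0 = 0" "\<And>x. h (x + h x) = h x" "\<And>x. h (x - h x) = h x"
  shows "bilipschitz_homeo (\<lambda>x. x + h x)"
proof -
  have "(1 + C)-lipschitz_on UNIV (\<lambda>x. x + h x)" "(1 + C)-lipschitz_on UNIV (\<lambda>x. x - h x)"
    using assms(1) by (auto intro: lipschitz_intros)
  then show ?thesis unfolding bilipschitz_homeo_def using assms(2-4)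
    by (intro conjI exI[of _ "\<lambda>x. x - h x"] exI[of _ "1 + C"]) auto
qed

lemma norm_axis_real: "norm (axis i c :: real^'n) = \<bar>c\<bar>"
  by (simp add: norm_eq_sqrt_inner inner_axis_axis flip: power2_eq_square)

text \<open>If the orthogonal map taking \<open>w\<close> to the last axis has determinant -1, a
  reflection of the last coordinate corrects it; \<open>c\<close> is then negative.\<close>

lemma rotation_to_last_axis:
  fixes w :: "real^'n::{finite,linorder}"
  assumes "w \<noteq> 0"
  obtains A A' c where "linear A" "linear A'" "det (matrix A) = 1" "det (matrix A') = 1"
    "\<And>x. A' (A x) = x" "\<And>x. A (A' x) = x" "c \<noteq> 0" "A w = axis last_index c"
proof -
  have "norm w = norm (axis last_index (norm w) :: real^'n::{finite,linorder})" by (simp add: norm_axis_real)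
  then obtain f :: "real^'n::{finite,linorder} \<Rightarrow> real^'n::{finite,linorder}"
    where f: "orthogonal_transformation f" "f w = axis last_index (norm w)"
    by (rule orthogonal_transformation_exists) (erule that, assumption)
  define R where "R x = (\<chi> i. (if i = last_index then -1 else 1) * x $ i)" for x :: "real^'n::{finite,linorder}"
  have R: "linear R"
  proof (rule linearI)
    show "R (x + y) = R x + R y" for x y by (simp add: R_def vec_eq_iff distrib_left)
    show "R (t *\<^sub>R x) = t *\<^sub>R R x" for t x by (simp add: R_def vec_eq_iff)
  qed
  have detR: "det (matrix R) = -1"
  proof -
    have "det (matrix R) = (\<Prod>i\<in>UNIV. matrix R $ i $ i)"
      by (rule det_diagonal) (simp add: matrix_def R_def axis_def)
    also have "\<dots> = (\<Prod>i\<in>UNIV. if i = (last_index :: 'n::{finite,linorder}) then - 1 else (1 :: real))"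
      by (simp add: matrix_def R_def axis_def)
    also have "\<dots> = -1" by (simp add: prod.delta)
    finally show ?thesis .
  qed
  have lf: "linear f" and df: "det (matrix f) = 1 \<or> det (matrix f) = -1"
    using f(1) orthogonal_transformation_matrix[of f] det_orthogonal_matrix[of "matrix f"] by auto
  obtain A c where A: "linear A" "det (matrix A) = 1" "c \<noteq> 0" "A w = axis last_index c" "bij A"
  proof (cases "det (matrix f) = 1")
    case True
    then show ?thesis using that[of f "norm w"] lf f assms orthogonal_transformation_bij[OF f(1)] by simp
  next
    case False
    have "det (matrix (R \<circ> f)) = 1"
      using False df detR matrix_compose[OF lf R] by (simp add: det_mul)
    moreover have "(R \<circ> f) w = axis last_index (- norm w)"
      by (auto simp: f(2) R_def axis_def vec_eq_iff)
    moreover have "R (R x) = x" for x by (simp add: R_def vec_eq_iff)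
    then have "bij R" by (metis involuntory_imp_bij)
    then have "bij (R \<circ> f)" using orthogonal_transformation_bij[OF f(1)] by (simp add: bij_comp)
    ultimately show ?thesis
      using that[of "R \<circ> f" "- norm w"] linear_compose[OF lf R] assms by simp
  qed
  have inv: "inv A (A x) = x" "A (inv A x) = x" for x
    using A(5) by (simp_all add: bij_is_inj bij_is_surj surj_f_inv_f)
  have linv: "linear (inv A)" using A(1,5) by (simp add: bij_is_inj inj_linear_imp_inv_linear)
  have "matrix (inv A \<circ> A) = matrix (inv A) ** matrix A" by (rule matrix_compose[OF A(1) linv])
  moreover have "inv A \<circ> A = id" using inv by auto
  ultimately have "det (matrix (inv A)) * det (matrix A) = 1"
    by (metis det_mul matrix_id)
  then have "det (matrix (inv A)) = 1" using A(2) by simp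
  then show ?thesis using that[of A "inv A" c] A inv linv by blast
qed

text \<open>Conjugation by the rotation makes the shear elementary: invariance of \<phi> along
  \<open>w\<close> becomes independence of the last coordinate.\<close>

lemma tame_composition_single_shear:
  fixes w :: "real^'n::{finite,linorder}" and \<phi> :: "real^'n::{finite,linorder} \<Rightarrow> real"
  assumes "C-lipschitz_on UNIV \<phi>" "\<phi> 0 = 0" "\<And>x s. \<phi> (x + s *\<^sub>R w) = \<phi> x" "w \<noteq> 0"
  shows "tame_composition (\<lambda>x. x + \<phi> x *\<^sub>R w)"
proof -
  obtain A A' c where A: "linear A" "linear A'" "det (matrix A) = 1" "det (matrix A') = 1"
    "\<And>x. A' (A x) = x" "\<And>x. A (A' x) = x" "c \<noteq> 0" "A w = axis last_index c"
    by (rule rotation_to_last_axis[OF assms(4)]) (rule that)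
  define h where "h y = \<phi> (A' y) *\<^sub>R (axis last_index c :: real^'n::{finite,linorder})" for y :: "real^'n::{finite,linorder}"
  have A'axis: "A' (axis last_index s) = (s / c) *\<^sub>R w" for s
  proof -
    have "axis last_index s = (s / c) *\<^sub>R A w" using A(7) by (simp add: A(8) vec_eq_iff axis_def)
    then show ?thesis by (simp add: linear_scale[OF A(2)] A(5))
  qed
  have inv: "\<phi> (A' (y + axis last_index s)) = \<phi> (A' y)" for y s
    by (simp add: linear_add[OF A(2)] A'axis assms(3))
  have scale: "t *\<^sub>R axis last_index c = axis last_index (t * c)" for t
    by (simp add: vec_eq_iff axis_def)
  have inv_minus: "\<phi> (A' (y - t *\<^sub>R axis last_index c)) = \<phi> (A' y)" for y t
  proof -
    have "y - t *\<^sub>R axis last_index c = y + axis last_index (- (t * c))"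
      by (simp add: vec_eq_iff axis_def)
    then show ?thesis by (simp only: inv)
  qed
  have "bilipschitz_homeo (\<lambda>y. y + h y)"
  proof -
    obtain D where D: "D-lipschitz_on UNIV A'"
      using bounded_linear.lipschitz_boundE[of A' UNIV] A(2) linear_conv_bounded_linear by blast
    have "(C * D)-lipschitz_on UNIV (\<lambda>y. \<phi> (A' y))"
      using D assms(1) by (intro lipschitz_on_compose2) (auto intro: lipschitz_on_subset)
    moreover have "\<bar>c\<bar>-lipschitz_on UNIV (\<lambda>t. t *\<^sub>R axis last_index c :: real^'n::{finite,linorder})"
      by (intro lipschitz_onI) (auto simp: dist_norm mult.commute norm_axis_real simp flip: scaleR_left_diff_distrib)
    ultimately have "(\<bar>c\<bar> * (C * D))-lipschitz_on UNIV h" unfolding h_def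
      by (intro lipschitz_on_compose2[where g = "\<lambda>t. t *\<^sub>R axis last_index c"]) (auto intro: lipschitz_on_subset)
    moreover have "h 0 = 0" by (simp add: h_def linear_0[OF A(2)] assms(2))
    moreover have "h (x + h x) = h x" for x unfolding h_def by (simp only: scale inv)
    moreover have "h (x - h x) = h x" for x unfolding h_def by (simp only: inv_minus)
    ultimately show ?thesis by (rule bilipschitz_homeo_shear)
  qed
  moreover have "elementary_map (\<lambda>y. y + h y)"
    unfolding elementary_map_def
  proof (intro exI[of _ "\<lambda>y. c * \<phi> (A' y)"] conjI allI impI)
    fix x y :: "real^'n::{finite,linorder}"
    assume eq: "\<forall>i. i \<noteq> last_index \<longrightarrow> x $ i = y $ i"
    have "x = y + axis last_index (x $ last_index - y $ last_index)"
      using eq by (auto simp: vec_eq_iff axis_def)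
    then show "c * \<phi> (A' x) = c * \<phi> (A' y)" using inv by metis
  qed (auto simp: h_def vec_eq_iff axis_def fun_eq_iff mult.commute)
  ultimately have "tame_composition (\<lambda>y. y + h y)"
    by (intro tame_composition.elementary bilipschitz_homeo_imp_germ)
  from tame_composition.comp[OF tame_composition.linear[OF A(2,4)]
      tame_composition.comp[OF this tame_composition.linear[OF A(1,3)]]]
  have "tame_composition (A' \<circ> ((\<lambda>y. y + h y) \<circ> A))" .
  moreover have "A' \<circ> ((\<lambda>y. y + h y) \<circ> A) = (\<lambda>x. x + \<phi> x *\<^sub>R w)"
    using A(7) by (simp add: fun_eq_iff h_def linear_add[OF A(2)] A(5) linear_scale[OF A(2)] A'axis)
  ultimately show ?thesis by simp
qed

text \<open>The components of \<open>h\<close> in an orthonormal basis of \<open>W\<close> are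
  applied one at a time; the other shears move points along \<open>W\<close>, where \<open>h\<close>
  is constant, so each component still sees \<open>h x\<close>.\<close>

lemma tame_germ_shear:
  fixes h :: "real^'n::{finite,linorder} \<Rightarrow> real^'n::{finite,linorder}"
  assumes "C-lipschitz_on UNIV h" "h 0 = 0" "subspace W" "\<And>x. h x \<in> W" "\<And>x w. w \<in> W \<Longrightarrow> h (x + w) = h x"
  shows "bilipschitz_homeo (\<lambda>x. x + h x)" "tame_composition (\<lambda>x. x + h x)"
proof -
  have minus: "h (x - w) = h x" if "w \<in> W" for x w
    using assms(5)[of "- w" x] that assms(3) by (simp add: subspace_neg)
  then show "bilipschitz_homeo (\<lambda>x. x + h x)"
    using assms by (intro bilipschitz_homeo_shear) auto
  obtain B where B: "finite B" "B \<subseteq> W" "\<And>b. b \<in> B \<Longrightarrow> norm b = 1"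
    "\<And>x. x \<in> W \<Longrightarrow> (\<Sum>b\<in>B. (x \<bullet> b) *\<^sub>R b) = x"
    using orthonormal_basis_subspace_expand[OF assms(3)] by blast
  have "tame_composition (\<lambda>x. x + (\<Sum>b\<in>B'. (h x \<bullet> b) *\<^sub>R b))" if "finite B'" "B' \<subseteq> B" for B'
    using that
  proof (induction B' rule: finite_induct)
    case empty
    have "det (matrix (\<lambda>x::real^'n::{finite,linorder}. x)) = 1" using matrix_id by (simp add: id_def)
    then show ?case by (intro tame_composition.linear) (auto simp: linear_id[unfolded id_def])
  next
    case (insert b B')
    then have b: "b \<in> B" by simp
    then have bW: "s *\<^sub>R b \<in> W" for s using B(2) assms(3) by (auto intro: subspace_scale)
    have "C-lipschitz_on UNIV (\<lambda>x. h x \<bullet> b)"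
    proof (rule lipschitz_onI)
      show "C \<ge> 0" using assms(1) by (rule lipschitz_on_nonneg)
      fix x y
      have "dist (h x \<bullet> b) (h y \<bullet> b) \<le> norm (h x - h y) * norm b"
        using Cauchy_Schwarz_ineq2[of "h x - h y" b] by (simp add: dist_real_def inner_diff_left)
      also have "\<dots> \<le> C * dist x y"
        using lipschitz_onD[OF assms(1), of x y] B(3)[OF b] by (simp add: dist_norm)
      finally show "dist (h x \<bullet> b) (h y \<bullet> b) \<le> C * dist x y" .
    qed
    moreover have "b \<noteq> 0" using B(3)[OF b] by auto
    ultimately have "tame_composition (\<lambda>x. x + (h x \<bullet> b) *\<^sub>R b)"
      using assms(2,5) bW by (intro tame_composition_single_shear) auto
    then have "tame_composition ((\<lambda>x. x + (h x \<bullet> b) *\<^sub>R b) \<circ> (\<lambda>x. x + (\<Sum>b\<in>B'. (h x \<bullet> b) *\<^sub>R b)))"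
      using insert by (intro tame_composition.comp) auto
    moreover have "h (x + (\<Sum>b\<in>B'. (h x \<bullet> b) *\<^sub>R b)) = h x" for x
      using insert.prems B(2) assms(3) by (intro assms(5) subspace_sum subspace_scale) auto
    ultimately show ?case using insert.hyps by (simp add: o_def add_ac)
  qed
  from this[OF B(1) order_refl] show "tame_composition (\<lambda>x. x + h x)" using B(4) assms(4) by simp
qed

section \<open>Representatives of the germs on small balls\<close>

text \<open>An infimum of natural numbers is attained at some radius, and the maximum in
  \<open>semialg_dim\<close> is a true bound since dimensions in the ambient space form a finite
  set.\<close>

lemma germ_dim_cells:
  fixes X :: "(real^'n) set"
  assumes "germ_dim X = k"
  obtains r where "r > 0" "cells_dim_le (X \<inter> ball 0 r) k"
proof -
  have "germ_dim X \<in> (\<lambda>r. semialg_dim (X \<inter> ball 0 r)) ` {0<..}"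
    unfolding germ_dim_def by (rule Inf_nat_def1) auto
  then obtain r where r: "r > 0" "semialg_dim (X \<inter> ball 0 r) = k" using assms by auto
  let ?D = "{d. \<exists>S V. subspace (S :: (real^'n) set) \<and> dim S = d \<and> V \<subseteq> X \<inter> ball 0 r \<and> S homeomorphic V}"
  have "?D \<subseteq> {..DIM(real^'n)}" using dim_subset_UNIV[where 'a = "real^'n"] by auto
  then have "finite ?D" by (rule finite_subset) simp
  then have "d \<le> k" if "d \<in> ?D" for d using Max_ge[OF _ that] r(2) unfolding semialg_dim_def by simp
  then have "cells_dim_le (X \<inter> ball 0 r) k" unfolding cells_dim_le_def by blast
  with r(1) show ?thesis by (rule that)
qed

lemma set_germ_eq_ball:
  assumes "set_germ_eq X Y"
  obtains r where "r > 0" "\<And>x. norm x < r \<Longrightarrow> x \<in> X \<longleftrightarrow> x \<in> Y"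
proof -
  obtain r where "r > 0" "\<And>x. dist x 0 < r \<Longrightarrow> x \<in> X \<longleftrightarrow> x \<in> Y"
    using assms unfolding set_germ_eq_def eventually_nhds_metric by blast
  then show ?thesis using that[of r] by (simp add: dist_norm)
qed

text \<open>\<open>s\<close> and \<open>k\<close> come after \<open>r\<close> because the ball on
  which cells are bounded is found later, and differently for the two germs.\<close>

lemma closed_semialgebraic_germ_growth:
  fixes X :: "(real^'n) set"
  assumes "closed_semialgebraic_germ X"
  obtains r where "r > 0" "0 \<in> X"
    "\<And>s k. s \<le> r \<Longrightarrow> cells_dim_le (X \<inter> ball 0 s) k \<Longrightarrow> poly_growth (X \<inter> ball 0 s) k"
proof -
  obtain Z where Z: "semialgebraic Z" "0 \<in> Z" "set_germ_eq X Z"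
    using assms unfolding closed_semialgebraic_germ_def by blast
  obtain r where r: "r > 0" "\<And>x. norm x < r \<Longrightarrow> x \<in> X \<longleftrightarrow> x \<in> Z"
    using set_germ_eq_ball[OF Z(3)] by blast
  have "poly_growth (X \<inter> ball 0 s) k" if "s \<le> r" "cells_dim_le (X \<inter> ball 0 s) k" for s k
  proof (rule poly_growth_loc_zero_set[OF _ that(2)])
    have "X \<inter> ball 0 s = Z \<inter> ball 0 s" using r(2) that(1) by auto
    then show "loc_zero_set (X \<inter> ball 0 s)"
      using semialgebraic_loc_zero_set[OF Z(1)] loc_zero_set_Int[OF _ loc_zero_set_open[OF open_ball]]
      by metis
  qed
  moreover have "0 \<in> X" using r Z(2) by simp
  ultimately show ?thesis using that r(1) by blast
qed

lemma bilipschitz_germE: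
  assumes "bilipschitz_germ X Y f"
  obtains U C D r where "f 0 = 0" "open U" "0 \<in> U" "C \<ge> 0" "D \<ge> 0" "r > 0"
    "\<And>x y. x \<in> X \<inter> U \<Longrightarrow> y \<in> X \<inter> U \<Longrightarrow> norm (f x - f y) \<le> C * norm (x - y)"
    "\<And>x y. x \<in> X \<inter> U \<Longrightarrow> y \<in> X \<inter> U \<Longrightarrow> norm (x - y) \<le> D * norm (f x - f y)"
    "\<And>y. norm y < r \<Longrightarrow> y \<in> f ` (X \<inter> U) \<longleftrightarrow> y \<in> Y"
proof -
  obtain U C D where U: "f 0 = 0" "open U" "0 \<in> U" "set_germ_eq (f ` (X \<inter> U)) Y" "inj_on f (X \<inter> U)"
    "C-lipschitz_on (X \<inter> U) f" "D-lipschitz_on (f ` (X \<inter> U)) (inv_into (X \<inter> U) f)"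
    using assms unfolding bilipschitz_germ_def by blast
  obtain r where r: "r > 0" "\<And>y. norm y < r \<Longrightarrow> y \<in> f ` (X \<inter> U) \<longleftrightarrow> y \<in> Y"
    using set_germ_eq_ball[OF U(4)] by blast
  have "norm (f x - f y) \<le> C * norm (x - y)" if "x \<in> X \<inter> U" "y \<in> X \<inter> U" for x y
    using lipschitz_onD[OF U(6) that] by (simp add: dist_norm)
  moreover have "norm (x - y) \<le> D * norm (f x - f y)" if "x \<in> X \<inter> U" "y \<in> X \<inter> U" for x y
    using lipschitz_onD[OF U(7) imageI[OF that(1)] imageI[OF that(2)]] U(5) that
    by (simp add: dist_norm inv_into_f_f)
  ultimately show ?thesis
    using that[of U C D r] U(1-3) r lipschitz_on_nonneg[OF U(6)] lipschitz_on_nonneg[OF U(7)] by blast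
qed

text \<open>The inverse of \<open>f\<close> carries cells in \<open>Y\<close> to cells in
  \<open>X\<close> of the same dimension; this bounds the dimension of the image without any
  algebraic property of \<open>f\<close>.\<close>

lemma cells_dim_le_bilipschitz_image:
  fixes X Y :: "(real^'n) set"
  assumes cells: "cells_dim_le X k" and Y: "Y \<subseteq> f ` X"
    and f: "\<And>x y. x \<in> X \<Longrightarrow> y \<in> X \<Longrightarrow> norm (f x - f y) \<le> C * norm (x - y)"
    and g: "\<And>x y. x \<in> X \<Longrightarrow> y \<in> X \<Longrightarrow> norm (x - y) \<le> D * norm (f x - f y)"
    and CD: "C \<ge> 0" "D \<ge> 0"
  shows "cells_dim_le Y k"
  unfolding cells_dim_le_def
proof (intro allI impI)
  fix S V :: "(real^'n) set"
  assume S: "subspace S" and V: "V \<subseteq> Y" and hom: "S homeomorphic V"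
  define g where "g = inv_into X f"
  have gX: "g y \<in> X" and fg: "f (g y) = y" if "y \<in> V" for y
    using that V Y unfolding g_def by (auto intro: inv_into_into f_inv_into_f)
  have "C-lipschitz_on X f" using f CD by (intro lipschitz_onI) (auto simp: dist_norm)
  moreover have "D-lipschitz_on V g"
  proof (rule lipschitz_onI[OF _ CD(2)])
    fix x y assume "x \<in> V" "y \<in> V"
    then show "dist (g x) (g y) \<le> D * dist x y"
      using g[OF gX gX, of x y] fg by (simp add: dist_norm)
  qed
  moreover have "g (f (g y)) = g y" if "y \<in> V" for y using fg[OF that] by simp
  ultimately have "V homeomorphic g ` V"
    using fg gX by (intro homeomorphicI[of g V _ f])
      (auto simp: image_image intro!: lipschitz_on_continuous_on intro: lipschitz_on_subset)
  then have "S homeomorphic g ` V" using hom homeomorphic_trans by blast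
  moreover have "g ` V \<subseteq> X" using gX by blast
  ultimately show "dim S \<le> k" using cells S unfolding cells_dim_le_def by blast
qed

theorem theorem5p6:
  fixes X Y :: "(real^'n::{finite,linorder}) set"
    and f :: "real^'n::{finite,linorder} \<Rightarrow> real^'n::{finite,linorder}"
    and k :: nat
  assumes "closed_semialgebraic_germ X"
    and "germ_dim X = k"
    and "closed_semialgebraic_germ Y"
    and "bilipschitz_germ X Y f"
    and "CARD('n) \<ge> 4 * k"
  shows "(\<exists>F. tame_germ F \<and> map_germ_eq_on X F f) \<and>
         (\<exists>F :: real \<Rightarrow> (real, 'n) vec \<Rightarrow> (real, 'n) vec.
            (\<forall>t. tame_germ (F t)) \<and> continuous_germ_family F \<and>
            map_germ_eq_on UNIV (F 0) id \<and> map_germ_eq_on X (F 1) f)"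
proof -
  obtain U C D rY where f0: "f 0 = 0" and U: "open U" "0 \<in> U" and CD: "C \<ge> 0" "D \<ge> 0" and rY: "rY > 0"
    and lip: "\<And>x y. x \<in> X \<inter> U \<Longrightarrow> y \<in> X \<inter> U \<Longrightarrow> norm (f x - f y) \<le> C * norm (x - y)"
      "\<And>x y. x \<in> X \<inter> U \<Longrightarrow> y \<in> X \<inter> U \<Longrightarrow> norm (x - y) \<le> D * norm (f x - f y)"
    and Y: "\<And>y. norm y < rY \<Longrightarrow> y \<in> f ` (X \<inter> U) \<longleftrightarrow> y \<in> Y"
    by (rule bilipschitz_germE[OF assms(4)]) (rule that)
  obtain rU where rU: "rU > 0" "ball 0 rU \<subseteq> U" using U by (meson open_contains_ball)
  obtain rX where rX: "rX > 0" "0 \<in> X"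
    "\<And>s k. s \<le> rX \<Longrightarrow> cells_dim_le (X \<inter> ball 0 s) k \<Longrightarrow> poly_growth (X \<inter> ball 0 s) k"
    by (rule closed_semialgebraic_germ_growth[OF assms(1)]) (rule that)
  obtain rY' where rY': "rY' > 0" "0 \<in> Y"
    "\<And>s k. s \<le> rY' \<Longrightarrow> cells_dim_le (Y \<inter> ball 0 s) k \<Longrightarrow> poly_growth (Y \<inter> ball 0 s) k"
    by (rule closed_semialgebraic_germ_growth[OF assms(3)]) (rule that)
  obtain rc where rc: "rc > 0" "cells_dim_le (X \<inter> ball 0 rc) k" by (rule germ_dim_cells[OF assms(2)])
  define r1 where "r1 = min rU (min rX rc)"
  have r1: "r1 > 0" "ball 0 r1 \<subseteq> U" "r1 \<le> rX" "r1 \<le> rc" using rU rX rc by (auto simp: r1_def)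
  define X1 where "X1 = X \<inter> ball 0 r1"
  have X1: "X1 \<subseteq> X \<inter> U" using r1 by (auto simp: X1_def)
  have cellsX: "cells_dim_le X1 k"
    using rc(2) by (rule cells_dim_le_subset) (use r1 in \<open>auto simp: X1_def\<close>)
  then have growthX: "poly_growth X1 k" unfolding X1_def by (rule rX(3)[OF r1(3)])
  \<comment> \<open>A point of \<open>Y\<close> of norm less than \<open>r2\<close> has a preimage
    of norm at most \<open>D * r2\<close>, which is below \<open>r1\<close>.\<close>
  define r2 where "r2 = min (min rY rY') (r1 / (D + 1))"
  have r2: "r2 > 0" "r2 \<le> rY" "r2 \<le> rY'" using rY rY' r1 CD by (auto simp: r2_def)
  have "r2 \<le> r1 / (D + 1)" by (simp add: r2_def)
  then have r2D: "r2 * (D + 1) \<le> r1" using CD by (simp add: pos_le_divide_eq)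
  define Y1 where "Y1 = Y \<inter> ball 0 r2"
  have "Y1 \<subseteq> f ` X1"
  proof
    fix y assume "y \<in> Y1"
    then have y: "y \<in> Y" "norm y < r2" by (auto simp: Y1_def)
    then obtain x where x: "x \<in> X \<inter> U" "y = f x" using Y[of y] r2(2) by auto
    have "norm x \<le> D * norm y" using lip(2)[OF x(1), of 0] rX(2) U(2) f0 x(2) by simp
    also have "\<dots> \<le> D * r2" using y(2) CD(2) by (intro mult_left_mono) auto
    also have "\<dots> < r2 * (D + 1)" using r2(1) by (simp add: algebra_simps)
    finally have "x \<in> X1" using r2D x(1) by (simp add: X1_def)
    then show "y \<in> f ` X1" using x(2) by blast
  qed
  with cellsX have "cells_dim_le Y1 k"
    by (rule cells_dim_le_bilipschitz_image[where C = C and D = D]) (use X1 lip CD in blast)+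
  then have growthY: "poly_growth Y1 k" unfolding Y1_def by (rule rY'(3)[OF r2(3)])
  obtain V W where V: "subspace V" and W: "subspace W" and VW: "V \<inter> W = {0}" "dim V + dim W = CARD('n)"
    and secX: "\<And>u. u \<in> secant_cone X1 \<Longrightarrow> u \<in> W \<Longrightarrow> u = 0"
    and secY: "\<And>u. u \<in> secant_cone Y1 \<Longrightarrow> u \<in> V \<Longrightarrow> u = 0"
    by (rule complementary_subspaces_avoiding_secants[OF growthX growthY assms(5)]) (rule that)
  obtain P where P: "linear P" "\<And>x. P x \<in> V" "\<And>x. x - P x \<in> W" "\<And>x. x \<in> V \<Longrightarrow> P x = x" "\<And>x. x \<in> W \<Longrightarrow> P x = 0"
    by (rule projection_along_complement[OF V W VW(1)]) (use VW(2) in simp, rule that)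
  \<comment> \<open>The complementary projection, onto \<open>W\<close> along
    \<open>V\<close>.\<close>
  define Q where "Q x = x - P x" for x
  have linQ: "linear Q" unfolding Q_def by (intro linear_compose_sub linear_id[unfolded id_def] P(1))
  have QW: "Q x \<in> W" for x using P(3) by (simp add: Q_def)
  have bP: "bounded_linear P" and bQ: "bounded_linear Q"
    using P(1) linQ by (simp_all add: linear_conv_bounded_linear)
  have secP: "u = 0" if "u \<in> secant_cone X1" "P u = 0" for u
    using secX[OF that(1)] P(3)[of u] that(2) by simp
  obtain LX r3 where r3: "r3 > 0"
    "\<And>x y. x \<in> X1 \<inter> ball 0 r3 \<Longrightarrow> y \<in> X1 \<inter> ball 0 r3 \<Longrightarrow> norm (x - y) \<le> LX * norm (P (x - y))"
    by (rule projection_injective_near_0[OF P(1) secP]) (assumption, assumption, rule that)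
  have secQ: "u = 0" if "u \<in> secant_cone Y1" "Q u = 0" for u
    using secY[OF that(1)] P(2)[of u] that(2) by (simp add: Q_def)
  obtain LY r4 where r4: "r4 > 0"
    "\<And>x y. x \<in> Y1 \<inter> ball 0 r4 \<Longrightarrow> y \<in> Y1 \<inter> ball 0 r4 \<Longrightarrow> norm (x - y) \<le> LY * norm (Q (x - y))"
    by (rule projection_injective_near_0[OF linQ secQ]) (assumption, assumption, rule that)
  \<comment> \<open>The factor \<open>C + 1\<close> ensures that \<open>f\<close> maps
    \<open>A\<close> into \<open>Y1\<close> and into \<open>ball 0 r4\<close>.\<close>
  define r where "r = min (min r1 r3) (min r2 r4 / (C + 1))"
  have "min r2 r4 / (C + 1) > 0" using r2(1) r4(1) CD by (intro divide_pos_pos) auto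
  then have r: "r > 0" "r \<le> r1" "r \<le> r3" using r1(1) r3(1) by (auto simp: r_def)
  have "r \<le> min r2 r4 / (C + 1)" by (simp add: r_def)
  then have rC: "r * (C + 1) \<le> min r2 r4" using CD by (simp add: pos_le_divide_eq)
  define A where "A = X \<inter> ball 0 r"
  have AX: "A \<subseteq> X1 \<inter> ball 0 r3" using r by (auto simp: A_def X1_def)
  then have AU: "A \<subseteq> X \<inter> U" using X1 by blast
  have "0 \<in> A" using rX(2) r(1) by (simp add: A_def)
  have AY: "f x \<in> Y1 \<inter> ball 0 r4" if "x \<in> A" for x
  proof -
    have xU: "x \<in> X \<inter> U" using that AU by blast
    have "norm (f x) \<le> C * norm x" using lip(1)[OF xU, of 0] rX(2) U(2) f0 by simp
    also have "\<dots> \<le> C * r" using that CD(1) by (intro mult_left_mono) (auto simp: A_def)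
    also have "\<dots> < r * (C + 1)" using r(1) by (simp add: algebra_simps)
    finally have n: "norm (f x) < r2" "norm (f x) < r4" using rC by auto
    then have "f x \<in> Y" using Y[of "f x"] r2(2) xU by auto
    then show ?thesis using n by (simp add: Y1_def)
  qed
  obtain KP where KP: "KP > 0" "\<And>x. norm (P x) \<le> norm x * KP" using bounded_linear.pos_bounded[OF bP] by blast
  obtain KQ where KQ: "KQ > 0" "\<And>x. norm (Q x) \<le> norm x * KQ" using bounded_linear.pos_bounded[OF bQ] by blast
  define v where "v x = f x - x" for x
  have vdiff: "norm (v x - v y) \<le> norm (f x - f y) + norm (x - y)" for x y
    using norm_triangle_ineq4[of "f x - f y" "x - y"] by (simp add: v_def algebra_simps)
  \<comment> \<open>On \<open>A\<close> the projection \<open>P\<close> has a Lipschitz inverse, so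
    the \<open>W\<close> part of the displacement is a Lipschitz function of \<open>P x\<close>, and
    a function of \<open>P x\<close> alone is constant along \<open>W\<close>.\<close>
  have lipQ: "norm (Q (v x) - Q (v y)) \<le> ((C + 1) * LX * KQ) * dist (P x) (P y)" if xy: "x \<in> A" "y \<in> A" for x y
  proof -
    have "norm (f x - f y) \<le> C * norm (x - y)" using lip(1)[of x y] xy AU by blast
    then have "norm (v x - v y) \<le> (C + 1) * norm (x - y)"
      using vdiff[of x y] by (simp add: distrib_right)
    also have "\<dots> \<le> (C + 1) * (LX * norm (P (x - y)))"
      using CD(1) xy[THEN subsetD[OF AX]] by (intro mult_left_mono r3(2)) simp_all
    finally have "norm (v x - v y) * KQ \<le> (C + 1) * (LX * norm (P (x - y))) * KQ"
      using KQ(1) by (intro mult_right_mono) auto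
    then show ?thesis using KQ(2)[of "v x - v y"]
      by (simp add: linear_diff[OF linQ] linear_diff[OF P(1)] dist_norm mult_ac)
  qed
  obtain \<eta> C\<eta> where \<eta>: "C\<eta>-lipschitz_on UNIV \<eta>" "\<And>z. \<eta> z \<in> W" "\<And>x. x \<in> A \<Longrightarrow> \<eta> (P x) = Q (v x)"
    by (rule lipschitz_extension_subspace[of W A "\<lambda>x. Q (v x)" _ P, OF W QW lipQ])
      (assumption, assumption, rule that)
  \<comment> \<open>The second shear meets the point \<open>P x + Q (f x)\<close>, so its
    displacement must be a function of \<open>Q (f x)\<close>; here the estimate on
    \<open>Y1\<close> is used.\<close>
  have lipP: "norm (P (v x) - P (v y)) \<le> ((1 + D) * LY * KP) * dist (Q (f x)) (Q (f y))"
    if xy: "x \<in> A" "y \<in> A" for x y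
  proof -
    have "norm (x - y) \<le> D * norm (f x - f y)" using lip(2)[of x y] xy AU by blast
    then have "norm (v x - v y) \<le> (1 + D) * norm (f x - f y)"
      using vdiff[of x y] by (simp add: distrib_right)
    also have "\<dots> \<le> (1 + D) * (LY * norm (Q (f x - f y)))"
      using CD(2) xy by (intro mult_left_mono r4(2) AY) simp_all
    finally have "norm (v x - v y) * KP \<le> (1 + D) * (LY * norm (Q (f x - f y))) * KP"
      using KP(1) by (intro mult_right_mono) auto
    then show ?thesis using KP(2)[of "v x - v y"]
      by (simp add: linear_diff[OF linQ] linear_diff[OF P(1)] dist_norm mult_ac)
  qed
  obtain \<delta> C\<delta> where \<delta>: "C\<delta>-lipschitz_on UNIV \<delta>" "\<And>z. \<delta> z \<in> V" "\<And>x. x \<in> A \<Longrightarrow> \<delta> (Q (f x)) = P (v x)"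
    by (rule lipschitz_extension_subspace[of V A "\<lambda>x. P (v x)" _ "\<lambda>x. Q (f x)", OF V P(2) lipP])
      (assumption, assumption, rule that)
  have PQ: "P (Q x) = 0" "Q (P x) = 0" "P (P x) = P x" "Q (Q x) = Q x" for x
    using P(4)[OF P(2)] P(5)[OF QW] by (simp_all add: Q_def linear_diff[OF P(1)])
  have \<eta>0: "\<eta> 0 = 0" using \<eta>(3)[OF \<open>0 \<in> A\<close>] by (simp add: v_def f0 linear_0[OF P(1)] linear_0[OF linQ])
  have \<delta>0: "\<delta> 0 = 0" using \<delta>(3)[OF \<open>0 \<in> A\<close>] by (simp add: v_def f0 linear_0[OF P(1)] linear_0[OF linQ])
  define F1 where "F1 t x = x + t *\<^sub>R \<eta> (P x)" for t x
  define F2 where "F2 t x = x + t *\<^sub>R \<delta> (Q x)" for t x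
  \<comment> \<open>Both shears are invertible for every real \<open>t\<close>, so the family is
    defined beyond the interval from 0 to 1.\<close>
  define F where "F t = F2 t \<circ> F1 t" for t
  have F1: "bilipschitz_homeo (F1 t)" "tame_composition (F1 t)" for t
  proof -
    obtain B where B: "B-lipschitz_on UNIV P" using bounded_linear.lipschitz_boundE[OF bP] by blast
    have l: "(\<bar>t\<bar> * (C\<eta> * B))-lipschitz_on UNIV (\<lambda>x. t *\<^sub>R \<eta> (P x))"
      by (intro lipschitz_on_cmult lipschitz_on_compose2[OF B] lipschitz_on_subset[OF \<eta>(1)]) simp
    show "bilipschitz_homeo (F1 t)" "tame_composition (F1 t)" unfolding F1_def
      by (rule tame_germ_shear[OF l _ W];
          simp add: linear_0[OF P(1)] \<eta>0 subspace_scale[OF W \<eta>(2)] linear_add[OF P(1)] P(5))+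
  qed
  have F2: "bilipschitz_homeo (F2 t)" "tame_composition (F2 t)" for t
  proof -
    obtain B where B: "B-lipschitz_on UNIV Q" using bounded_linear.lipschitz_boundE[OF bQ] by blast
    have l: "(\<bar>t\<bar> * (C\<delta> * B))-lipschitz_on UNIV (\<lambda>x. t *\<^sub>R \<delta> (Q x))"
      by (intro lipschitz_on_cmult lipschitz_on_compose2[OF B] lipschitz_on_subset[OF \<delta>(1)]) simp
    have QV: "Q w = 0" if "w \<in> V" for w using P(4)[OF that] by (simp add: Q_def)
    show "bilipschitz_homeo (F2 t)" "tame_composition (F2 t)" unfolding F2_def
      by (rule tame_germ_shear[OF l _ V];
          simp add: linear_0[OF linQ] \<delta>0 subspace_scale[OF V \<delta>(2)] linear_add[OF linQ] QV)+
  qed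
  have tame: "tame_germ (F t)" for t unfolding tame_germ_def F_def
    by (intro conjI bilipschitz_homeo_imp_germ bilipschitz_homeo_comp tame_composition.comp F1 F2)
  have "F 1 x = f x" if "x \<in> A" for x
  proof -
    have F1x: "F1 1 x = P x + Q (f x)"
      using \<eta>(3)[OF that] by (simp add: F1_def v_def linear_diff[OF linQ]) (simp add: Q_def)
    have "F 1 x = P x + Q (f x) + \<delta> (Q (f x))"
      by (simp add: F_def F1x F2_def linear_add[OF linQ] PQ)
    also have "\<dots> = f x" using \<delta>(3)[OF that] by (simp add: v_def linear_diff[OF P(1)]) (simp add: Q_def)
    finally show ?thesis .
  qed
  moreover have "\<forall>\<^sub>F x in nhds 0. x \<in> ball (0 :: real^'n::{finite,linorder}) r"
    using r(1) by (intro eventually_nhds_in_open) auto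
  ultimately have ext: "map_germ_eq_on X (F 1) f" unfolding map_germ_eq_on_def
    by (elim eventually_mono) (auto simp: A_def)
  have "map_germ_eq_on UNIV (F 0) id"
    unfolding map_germ_eq_on_def by (simp add: F_def F1_def F2_def)
  moreover have "continuous_germ_family F" unfolding continuous_germ_family_def
  proof (intro exI[of _ UNIV] conjI)
    have c\<eta>: "continuous_on UNIV \<eta>" and c\<delta>: "continuous_on UNIV \<delta>"
      using \<eta>(1) \<delta>(1) by (auto intro: lipschitz_on_continuous_on)
    have cP: "continuous_on UNIV P" and cQ: "continuous_on UNIV Q"
      using bP bQ by (simp_all add: linear_continuous_on)
    have 1: "continuous_on UNIV (\<lambda>p. F1 (snd p) (fst p))" unfolding F1_def
      by (intro continuous_intros continuous_on_compose2[OF c\<eta>] continuous_on_compose2[OF cP]) auto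
    have "continuous_on UNIV (\<lambda>p. F1 (snd p) (fst p) + snd p *\<^sub>R \<delta> (Q (F1 (snd p) (fst p))))"
      by (intro continuous_intros 1 continuous_on_compose2[OF c\<delta>] continuous_on_compose2[OF cQ 1]) auto
    then show "continuous_on UNIV (\<lambda>(x, t). F t x)"
      by (simp add: F_def F2_def case_prod_unfold)
  qed auto
  ultimately show ?thesis using tame ext by blast
qed

end
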